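(* Let $a>0$, $\alpha\in(0,2)$, and let $\sigma\colon\mathbb{R}^2\times\mathbb{R}_+\to\mathbb{R}$ be bounded ($|\sigma(x,t)|\le C$ for all $t\ge0$, $x\in\mathbb{R}^2$) and continuous. Let $U(x,t)=\iint_{\mathbb{R}^2}G(x,y,t)\,M(dy)$ with $G(x,y,t)=\frac{1}{2\pi a}\int_0^{t-|x-y|/a}\frac{\sigma(y,\tau)}{\sqrt{a^2(t-\tau)^2-|y-x|^2}}\,d\tau\,\mathbf{1}_{\{|x-y|<at\}}$. For $\theta\in\mathcal D(\mathbb{R}^2\times\mathbb{R}_+)$ consider the identity $$\int_0^{\infty}\iint_{\mathbb{R}^2}U(x,t)\Big(\frac{\partial^2}{\partial t^2}\theta(x,t)-a^2\Delta\theta(x,t)\Big)\,dx\,dt=\int_0^{\infty}\iint_{\mathbb{R}^2}\theta(x,t)\sigma(x,t)\,M(dx)\,dt. \quad ( * )$$ 1. If $\alpha\in(0,1)$, then there is $\Omega_0\in\mathcal F$ with $\mathbb{P}(\Omega_0)=1$ such that, for all $\omega\in\Omega_0$ and all $\theta\in\mathcal D(\mathbb{R}^2\times\mathbb{R}_+)$, the identity $( * )$ holds. 2. If $\alpha\in[1,2)$, then, for any $\theta\in\mathcal D(\mathbb{R}^2\times\mathbb{R}_+)$, the identity $( * )$ holds almost surely.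
   Context: $(\Omega,\mathcal F,\mathbb{P})$ is a complete probability space and $M$ is an independently scattered symmetric $\alpha$-stable random measure on $\mathbb{R}^2$ with Lebesgue control measure, assumed to be given by its LePage series $M(A)=C_\alpha\sum_{k\ge1}\Gamma_k^{-1/\alpha}\varphi(\xi_k)^{-1/\alpha}\mathbf{1}_A(\xi_k)g_k$, where $\varphi$ is a continuous positive probability density on $\mathbb{R}^2$, $\Gamma_k$ are arrival times of a unit-intensity Poisson process, $\xi_k$ are i.i.d. with density $\varphi$, $g_k$ are i.i.d. centered Gaussian with $\mathbb{E}|g_k|^\alpha=1$, these three families are independent, and $C_\alpha=\big(\frac{\Gamma(2-\alpha)\cos(\pi\alpha/2)}{1-\alpha}\big)^{1/\alpha}$. Integrals $\iint f\,dM$ for $f\in L^\alpha(\mathbb{R}^2)$ are given by the corresponding almost surely convergent LePage series $C_\alpha\sum_k\Gamma_k^{-1/\alpha}\varphi(\xi_k)^{-1/\alpha}f(\xi_k)g_k$; in particular the right-hand side of $( * )$ is $C_\alpha\int_0^\infty\sum_k\Gamma_k^{-1/\alpha}\varphi(\xi_k)^{-1/\alpha}\theta(\xi_k,t)\sigma(\xi_k,t)g_k\,dt$. $\mathcal D(\mathbb{R}^2\times\mathbb{R}_+)$ is the class of compactly supported infinitely differentiable functions on $\mathbb{R}^2\times\mathbb{R}_+$, and $\mathbb{R}_+=[0,\infty)$. The identity $( * )$ expresses that $U$ is a generalized solution of $\big(\frac{\partial^2}{\partial t^2}-a^2\Delta\big)U(x,t)=\sigma(x,t)\dot M(x)$ with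 zero initial conditions. *)

theory Defs
  imports "HOL-Probability.Probability"
begin

text \<open>Points of the plane are modelled as real \<times> real (Euclidean norm, lborel = Lebesgue measure).\<close>

text \<open>The constant C_alpha; at alpha = 1 the formula is read as its limit pi/2.\<close>
definition stable_const :: "real \<Rightarrow> real" where
  "stable_const \<alpha> = (if \<alpha> = 1 then pi / 2
     else (Gamma (2 - \<alpha>) * cos (pi * \<alpha> / 2) / (1 - \<alpha>)) powr (1 / \<alpha>))"

definition gen_sets :: "'w measure \<Rightarrow> ('w \<Rightarrow> 'b::topological_space) \<Rightarrow> 'w set set" where
  "gen_sets P X = {X -` A \<inter> space P | A. A \<in> sets borel}"

definition lepage_data ::
  "'w measure \<Rightarrow> real \<Rightarrow> (real \<times> real \<Rightarrow> real) \<Rightarrow> (nat \<Rightarrow> 'w \<Rightarrow> real)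
     \<Rightarrow> (nat \<Rightarrow> 'w \<Rightarrow> real \<times> real) \<Rightarrow> (nat \<Rightarrow> 'w \<Rightarrow> real) \<Rightarrow> bool" where
  "lepage_data P \<alpha> \<phi> E \<xi> g \<longleftrightarrow>
     prob_space P \<and> complete_measure P \<and>
     continuous_on UNIV \<phi> \<and> (\<forall>x. 0 < \<phi> x) \<and> (\<integral>\<^sup>+ x. ennreal (\<phi> x) \<partial>lborel) = 1 \<and>
     (\<forall>k. distributed P lborel (E k) (\<lambda>x. ennreal (exponential_density 1 x))) \<and>
     (\<forall>k. distributed P lborel (\<xi> k) (\<lambda>x. ennreal (\<phi> x))) \<and>
     (\<exists>s>0. \<forall>k. distributed P lborel (g k) (\<lambda>x. ennreal (normal_density 0 s x))) \<and>
     (\<forall>k. prob_space.expectation P (\<lambda>\<omega>. \<bar>g k \<omega>\<bar> powr \<alpha>) = 1) \<and>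
     prob_space.indep_sets P
       (\<lambda>i. case i of Inl k \<Rightarrow> gen_sets P (E k)
                    | Inr (Inl k) \<Rightarrow> gen_sets P (\<xi> k)
                    | Inr (Inr k) \<Rightarrow> gen_sets P (g k)) UNIV"

text \<open>Arrival times of the unit-intensity Poisson process: arrival E k = Gamma_(k+1).\<close>
definition arrival :: "(nat \<Rightarrow> 'w \<Rightarrow> real) \<Rightarrow> nat \<Rightarrow> 'w \<Rightarrow> real" where
  "arrival E k \<omega> = (\<Sum>i\<le>k. E i \<omega>)"

definition lepage_term ::
  "real \<Rightarrow> (real \<times> real \<Rightarrow> real) \<Rightarrow> (nat \<Rightarrow> 'w \<Rightarrow> real) \<Rightarrow> (nat \<Rightarrow> 'w \<Rightarrow> real \<times> real)
     \<Rightarrow> (nat \<Rightarrow> 'w \<Rightarrow> real) \<Rightarrow> (real \<times> real \<Rightarrow> real) \<Rightarrow> nat \<Rightarrow> 'w \<Rightarrow> real" where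
  "lepage_term \<alpha> \<phi> E \<xi> g f k \<omega> =
     arrival E k \<omega> powr (-1 / \<alpha>) * \<phi> (\<xi> k \<omega>) powr (-1 / \<alpha>) * f (\<xi> k \<omega>) * g k \<omega>"

text \<open>Stochastic integral of f against M, given by its LePage series.\<close>
definition stable_integral ::
  "real \<Rightarrow> (real \<times> real \<Rightarrow> real) \<Rightarrow> (nat \<Rightarrow> 'w \<Rightarrow> real) \<Rightarrow> (nat \<Rightarrow> 'w \<Rightarrow> real \<times> real)
     \<Rightarrow> (nat \<Rightarrow> 'w \<Rightarrow> real) \<Rightarrow> (real \<times> real \<Rightarrow> real) \<Rightarrow> 'w \<Rightarrow> real" where
  "stable_integral \<alpha> \<phi> E \<xi> g f \<omega> = stable_const \<alpha> * (\<Sum>k. lepage_term \<alpha> \<phi> E \<xi> g f k \<omega>)"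

definition green_kernel ::
  "real \<Rightarrow> (real \<times> real \<Rightarrow> real \<Rightarrow> real) \<Rightarrow> real \<times> real \<Rightarrow> real \<times> real \<Rightarrow> real \<Rightarrow> real" where
  "green_kernel a \<sigma> x y t =
     (if dist x y < a * t then
        1 / (2 * pi * a) *
        (LINT \<tau>:{0..t - dist x y / a}|lborel. \<sigma> y \<tau> / sqrt ((a * (t - \<tau>))\<^sup>2 - (dist y x)\<^sup>2))
      else 0)"

definition wave_sol ::
  "real \<Rightarrow> (real \<times> real \<Rightarrow> real) \<Rightarrow> (nat \<Rightarrow> 'w \<Rightarrow> real) \<Rightarrow> (nat \<Rightarrow> 'w \<Rightarrow> real \<times> real)
     \<Rightarrow> (nat \<Rightarrow> 'w \<Rightarrow> real) \<Rightarrow> real \<Rightarrow> (real \<times> real \<Rightarrow> real \<Rightarrow> real)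
     \<Rightarrow> real \<times> real \<Rightarrow> real \<Rightarrow> 'w \<Rightarrow> real" where
  "wave_sol \<alpha> \<phi> E \<xi> g a \<sigma> x t \<omega> = stable_integral \<alpha> \<phi> E \<xi> g (\<lambda>y. green_kernel a \<sigma> x y t) \<omega>"

definition pdiff :: "nat \<Rightarrow> (real \<times> real \<Rightarrow> real \<Rightarrow> real) \<Rightarrow> (real \<times> real \<Rightarrow> real \<Rightarrow> real)" where
  "pdiff i f = (\<lambda>x t.
     if i = 0 then deriv (\<lambda>s. f (s, snd x) t) (fst x)
     else if i = 1 then deriv (\<lambda>s. f (fst x, s) t) (snd x)
     else deriv (\<lambda>s. f x s) t)"

definition partial_exists :: "nat \<Rightarrow> (real \<times> real \<Rightarrow> real \<Rightarrow> real) \<Rightarrow> bool" where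
  "partial_exists i f \<longleftrightarrow> (\<forall>x t.
     (if i = 0 then (\<lambda>s. f (s, snd x) t) differentiable (at (fst x))
      else if i = 1 then (\<lambda>s. f (fst x, s) t) differentiable (at (snd x))
      else (\<lambda>s. f x s) differentiable (at t)))"

definition smooth3 :: "(real \<times> real \<Rightarrow> real \<Rightarrow> real) \<Rightarrow> bool" where
  "smooth3 f \<longleftrightarrow> (\<forall>ds. set ds \<subseteq> {0,1,2} \<longrightarrow>
     continuous_on UNIV (\<lambda>(x, t). foldr pdiff ds f x t) \<and>
     (\<forall>i\<in>{0,1,2}. partial_exists i (foldr pdiff ds f)))"

text \<open>Test functions D(R^2 x R_+): restrictions to R^2 x [0,oo) of C-infinity functions on R^3
  whose support in R^2 x [0,oo) is compact (equivalently bounded).\<close>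
definition test_fun :: "(real \<times> real \<Rightarrow> real \<Rightarrow> real) \<Rightarrow> bool" where
  "test_fun \<theta> \<longleftrightarrow> smooth3 \<theta> \<and> bounded {(x, t). 0 \<le> t \<and> \<theta> x t \<noteq> 0}"

definition wave_op :: "real \<Rightarrow> (real \<times> real \<Rightarrow> real \<Rightarrow> real) \<Rightarrow> real \<times> real \<Rightarrow> real \<Rightarrow> real" where
  "wave_op a \<theta> x t = pdiff 2 (pdiff 2 \<theta>) x t
     - a\<^sup>2 * (pdiff 0 (pdiff 0 \<theta>) x t + pdiff 1 (pdiff 1 \<theta>) x t)"

definition weak_lhs where
  "weak_lhs \<alpha> \<phi> E \<xi> g a \<sigma> \<theta> \<omega> =
     (LINT t:{0..}|lborel. (LINT x|lborel. wave_sol \<alpha> \<phi> E \<xi> g a \<sigma> x t \<omega> * wave_op a \<theta> x t))"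

definition weak_rhs where
  "weak_rhs \<alpha> \<phi> E \<xi> g \<sigma> \<theta> \<omega> =
     stable_const \<alpha> *
     (LINT t:{0..}|lborel. (\<Sum>k. lepage_term \<alpha> \<phi> E \<xi> g (\<lambda>y. \<theta> y t * \<sigma> y t) k \<omega>))"

end

theory Submission
  imports Defs
begin

text \<open>
  Both sides of the identity are integrals of LePage series. Interchanging summation and integration
  turns them into the series of \<open>y \<mapsto> \<integral>\<integral> G(x,y,t) (\<theta>\<^sub>t\<^sub>t - a\<^sup>2 \<Delta>\<theta>)(x,t) dx dt\<close> and of
  \<open>y \<mapsto> \<integral> \<theta>(y,t) \<sigma>(y,t) dt\<close>. These two functions agree because the kernel
  \<open>1 / (2 \<pi> a sqrt (a\<^sup>2 t\<^sup>2 - |x|\<^sup>2))\<close> on the cone \<open>|x| < a t\<close> is the fundamental solution of the wave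
  operator in the plane: it is the projection of the surface measure of a hemisphere, and in spherical
  coordinates on the cone the integrand \<open>\<theta>\<^sub>t\<^sub>t - a\<^sup>2 \<Delta>\<theta>\<close> becomes a divergence.

  The arrival times grow linearly almost surely. For \<open>\<alpha> < 1\<close> the coefficients in any bounded region are
  therefore absolutely summable outside one null set, and the interchange is Fubini's theorem for each
  outcome. For \<open>\<alpha> \<ge> 1\<close> the terms are orthogonal, since each Gaussian factor is independent of all the
  other data. Kolmogorov's maximal inequality gives convergence almost everywhere, and the remainders
  tend to 0 in mean, uniformly enough to be integrated over the parameter; this needs the Green
  function to be square integrable in \<open>y\<close>, which holds as its singularity at \<open>y = x\<close> is logarithmic.
\<close>

section \<open>Convergence of orthogonal series\<close>

text \<open>The Green function inherits only the regularity of \<sigma>, so the wave operator never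
  acts on it. It is written as a superposition, over emission times \<tau>, of kernels started at
  \<open>(y, \<tau>)\<close>. Each of them, tested against the wave operator of \<theta>, returns
  \<open>\<theta> y \<tau>\<close>, and \<sigma> enters only as a weight in the \<tau>-integral. The
  kernel blows up at the boundary of the cone; in the spherical coordinates this singularity cancels
  against the Jacobian, and what remains is continuous on a compact box.

  The factor \<open>\<phi> powr (-1/\<alpha>)\<close> of the series is unbounded at infinity. Finite
  propagation speed saves the estimates: for a fixed \<theta> only points \<xi> in one ball matter,
  and there \<phi> lies between two positive constants. For \<alpha> \<ge> 1 the convergence rests
  on cancellation and is proved for fixed kernels, so the null set is obtained for each \<theta>
  separately.

  Series and integrals are total functions with default values, so convergence and integrability
  have to be carried along with the equations between them.\<close>

locale orthogonal_terms = prob_space M for M +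
  fixes X :: "nat \<Rightarrow> 'a \<Rightarrow> real" and H :: "nat \<Rightarrow> 'a measure"
  assumes sub: "\<And>j. subalgebra M (H j)"
    and meas: "\<And>i j. i < j \<Longrightarrow> X i \<in> borel_measurable (H j)"
    and sq: "\<And>j. integrable M (\<lambda>\<omega>. (X j \<omega>)\<^sup>2)"
    and X_measurable [measurable]: "\<And>j. X j \<in> borel_measurable M"
    and orth: "\<And>j h. h \<in> borel_measurable (H j) \<Longrightarrow> integrable M (\<lambda>\<omega>. (h \<omega>)\<^sup>2) \<Longrightarrow> expectation (\<lambda>\<omega>. h \<omega> * X j \<omega>) = 0"
begin

text \<open>Kolmogorov's maximal inequality: the sum is stopped the first time it leaves the interval
  \<open>(-e, e)\<close>, which costs nothing in the second moment since the frozen part is orthogonal to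
  the increments that follow.\<close>
lemma stopped_sum_maximal:
  assumes e: "0 < e"
  shows "e\<^sup>2 * prob {\<omega> \<in> space M. \<exists>n\<le>N. e \<le> \<bar>\<Sum>i=m..<m+n. X i \<omega>\<bar>} \<le> (\<Sum>i=m..<m+N. expectation (\<lambda>\<omega>. (X i \<omega>)\<^sup>2))"
proof -
  define T where "T = rec_nat (\<lambda>\<omega>. 0::real) (\<lambda>n t \<omega>. t \<omega> + (if \<bar>t \<omega>\<bar> < e then X (m + n) \<omega> else 0))"
  have T0: "T 0 = (\<lambda>\<omega>. 0)" and TS: "T (Suc n) = (\<lambda>\<omega>. T n \<omega> + (if \<bar>T n \<omega>\<bar> < e then X (m + n) \<omega> else 0))" for n
    by (simp_all add: T_def)
  have TH: "n \<le> k \<Longrightarrow> T n \<in> borel_measurable (H (m + k))" for n k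
  proof (induction n)
    case (Suc n)
    have [measurable]: "X (m + n) \<in> borel_measurable (H (m + k))" using Suc.prems by (intro meas) auto
    have [measurable]: "T n \<in> borel_measurable (H (m + k))" using Suc by auto
    show ?case unfolding TS by measurable
  qed (simp add: T0)
  have TM [measurable]: "T n \<in> borel_measurable M" for n
    using TH[of n n] sub measurable_from_subalg by blast
  have T2: "integrable M (\<lambda>\<omega>. (T n \<omega>)\<^sup>2) \<and> expectation (\<lambda>\<omega>. (T n \<omega>)\<^sup>2) \<le> (\<Sum>i=m..<m+n. expectation (\<lambda>\<omega>. (X i \<omega>)\<^sup>2))" for n
  proof (induction n)
    case 0 then show ?case by (simp add: T0)
  next
    case (Suc n)
    \<comment> \<open>\<open>h\<close> is \<open>T n\<close> as long as the sum is still moving, and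
      \<open>Y\<close> is the square of the increment it then receives. The next square is the old
      one plus a cross term of mean 0 plus \<open>Y\<close>.\<close>
    define h where "h = (\<lambda>\<omega>. if \<bar>T n \<omega>\<bar> < e then T n \<omega> else 0)"
    define Y where "Y = (\<lambda>\<omega>. if \<bar>T n \<omega>\<bar> < e then (X (m + n) \<omega>)\<^sup>2 else 0)"
    have [measurable]: "T n \<in> borel_measurable (H (m + n))" by (rule TH) simp
    have hH: "h \<in> borel_measurable (H (m + n))" unfolding h_def by measurable
    have [measurable]: "h \<in> borel_measurable M" using measurable_from_subalg[OF sub hH] .
    have h2: "integrable M (\<lambda>\<omega>. (h \<omega>)\<^sup>2)"
      by (rule integrable_const_bound[of _ "e\<^sup>2"]) (auto simp: h_def e less_imp_le abs_le_square_iff[symmetric])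
    have o: "expectation (\<lambda>\<omega>. h \<omega> * X (m + n) \<omega>) = 0" by (rule orth[OF hH h2])
    have X1: "integrable M (X (m + n))" by (rule square_integrable_imp_integrable[OF _ sq]) simp
    have hX: "integrable M (\<lambda>\<omega>. h \<omega> * X (m + n) \<omega>)"
      by (rule Bochner_Integration.integrable_bound[of _ "\<lambda>\<omega>. e * X (m+n) \<omega>"])
         (use e in \<open>auto simp: h_def X1 abs_mult intro!: AE_I2 mult_right_mono\<close>)
    have Yi: "integrable M Y"
      by (rule Bochner_Integration.integrable_bound[OF sq[of "m+n"]]) (auto simp: Y_def)
    have YX: "expectation Y \<le> expectation (\<lambda>\<omega>. (X (m + n) \<omega>)\<^sup>2)"
      by (rule integral_mono[OF Yi sq]) (auto simp: Y_def)
    have eq: "(T (Suc n) \<omega>)\<^sup>2 = (T n \<omega>)\<^sup>2 + 2 * (h \<omega> * X (m + n) \<omega>) + Y \<omega>" for \<omega>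
      by (auto simp: TS h_def Y_def power2_sum)
    have i: "integrable M (\<lambda>\<omega>. (T n \<omega>)\<^sup>2 + 2 * (h \<omega> * X (m + n) \<omega>) + Y \<omega>)"
      using Suc hX Yi by auto
    have "expectation (\<lambda>\<omega>. (T (Suc n) \<omega>)\<^sup>2) = expectation (\<lambda>\<omega>. (T n \<omega>)\<^sup>2) + expectation Y"
      unfolding eq using Suc hX Yi o by (simp add: Bochner_Integration.integral_add)
    with i show ?case using Suc YX unfolding eq by simp
  qed
  have frozen: "e \<le> \<bar>T n \<omega>\<bar> \<Longrightarrow> e \<le> \<bar>T (n + k) \<omega>\<bar>" for n k \<omega>
    by (induction k) (auto simp: TS)
  \<comment> \<open>Until it is frozen, \<open>T\<close> agrees with the partial sum of the block;
    once frozen it stays outside. An exit at any time n \<le> N can therefore be read off at time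
    N.\<close>
  have sub_ev: "e \<le> \<bar>T n \<omega>\<bar> \<or> T n \<omega> = (\<Sum>i=m..<m+n. X i \<omega>)" for n \<omega>
    by (induction n) (auto simp: TS T0)
  have hit: "e \<le> \<bar>T N \<omega>\<bar>" if "n \<le> N" "e \<le> \<bar>\<Sum>i=m..<m+n. X i \<omega>\<bar>" for n \<omega>
    using that sub_ev[of n \<omega>] frozen[of n \<omega> "N - n"] by auto
  have "e\<^sup>2 * prob {\<omega> \<in> space M. \<exists>n\<le>N. e \<le> \<bar>\<Sum>i=m..<m+n. X i \<omega>\<bar>} \<le> e\<^sup>2 * prob {\<omega> \<in> space M. e\<^sup>2 \<le> (T N \<omega>)\<^sup>2}"
    using e hit by (intro mult_left_mono finite_measure_mono) (auto simp: abs_le_square_iff[symmetric])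
  also have "\<dots> \<le> expectation (\<lambda>\<omega>. (T N \<omega>)\<^sup>2)"
    using integral_Markov_inequality_measure[where M=M and u="\<lambda>\<omega>. (T N \<omega>)\<^sup>2" and A="space M" and c="e\<^sup>2"] T2[of N] e
    by (simp add: field_simps)
  also have "\<dots> \<le> (\<Sum>i=m..<m+N. expectation (\<lambda>\<omega>. (X i \<omega>)\<^sup>2))" using T2 by simp
  finally show ?thesis .
qed

text \<open>Pythagoras: each new term is orthogonal to the sum of the preceding ones, which is
  measurable with respect to its \<open>H\<close>. The exact second moment of a block later controls
  the remainder of the series.\<close>

lemma orthogonal_sum_square:
  shows "integrable M (\<lambda>\<omega>. (\<Sum>i=m..<m+n. X i \<omega>)\<^sup>2) \<and>
     expectation (\<lambda>\<omega>. (\<Sum>i=m..<m+n. X i \<omega>)\<^sup>2) = (\<Sum>i=m..<m+n. expectation (\<lambda>\<omega>. (X i \<omega>)\<^sup>2))"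
proof (induction n)
  case (Suc n)
  define S where "S = (\<lambda>\<omega>. \<Sum>i=m..<m+n. X i \<omega>)"
  have SH: "S \<in> borel_measurable (H (m + n))" unfolding S_def by (intro borel_measurable_sum meas) auto
  have [measurable]: "S \<in> borel_measurable M" unfolding S_def by measurable
  have S2: "integrable M (\<lambda>\<omega>. (S \<omega>)\<^sup>2)" using Suc by (simp add: S_def)
  have SX: "integrable M (\<lambda>\<omega>. S \<omega> * X (m + n) \<omega>)"
  proof (rule Bochner_Integration.integrable_bound[of _ "\<lambda>\<omega>. (S \<omega>)\<^sup>2 + (X (m+n) \<omega>)\<^sup>2"])
    show "AE \<omega> in M. norm (S \<omega> * X (m + n) \<omega>) \<le> norm ((S \<omega>)\<^sup>2 + (X (m+n) \<omega>)\<^sup>2)"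
    proof (rule AE_I2)
      fix \<omega>
      have "2 * \<bar>S \<omega> * X (m + n) \<omega>\<bar> \<le> (S \<omega>)\<^sup>2 + (X (m+n) \<omega>)\<^sup>2"
        using sum_squares_bound[of "\<bar>S \<omega>\<bar>" "\<bar>X (m+n) \<omega>\<bar>"] by (simp add: abs_mult)
      then show "norm (S \<omega> * X (m + n) \<omega>) \<le> norm ((S \<omega>)\<^sup>2 + (X (m+n) \<omega>)\<^sup>2)" by simp
    qed
  qed (use S2 sq in auto)
  have eq: "(\<Sum>i=m..<m+Suc n. X i \<omega>)\<^sup>2 = (S \<omega>)\<^sup>2 + 2 * (S \<omega> * X (m + n) \<omega>) + (X (m+n) \<omega>)\<^sup>2" for \<omega>
    by (simp add: S_def power2_sum)
  show ?case unfolding eq using Suc[THEN conjunct2] SX sq S2 orth[OF SH S2]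
    unfolding S_def[THEN fun_cong, symmetric] by auto
qed simp

text \<open>The events of the maximal inequality increase with \<open>N\<close>, so the bound
  survives the limit and controls all blocks starting at \<open>m\<close> by a tail of the variance
  series. These tails tend to 0, hence almost surely, for every level, some \<open>m\<close> keeps
  all later blocks below it. This is the Cauchy criterion.\<close>

lemma orthogonal_series_converges:
  assumes summ: "summable (\<lambda>i. expectation (\<lambda>\<omega>. (X i \<omega>)\<^sup>2))"
  shows "AE \<omega> in M. summable (\<lambda>i. X i \<omega>)"
proof -
  define v where "v = (\<lambda>i. expectation (\<lambda>\<omega>. (X i \<omega>)\<^sup>2))"
  have v0: "0 \<le> v i" for i by (simp add: v_def)
  have sv: "summable v" using summ by (simp add: v_def)
  have small: "prob {\<omega> \<in> space M. \<exists>n. e \<le> \<bar>\<Sum>i=m..<m+n. X i \<omega>\<bar>} \<le> (\<Sum>i. v (i + m)) / e\<^sup>2" if e: "0 < e" for e m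
  proof -
    let ?A = "\<lambda>N. {\<omega> \<in> space M. \<exists>n\<le>N. e \<le> \<bar>\<Sum>i=m..<m+n. X i \<omega>\<bar>}"
    have "incseq ?A" by (intro incseq_SucI) (auto intro: le_SucI)
    then have "(\<lambda>N. prob (?A N)) \<longlonglongrightarrow> prob (\<Union>N. ?A N)" by (intro finite_Lim_measure_incseq) auto
    moreover have "(\<Union>N. ?A N) = {\<omega> \<in> space M. \<exists>n. e \<le> \<bar>\<Sum>i=m..<m+n. X i \<omega>\<bar>}" by auto
    moreover have "prob (?A N) \<le> (\<Sum>i. v (i + m)) / e\<^sup>2" for N
    proof -
      have "e\<^sup>2 * prob (?A N) \<le> (\<Sum>i=m..<m+N. v i)"
        unfolding v_def by (rule stopped_sum_maximal[OF e])
      also have "\<dots> = (\<Sum>i<N. v (i + m))"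
        using sum.shift_bounds_nat_ivl[of v 0 m N] by (simp add: lessThan_atLeast0 add.commute)
      also have "\<dots> \<le> (\<Sum>i. v (i + m))" using sv v0 by (intro sum_le_suminf) (auto simp: summable_iff_shift)
      finally show ?thesis using e by (simp add: field_simps)
    qed
    ultimately show ?thesis by (auto intro: LIMSEQ_le_const2)
  qed
  have tail: "(\<lambda>m. \<Sum>i. v (i + m)) \<longlonglongrightarrow> 0" using suminf_exist_split2[OF sv] .
  have "AE \<omega> in M. \<exists>m. \<forall>n. \<bar>\<Sum>i=m..<m+n. X i \<omega>\<bar> < e" if e: "0 < e" for e
  proof -
    let ?B = "{\<omega> \<in> space M. \<forall>m. \<exists>n. e \<le> \<bar>\<Sum>i=m..<m+n. X i \<omega>\<bar>}"
    have [measurable]: "?B \<in> sets M" by measurable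
    have "prob ?B \<le> (\<Sum>i. v (i + m)) / e\<^sup>2" for m
      by (rule order_trans[OF finite_measure_mono small[OF e, of m]]) auto
    moreover have "(\<lambda>m. (\<Sum>i. v (i + m)) / e\<^sup>2) \<longlonglongrightarrow> 0" using tendsto_divide[OF tail tendsto_const, of "e\<^sup>2"] e by simp
    ultimately have "prob ?B \<le> 0" by (intro LIMSEQ_le_const) auto
    then have "prob ?B = 0" by (simp add: antisym)
    then have "AE \<omega> in M. \<omega> \<notin> ?B" by (intro AE_not_in) (auto simp: null_setsI emeasure_eq_measure)
    with AE_space show ?thesis by eventually_elim (auto simp: not_le)
  qed
  then have "AE \<omega> in M. \<forall>k. \<exists>m. \<forall>n. \<bar>\<Sum>i=m..<m+n. X i \<omega>\<bar> < inverse (real (Suc k))"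
    by (subst AE_all_countable) auto
  then show ?thesis
  proof eventually_elim
    case (elim \<omega>)
    show ?case unfolding summable_Cauchy
    proof (intro allI impI)
      fix e :: real assume "0 < e"
      \<comment> \<open>Half of \<open>e\<close>, because the block from \<open>p\<close> to
        \<open>q\<close> is a difference of two blocks that start at \<open>m\<close>.\<close>
      then obtain k where k: "inverse (real (Suc k)) < e / 2" using reals_Archimedean[of "e/2"] by auto
      from elim obtain m where m: "\<And>n. \<bar>\<Sum>i=m..<m+n. X i \<omega>\<bar> < inverse (real (Suc k))" by blast
      show "\<exists>N. \<forall>m\<ge>N. \<forall>n. norm (\<Sum>i=m..<n. X i \<omega>) < e"
      proof (intro exI allI impI)
        fix p q assume p: "m \<le> p"
        show "norm (\<Sum>i=p..<q. X i \<omega>) < e"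
        proof (cases "p \<le> q")
          case True
          then have "(\<Sum>i=m..<q. X i \<omega>) = (\<Sum>i=m..<p. X i \<omega>) + (\<Sum>i=p..<q. X i \<omega>)"
            using p by (simp add: sum.atLeastLessThan_concat)
          moreover have "\<bar>\<Sum>i=m..<p. X i \<omega>\<bar> < e / 2" using m[of "p - m"] p k by simp
          moreover have "\<bar>\<Sum>i=m..<q. X i \<omega>\<bar> < e / 2" using m[of "q - m"] p True k by simp
          ultimately show ?thesis by (simp add: abs_if split: if_splits)
        qed (use \<open>0 < e\<close> in simp)
      qed
    qed
  qed
qed

end

section \<open>LePage series\<close>

text \<open>The data are independent as one family over a sum type. This extracts the exponential
  variables as a family over the naturals, so that expectations of products over them
  factor.\<close>

lemma (in prob_space) indep_sets_reindex:
  assumes ind: "indep_sets F (f ` I)" and inj: "inj_on f I"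
  shows "indep_sets (\<lambda>i. F (f i)) I"
  unfolding indep_sets_def
proof (intro conjI ballI allI impI)
  show "F (f i) \<subseteq> events" if "i \<in> I" for i using ind that by (auto simp: indep_sets_def)
  fix J A assume J: "J \<subseteq> I" "J \<noteq> {}" "finite J" and A: "A \<in> (\<Pi> i\<in>J. F (f i))"
  define A' where "A' = (\<lambda>k. A (the_inv_into I f k))"
  have A': "A' (f i) = A i" if "i \<in> J" for i
    using that J the_inv_into_f_f[OF inj] by (auto simp: A'_def subset_iff)
  have "prob (\<Inter>k\<in>f ` J. A' k) = (\<Prod>k\<in>f ` J. prob (A' k))"
    using ind J A A' by (intro indep_setsD[OF ind]) (auto simp: Pi_iff)
  moreover have "(\<Inter>k\<in>f ` J. A' k) = (\<Inter>i\<in>J. A i)" using A' by auto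
  moreover have "(\<Prod>k\<in>f ` J. prob (A' k)) = (\<Prod>i\<in>J. prob (A i))"
    using A' J inj by (subst prod.reindex) (auto intro: inj_on_subset cong: prod.cong)
  ultimately show "prob (\<Inter>i\<in>J. A i) = (\<Prod>i\<in>J. prob (A i))" by simp
qed

lemma Int_stable_gen_sets: "Int_stable (gen_sets P X)"
proof (rule Int_stableI)
  fix a b assume "a \<in> gen_sets P X" "b \<in> gen_sets P X"
  then obtain A B where "A \<in> sets borel" "a = X -` A \<inter> space P" "B \<in> sets borel" "b = X -` B \<inter> space P"
    by (auto simp: gen_sets_def)
  then show "a \<inter> b \<in> gen_sets P X" unfolding gen_sets_def by (intro CollectI exI[of _ "A \<inter> B"]) auto
qed

locale lepage_series =
  fixes P :: "'w measure" and \<alpha> :: real and \<phi> :: "real \<times> real \<Rightarrow> real"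
    and E :: "nat \<Rightarrow> 'w \<Rightarrow> real" and \<xi> :: "nat \<Rightarrow> 'w \<Rightarrow> real \<times> real" and g :: "nat \<Rightarrow> 'w \<Rightarrow> real"
  assumes data: "lepage_data P \<alpha> \<phi> E \<xi> g"
begin

sublocale prob_space P
  using data by (simp add: lepage_data_def)

definition source :: "nat + nat + nat \<Rightarrow> 'w set set" where
  "source i = (case i of Inl k \<Rightarrow> gen_sets P (E k)
                    | Inr (Inl k) \<Rightarrow> gen_sets P (\<xi> k)
                    | Inr (Inr k) \<Rightarrow> gen_sets P (g k))"

text \<open>All the information except the j-th Gaussian factor, the later Gaussian factors
  included. These algebras are not nested in \<open>j\<close>; what counts is that everything
  multiplying \<open>g j\<close> in its term, and every earlier term, is measurable here.\<close>

definition others :: "nat \<Rightarrow> 'w measure" where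
  "others j = sigma (space P) (\<Union>i\<in>- {Inr (Inr j)}. source i)"

lemma indep_source: "indep_sets source UNIV"
  using data by (simp add: lepage_data_def source_def[abs_def])

lemma density_continuous: "continuous_on UNIV \<phi>" and density_pos: "0 < \<phi> x"
  using data by (auto simp: lepage_data_def simp del: split_paired_All)

lemma E_distributed: "distributed P lborel (E k) (\<lambda>x. ennreal (exponential_density 1 x))"
  and \<xi>_distributed: "distributed P lborel (\<xi> k) (\<lambda>x. ennreal (\<phi> x))"
  using data by (auto simp: lepage_data_def)

lemma g_distributed: "\<exists>s>0. \<forall>k. distributed P lborel (g k) (\<lambda>x. ennreal (normal_density 0 s x))"
  using data by (auto simp: lepage_data_def)

lemma E_measurable [measurable]: "E k \<in> borel_measurable P"
  using distributed_measurable[OF E_distributed[of k]] by simp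

lemma \<xi>_measurable [measurable]: "\<xi> k \<in> borel_measurable P"
  using distributed_measurable[OF \<xi>_distributed[of k]] by simp

lemma g_measurable [measurable]: "g k \<in> borel_measurable P"
  using g_distributed distributed_measurable by fastforce

lemma source_events: "source i \<subseteq> events"
  using indep_source by (auto simp: indep_sets_def)

lemma space_others [simp]: "space (others j) = space P"
  unfolding others_def by (rule space_measure_of_conv)

lemma sets_others: "sets (others j) = sigma_sets (space P) (\<Union>i\<in>- {Inr (Inr j)}. source i)"
  unfolding others_def using source_events sets.space_closed by (intro sets_measure_of) fast

lemma subalgebra_others: "subalgebra P (others j)"
  unfolding subalgebra_def
proof
  show "sets (others j) \<subseteq> events" unfolding sets_others using source_events by (intro sets.sigma_sets_subset) auto
qed simp

lemma others_measurable:
  fixes X :: "'w \<Rightarrow> 'b::topological_space"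
  assumes "source i = gen_sets P X" "i \<noteq> Inr (Inr j)"
  shows "X \<in> borel_measurable (others j)"
proof (rule measurableI)
  fix A :: "'b set" assume "A \<in> sets borel"
  then have "X -` A \<inter> space P \<in> (\<Union>i\<in>- {Inr (Inr j)}. source i)"
    using assms by (auto simp: gen_sets_def intro!: bexI[of _ i])
  then show "X -` A \<inter> space (others j) \<in> sets (others j)" unfolding sets_others by auto
qed simp

lemma E_others [measurable]: "E k \<in> borel_measurable (others j)"
  by (rule others_measurable[of "Inl k"]) (auto simp: source_def)

lemma \<xi>_others [measurable]: "\<xi> k \<in> borel_measurable (others j)"
  by (rule others_measurable[of "Inr (Inl k)"]) (auto simp: source_def)

lemma g_others: "i \<noteq> j \<Longrightarrow> g i \<in> borel_measurable (others j)"
  by (rule others_measurable[of "Inr (Inr i)"]) (auto simp: source_def)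

lemma arrival_others [measurable]: "arrival E k \<in> borel_measurable (others j)"
  unfolding arrival_def[abs_def] by measurable

lemma arrival_measurable [measurable]: "arrival E k \<in> borel_measurable P"
  unfolding arrival_def[abs_def] by measurable

lemma Int_stable_source: "Int_stable (source i)"
  unfolding source_def by (auto simp: Int_stable_gen_sets split: sum.split)

text \<open>Independence by blocks: the index set is split into the single index of
  \<open>g j\<close> and its complement, and the generating families are closed under intersection,
  so the generated sigma-algebras are independent.\<close>

lemma indep_g_others:
  fixes h :: "'w \<Rightarrow> real"
  assumes h: "h \<in> borel_measurable (others j)"
  shows "indep_var borel h borel (g j)"
proof -
  let ?I = "\<lambda>b. if b then - {Inr (Inr j)} else {Inr (Inr j)} :: (nat + nat + nat) set"
  have ind: "indep_sets (\<lambda>b. sigma_sets (space P) (\<Union>i\<in>?I b. source i)) UNIV"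
    by (rule indep_sets_collect_sigma)
       (auto simp: Int_stable_source disjoint_family_on_def UN_bool_eq intro: indep_sets_mono_index[OF _ indep_source])
  have 1: "sigma_sets (space P) {h -` A \<inter> space P |A. A \<in> sets borel} \<subseteq> sigma_sets (space P) (\<Union>i\<in>?I True. source i)"
  proof -
    have "{h -` A \<inter> space P |A. A \<in> sets borel} \<subseteq> sets (others j)"
      using measurable_sets[OF h] by auto
    then show ?thesis using sets.sigma_sets_subset[of _ "others j"] by (auto simp: sets_others)
  qed
  have 2: "sigma_sets (space P) {g j -` A \<inter> space P |A. A \<in> sets borel} \<subseteq> sigma_sets (space P) (\<Union>i\<in>?I False. source i)"
    by (rule sigma_sets_mono') (auto simp: source_def gen_sets_def)
  have "indep_sets (case_bool (sigma_sets (space P) {h -` A \<inter> space P |A. A \<in> sets borel})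
      (sigma_sets (space P) {g j -` A \<inter> space P |A. A \<in> sets borel})) UNIV"
    by (rule indep_sets_mono_sets[OF ind]) (use 1 2 in \<open>auto split: bool.split\<close>)
  then show ?thesis unfolding indep_var_eq indep_set_def
    using measurable_from_subalg[OF subalgebra_others h] by simp
qed

text \<open>The Gaussian factors share one standard deviation, so a single \<open>V\<close> serves
  all of them.\<close>

lemma g_moments:
  obtains V where "0 \<le> V" "\<And>k. integrable P (\<lambda>\<omega>. (g k \<omega>)\<^sup>2)" "\<And>k. expectation (\<lambda>\<omega>. (g k \<omega>)\<^sup>2) = V"
    "\<And>k. integrable P (g k)" "\<And>k. expectation (g k) = 0"
proof -
  obtain s where s: "0 < s" and d: "\<And>k. distributed P lborel (g k) (\<lambda>x. ennreal (normal_density 0 s x))"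
    using g_distributed by blast
  have e: "expectation (g k) = 0" for k using normal_distributed_expectation[OF s d] .
  have i2: "integrable P (\<lambda>\<omega>. (g k \<omega>)\<^sup>2)" for k
    using distributed_integrable[OF d, of "\<lambda>x. x\<^sup>2" k] integrable_normal_moment[OF s, of 0 2] by simp
  have i1: "integrable P (g k)" for k by (rule square_integrable_imp_integrable[OF _ i2]) simp
  have "expectation (\<lambda>\<omega>. (g k \<omega>)\<^sup>2) = s\<^sup>2" for k
    using normal_distributed_variance[OF s d, of k] by (simp add: e)
  then show ?thesis using that[of "s\<^sup>2"] i2 i1 e by simp
qed

lemma expectation_others_times_g:
  assumes "h \<in> borel_measurable (others j)" "integrable P h"
  shows "expectation (\<lambda>\<omega>. h \<omega> * g j \<omega>) = 0"
proof -
  obtain V where "integrable P (g j)" "expectation (g j) = 0" using g_moments by metis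
  then show ?thesis using indep_var_lebesgue_integral[OF indep_g_others[OF assms(1)] assms(2)] by simp
qed

text \<open>In the extended nonnegative reals no integrability of \<open>h\<close> is presupposed;
  finiteness of the second moments of the terms comes out as a conclusion.\<close>

lemma nn_integral_others_times_g_square:
  assumes "h \<in> borel_measurable (others j)"
  shows "(\<integral>\<^sup>+\<omega>. ennreal ((h \<omega> * g j \<omega>)\<^sup>2) \<partial>P) = (\<integral>\<^sup>+\<omega>. ennreal ((h \<omega>)\<^sup>2) \<partial>P) * (\<integral>\<^sup>+\<omega>. ennreal ((g j \<omega>)\<^sup>2) \<partial>P)"
proof -
  have "indep_var borel ((\<lambda>x. ennreal (x\<^sup>2)) \<circ> h) borel ((\<lambda>x. ennreal (x\<^sup>2)) \<circ> g j)"
    by (rule indep_var_compose[OF indep_g_others[OF assms]]) auto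
  then have "indep_vars (\<lambda>_. borel) (case_bool ((\<lambda>x. ennreal (x\<^sup>2)) \<circ> h) ((\<lambda>x. ennreal (x\<^sup>2)) \<circ> g j)) UNIV"
    unfolding indep_var_def by (rule indep_vars_cong[THEN iffD1, rotated -1]) (auto split: bool.split)
  from indep_vars_nn_integral[OF _ this]
  show ?thesis by (simp add: UNIV_bool power_mult_distrib ennreal_mult' mult.commute comp_def)
qed

section \<open>Growth of the arrival times\<close>

lemma E_pos: "AE \<omega> in P. \<forall>k. 0 < E k \<omega>"
proof -
  have "AE \<omega> in P. 0 < E k \<omega>" for k
  proof -
    have "(\<integral>\<^sup>+\<omega>. indicator {..0} (E k \<omega>) \<partial>P) = (\<integral>\<^sup>+x. ennreal (exponential_density 1 x) * indicator {..0} x \<partial>lborel)"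
      by (rule distributed_nn_integral[OF E_distributed, symmetric]) simp
    also have "\<dots> = (\<integral>\<^sup>+x. 0 \<partial>(lborel :: real measure))"
      by (rule nn_integral_cong_AE, rule AE_mp[OF AE_lborel_singleton[of 0]])
         (auto simp: exponential_density_def indicator_def)
    finally have "(\<integral>\<^sup>+\<omega>. indicator {..0} (E k \<omega>) \<partial>P) = 0" by simp
    then have "AE \<omega> in P. indicator {..0} (E k \<omega>) = (0::ennreal)" by (subst (asm) nn_integral_0_iff_AE) auto
    then show ?thesis by eventually_elim (auto simp: indicator_def split: if_splits)
  qed
  then show ?thesis by (simp add: AE_all_countable)
qed

text \<open>The Laplace transform of an arrival time at 1 is a product over independent exponential
  waiting times, each contributing 1/2.\<close>

lemma nn_integral_exp_arrival: "(\<integral>\<^sup>+\<omega>. ennreal (exp (- arrival E k \<omega>)) \<partial>P) = ennreal ((1/2) ^ Suc k)"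
proof -
  have ind: "indep_vars (\<lambda>_. borel) E UNIV"
  proof -
    have "indep_sets (\<lambda>k. source (Inl k)) UNIV"
      by (rule indep_sets_reindex) (auto intro: indep_sets_mono_index[OF _ indep_source])
    then show ?thesis unfolding indep_vars_def2 by (simp add: source_def gen_sets_def)
  qed
  have "indep_vars (\<lambda>_. borel) (\<lambda>i \<omega>. ennreal (exp (- E i \<omega>))) UNIV"
    using indep_vars_compose2[OF ind, of "\<lambda>_ x. ennreal (exp (- x))" "\<lambda>_. borel"] by simp
  then have "indep_vars (\<lambda>_. borel) (\<lambda>i \<omega>. ennreal (exp (- E i \<omega>))) {..k}"
    by (rule indep_vars_subset) simp
  from indep_vars_nn_integral[OF _ this]
  have "(\<integral>\<^sup>+\<omega>. (\<Prod>i\<le>k. ennreal (exp (- E i \<omega>))) \<partial>P) = (\<Prod>i\<le>k. \<integral>\<^sup>+\<omega>. ennreal (exp (- E i \<omega>)) \<partial>P)" by simp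
  moreover have "(\<integral>\<^sup>+\<omega>. ennreal (exp (- E i \<omega>)) \<partial>P) = ennreal (1/2)" for i
  proof -
    have "(\<integral>\<^sup>+\<omega>. ennreal (exp (- E i \<omega>)) \<partial>P) = (\<integral>\<^sup>+x. ennreal (exponential_density 1 x) * ennreal (exp (- x)) \<partial>lborel)"
      by (rule distributed_nn_integral[OF E_distributed, symmetric]) simp
    \<comment> \<open>Multiplied by \<open>exp (- x)\<close>, the density of rate 1 becomes half the
      density of rate 2.\<close>
    also have "\<dots> = (\<integral>\<^sup>+x. ennreal (1/2) * ennreal (exponential_density 2 x) \<partial>lborel)"
      by (intro nn_integral_cong)
         (simp add: exponential_density_def ennreal_mult'[symmetric] exp_add[symmetric] ac_simps del: ennreal_half)
    also have "\<dots> = ennreal (1/2) * (\<integral>\<^sup>+x. ennreal (exponential_density 2 x) \<partial>lborel)"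
      by (rule nn_integral_cmult) simp
    also have "(\<integral>\<^sup>+x. ennreal (exponential_density 2 x) \<partial>lborel) = 1"
      using prob_space.emeasure_space_1[OF prob_space_exponential_density[of 2]] by (simp add: emeasure_density)
    finally show ?thesis by simp
  qed
  moreover have "(\<Prod>i\<le>k. ennreal (exp (- E i \<omega>))) = ennreal (exp (- arrival E k \<omega>))" for \<omega>
    by (simp add: prod_ennreal arrival_def exp_sum sum_negf[symmetric])
  ultimately show ?thesis by (simp add: ennreal_power del: ennreal_half power_Suc)
qed

text \<open>An exponential moment bound in place of the law of large numbers: the variables
  \<open>exp (real (Suc k) / 2 - arrival E k \<omega>)\<close> have a finite expected sum, so almost
  surely they stay bounded and the arrival times exceed \<open>real (Suc k) / 2\<close> minus a
  random constant. The finitely many small indices are covered by the first arrival, which is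
  positive. The slope is the inverse of a natural number so that countably many events exhaust the
  probability space.\<close>

lemma arrival_linear_growth: "AE \<omega> in P. \<exists>N::nat. 0 < N \<and> (\<forall>k. real (Suc k) / real N \<le> arrival E k \<omega>)"
proof -
  \<comment> \<open>\<open>q ^ Suc k\<close> is the expectation of the k-th exponential. The rate
    1/2 is slow enough for q < 1, which comes down to exp 1 \<le> 3 < 4.\<close>
  define q :: real where "q = exp (1/2) / 2"
  have q: "0 \<le> q" "q < 1"
  proof -
    have "(exp (1/2::real))\<^sup>2 < 2\<^sup>2" using exp_le by (simp add: exp_double[symmetric])
    then have "exp (1/2::real) < 2" by (rule power2_less_imp_less) simp
    then show "0 \<le> q" "q < 1" by (simp_all add: q_def)
  qed
  have "(\<integral>\<^sup>+\<omega>. (\<Sum>k. ennreal (exp (real (Suc k) / 2 - arrival E k \<omega>))) \<partial>P) =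
      (\<Sum>k. \<integral>\<^sup>+\<omega>. ennreal (exp (real (Suc k) / 2 - arrival E k \<omega>)) \<partial>P)"
    by (rule nn_integral_suminf) measurable
  also have "\<dots> = (\<Sum>k. ennreal (q ^ Suc k))"
  proof (rule suminf_cong)
    fix k
    have "(\<integral>\<^sup>+\<omega>. ennreal (exp (real (Suc k) / 2 - arrival E k \<omega>)) \<partial>P) =
       (\<integral>\<^sup>+\<omega>. ennreal (exp (real (Suc k) / 2)) * ennreal (exp (- arrival E k \<omega>)) \<partial>P)"
      by (simp add: ennreal_mult'[symmetric] exp_add[symmetric])
    also have "\<dots> = ennreal (exp (real (Suc k) / 2)) * ennreal ((1/2) ^ Suc k)"
      by (subst nn_integral_cmult) (auto simp: nn_integral_exp_arrival)
    also have "\<dots> = ennreal (exp (1/2) ^ Suc k * (1/2) ^ Suc k)"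
      by (simp add: ennreal_mult'[symmetric] exp_of_nat_mult[symmetric] del: power_Suc)
    also have "exp (1/2) ^ Suc k * (1/2) ^ Suc k = q ^ Suc k" unfolding q_def by (simp only: power_mult_distrib[symmetric]) simp
    finally show "(\<integral>\<^sup>+\<omega>. ennreal (exp (real (Suc k) / 2 - arrival E k \<omega>)) \<partial>P) = ennreal (q ^ Suc k)" .
  qed
  also have "\<dots> < \<infinity>"
  proof -
    have "summable (\<lambda>k. q ^ Suc k)" using q by (simp only: summable_Suc_iff) (simp add: summable_geometric)
    then show ?thesis using q by (subst suminf_ennreal2) (simp_all del: power_Suc)
  qed
  finally have fin: "(\<integral>\<^sup>+\<omega>. (\<Sum>k. ennreal (exp (real (Suc k) / 2 - arrival E k \<omega>))) \<partial>P) \<noteq> \<infinity>"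
    by (rule less_imp_neq)
  have "AE \<omega> in P. (\<Sum>k. ennreal (exp (real (Suc k) / 2 - arrival E k \<omega>))) \<noteq> \<infinity>"
    by (rule nn_integral_noteq_infinite[OF _ fin]) measurable
  with E_pos show ?thesis
  proof eventually_elim
    case (elim \<omega>)
    define S where "S = enn2real (\<Sum>k. ennreal (exp (real (Suc k) / 2 - arrival E k \<omega>)))"
    have le: "exp (real (Suc k) / 2 - arrival E k \<omega>) \<le> S" for k
    proof -
      have "ennreal (exp (real (Suc k) / 2 - arrival E k \<omega>)) \<le> (\<Sum>k. ennreal (exp (real (Suc k) / 2 - arrival E k \<omega>)))"
        using sum_le_suminf[OF summableI, of "{k}" "\<lambda>k. ennreal (exp (real (Suc k) / 2 - arrival E k \<omega>))"]
        by (simp only: finite.intros sum.insert sum.empty empty_iff not_False_eq_True add_0_right zero_le simp_thms ball_simps)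
      also have "\<dots> = ennreal S" using elim(2) unfolding S_def by (intro ennreal_enn2real[symmetric]) (simp only: less_top infinity_ennreal_def)
      finally show ?thesis by (subst (asm) ennreal_le_iff) (simp_all only: S_def enn2real_nonneg)
    qed
    have S: "0 < S" by (rule less_le_trans[OF exp_gt_zero le[of 0]])
    define b where "b = max (ln S) 1"
    have ge: "real (Suc k) / 2 - b \<le> arrival E k \<omega>" for k
    proof -
      have "real (Suc k) / 2 - arrival E k \<omega> \<le> ln S" using le[of k] by (rule ln_ge_iff[OF S, THEN iffD2])
      then show ?thesis unfolding b_def by linarith
    qed
    define d where "d = E 0 \<omega>"
    have d: "0 < d" using elim(1) by (simp add: d_def)
    have ged: "d \<le> arrival E k \<omega>" for k
    proof -
      have "(\<Sum>i\<in>{0}. E i \<omega>) \<le> (\<Sum>i\<le>k. E i \<omega>)" using elim(1) by (intro sum_mono2) (auto intro: less_imp_le)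
      then show ?thesis by (simp add: d_def arrival_def)
    qed
    \<comment> \<open>With \<open>4 \<le> N\<close> the slope is small enough as soon as
      \<open>4 * b \<le> real (Suc k)\<close>; for smaller indices \<open>4 * b / d < N\<close>
      brings the line below the first arrival \<open>d\<close>.\<close>
    obtain N :: nat where N: "max 4 (4 * b / d) < real N" using reals_Archimedean2 by blast
    have "real (Suc k) / real N \<le> arrival E k \<omega>" for k
    proof (cases "4 * b \<le> real (Suc k)")
      case True
      have "real (Suc k) / real N \<le> real (Suc k) / 4" using N by (intro divide_left_mono) auto
      also have "\<dots> \<le> real (Suc k) / 2 - b"
      proof -
        have "x / 4 \<le> x / 2 - b" if "4 * b \<le> x" for x using that by (simp add: field_simps)
        then show ?thesis using True by blast
      qed
      finally show ?thesis using ge[of k] by linarith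
    next
      case False
      have "4 * b < d * real N" using N d by (simp add: field_simps)
      then have "real (Suc k) / real N \<le> d" using False N by (simp add: field_simps)
      then show ?thesis using ged[of k] by linarith
    qed
    then show ?case using N by (intro exI[of _ N]) auto
  qed
qed

end

section \<open>Stochastic Fubini theorem\<close>

text \<open>Cauchy-Schwarz against the constant 1, obtained pointwise from |Z| \<le> r/2 + Z^2/(2r).
  The division makes r = 0 a separate case.\<close>

lemma (in prob_space) nn_integral_abs_le_of_square:
  fixes Z :: "'a \<Rightarrow> real"
  assumes [measurable]: "Z \<in> borel_measurable M" and sq: "(\<integral>\<^sup>+\<omega>. ennreal ((Z \<omega>)\<^sup>2) \<partial>M) \<le> ennreal (r\<^sup>2)" and r: "0 \<le> r"
  shows "(\<integral>\<^sup>+\<omega>. ennreal \<bar>Z \<omega>\<bar> \<partial>M) \<le> ennreal r"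
proof (cases "r = 0")
  case True
  then have "(\<integral>\<^sup>+\<omega>. ennreal ((Z \<omega>)\<^sup>2) \<partial>M) = 0" using sq by simp
  then have "AE \<omega> in M. ennreal ((Z \<omega>)\<^sup>2) = 0" by (subst (asm) nn_integral_0_iff_AE) auto
  then have "(\<integral>\<^sup>+\<omega>. ennreal \<bar>Z \<omega>\<bar> \<partial>M) = (\<integral>\<^sup>+\<omega>. 0 \<partial>M)" by (intro nn_integral_cong_AE) auto
  then show ?thesis by simp
next
  case False
  with r have r: "0 < r" by simp
  have "(\<integral>\<^sup>+\<omega>. ennreal \<bar>Z \<omega>\<bar> \<partial>M) \<le> (\<integral>\<^sup>+\<omega>. ennreal (r / 2) + ennreal (1 / (2 * r)) * ennreal ((Z \<omega>)\<^sup>2) \<partial>M)"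
  proof (intro nn_integral_mono)
    fix \<omega>
    have "2 * (r * \<bar>Z \<omega>\<bar>) \<le> r\<^sup>2 + (Z \<omega>)\<^sup>2" using sum_squares_bound[of r "\<bar>Z \<omega>\<bar>"] by simp
    then have "\<bar>Z \<omega>\<bar> \<le> r / 2 + 1 / (2 * r) * (Z \<omega>)\<^sup>2" using r by (simp add: field_simps power2_eq_square)
    then have "ennreal \<bar>Z \<omega>\<bar> \<le> ennreal (r / 2 + 1 / (2 * r) * (Z \<omega>)\<^sup>2)" by (rule ennreal_leI)
    also have "\<dots> = ennreal (r / 2) + ennreal (1 / (2 * r)) * ennreal ((Z \<omega>)\<^sup>2)"
      using r by (simp only: ennreal_plus ennreal_mult' divide_nonneg_pos zero_le_power2 mult_nonneg_nonneg zero_le_one less_imp_le mult_pos_pos zero_less_numeral)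
    finally show "ennreal \<bar>Z \<omega>\<bar> \<le> \<dots>" .
  qed
  also have "\<dots> = ennreal (r / 2) + ennreal (1 / (2 * r)) * (\<integral>\<^sup>+\<omega>. ennreal ((Z \<omega>)\<^sup>2) \<partial>M)"
    by (simp add: nn_integral_add nn_integral_cmult emeasure_space_1)
  also have "\<dots> \<le> ennreal (r / 2) + ennreal (1 / (2 * r)) * ennreal (r\<^sup>2)"
    by (intro add_left_mono mult_left_mono sq) simp
  also have "\<dots> = ennreal (r / 2 + 1 / (2 * r) * r\<^sup>2)"
    using r by (simp only: ennreal_plus ennreal_mult' divide_nonneg_pos zero_le_power2 mult_nonneg_nonneg zero_le_one less_imp_le mult_pos_pos zero_less_numeral)
  also have "r / 2 + 1 / (2 * r) * r\<^sup>2 = r" using r by (simp add: field_simps power2_eq_square)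
  finally show ?thesis .
qed

text \<open>By completeness summability is the Cauchy condition, which involves only countable
  quantifiers. Exchanging the two almost-everywhere quantifiers over outcome and parameter needs
  this measurability.\<close>

lemma Collect_summable_sets:
  fixes X :: "nat \<Rightarrow> 'a \<Rightarrow> real"
  assumes [measurable]: "\<And>k. X k \<in> borel_measurable M"
  shows "{x \<in> space M. summable (\<lambda>k. X k x)} \<in> sets M"
  unfolding summable_iff_convergent Cauchy_convergent_iff[symmetric]
  by (rule sets_Collect_Cauchy) measurable

text \<open>\<open>c\<close> stands for the random weight made from the arrival times. Its
  deterministic square-summable bound \<open>d\<close> is what makes all second moments finite. The
  density factor of the series is meant to be part of the integrand.\<close>

locale weighted_lepage_series = lepage_series +
  fixes c :: "nat \<Rightarrow> 'a \<Rightarrow> real" and d :: "nat \<Rightarrow> real" and V :: real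
  assumes c_others [measurable]: "\<And>k j. c k \<in> borel_measurable (others j)"
    and c_le: "\<And>k \<omega>. \<bar>c k \<omega>\<bar> \<le> d k"
    and d_square_summable: "summable (\<lambda>k. (d k)\<^sup>2)"
    and V_nonneg: "0 \<le> V"
    and g_square: "\<And>k. (\<integral>\<^sup>+\<omega>. ennreal ((g k \<omega>)\<^sup>2) \<partial>P) = ennreal V"
begin

text \<open>Bound for the \<open>L^2\<close> norm of the remainder after \<open>n\<close> terms when
  the integrand has norm 1 in \<open>L^2\<close> with weight \<phi>.\<close>

definition tail_bound :: "nat \<Rightarrow> real" where
  "tail_bound n = sqrt (V * (\<Sum>i. (d (i + n))\<^sup>2))"

lemma d_square_tail_summable: "summable (\<lambda>i. (d (i + n))\<^sup>2)"
  using d_square_summable by (rule summable_ignore_initial_segment)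

lemma tail_bound_nonneg: "0 \<le> tail_bound n"
  unfolding tail_bound_def using V_nonneg d_square_tail_summable
  by (intro real_sqrt_ge_zero mult_nonneg_nonneg suminf_nonneg) (auto)

lemma tail_bound_tendsto: "tail_bound \<longlonglongrightarrow> 0"
  unfolding tail_bound_def
  using tendsto_real_sqrt[OF tendsto_mult[OF tendsto_const[of V] suminf_exist_split2[OF d_square_summable]]] by simp

lemma c_measurable [measurable]: "c k \<in> borel_measurable P"
  using measurable_from_subalg[OF subalgebra_others c_others] .

context
  fixes f :: "real \<times> real \<Rightarrow> real" and W :: real
  assumes f_meas [measurable]: "f \<in> borel_measurable borel"
    and f_square: "(\<integral>\<^sup>+y. ennreal ((f y)\<^sup>2) * ennreal (\<phi> y) \<partial>lborel) \<le> ennreal (W\<^sup>2)"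
    and W: "0 \<le> W"
begin

text \<open>The point \<open>\<xi> k\<close> has density \<phi>, so the second moment of
  \<open>f (\<xi> k \<omega>)\<close> is the weighted square integral bounded by
  \<open>W\<close>.\<close>

lemma weight_square: "(\<integral>\<^sup>+\<omega>. ennreal ((c k \<omega> * f (\<xi> k \<omega>))\<^sup>2) \<partial>P) \<le> ennreal ((d k)\<^sup>2 * W\<^sup>2)"
proof -
  have "(\<integral>\<^sup>+\<omega>. ennreal ((c k \<omega> * f (\<xi> k \<omega>))\<^sup>2) \<partial>P) \<le> (\<integral>\<^sup>+\<omega>. ennreal ((d k)\<^sup>2) * ennreal ((f (\<xi> k \<omega>))\<^sup>2) \<partial>P)"
    using c_le[of k]
    by (intro nn_integral_mono)
       (auto simp: ennreal_mult'[symmetric] power_mult_distrib abs_le_square_iff[symmetric]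
         intro!: ennreal_leI mult_right_mono order_trans[OF _ abs_ge_self])
  also have "\<dots> = ennreal ((d k)\<^sup>2) * (\<integral>\<^sup>+\<omega>. ennreal ((f (\<xi> k \<omega>))\<^sup>2) \<partial>P)"
    by (rule nn_integral_cmult) measurable
  also have "(\<integral>\<^sup>+\<omega>. ennreal ((f (\<xi> k \<omega>))\<^sup>2) \<partial>P) = (\<integral>\<^sup>+y. ennreal (\<phi> y) * ennreal ((f y)\<^sup>2) \<partial>lborel)"
    by (rule distributed_nn_integral[OF \<xi>_distributed, symmetric]) measurable
  also have "ennreal ((d k)\<^sup>2) * \<dots> \<le> ennreal ((d k)\<^sup>2) * ennreal (W\<^sup>2)"
    using f_square by (intro mult_left_mono) (auto simp: mult.commute)
  finally show ?thesis by (simp add: ennreal_mult')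
qed

lemma term_square: "(\<integral>\<^sup>+\<omega>. ennreal ((c k \<omega> * f (\<xi> k \<omega>) * g k \<omega>)\<^sup>2) \<partial>P) \<le> ennreal ((d k)\<^sup>2 * W\<^sup>2 * V)"
proof -
  have "(\<integral>\<^sup>+\<omega>. ennreal ((c k \<omega> * f (\<xi> k \<omega>) * g k \<omega>)\<^sup>2) \<partial>P) =
      (\<integral>\<^sup>+\<omega>. ennreal ((c k \<omega> * f (\<xi> k \<omega>))\<^sup>2) \<partial>P) * ennreal V"
    using nn_integral_others_times_g_square[of "\<lambda>\<omega>. c k \<omega> * f (\<xi> k \<omega>)" k] by (simp add: g_square)
  also have "\<dots> \<le> ennreal ((d k)\<^sup>2 * W\<^sup>2) * ennreal V" by (intro mult_right_mono weight_square) simp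
  finally show ?thesis using V_nonneg by (simp add: ennreal_mult'')
qed

lemma weight_square_integrable: "integrable P (\<lambda>\<omega>. (c k \<omega> * f (\<xi> k \<omega>))\<^sup>2)"
  using weight_square[of k] by (intro integrableI_bounded) (auto intro: le_less_trans)

lemma term_square_integrable: "integrable P (\<lambda>\<omega>. (c k \<omega> * f (\<xi> k \<omega>) * g k \<omega>)\<^sup>2)"
  using term_square[of k] by (intro integrableI_bounded) (auto intro: le_less_trans)

lemma term_square_expectation: "expectation (\<lambda>\<omega>. (c k \<omega> * f (\<xi> k \<omega>) * g k \<omega>)\<^sup>2) \<le> (d k)\<^sup>2 * W\<^sup>2 * V"
proof -
  have "ennreal (expectation (\<lambda>\<omega>. (c k \<omega> * f (\<xi> k \<omega>) * g k \<omega>)\<^sup>2)) \<le> ennreal ((d k)\<^sup>2 * W\<^sup>2 * V)"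
    using term_square[of k] by (subst nn_integral_eq_integral[OF term_square_integrable, symmetric]) auto
  then show ?thesis using V_nonneg by (subst (asm) ennreal_le_iff) auto
qed

text \<open>The factor in front of \<open>g j\<close> is integrable as a product of two square
  integrable functions and is measurable over \<open>others j\<close>; the centered
  \<open>g j\<close>, being independent of it, makes the mean vanish.\<close>

lemma term_orthogonal:
  assumes h: "h \<in> borel_measurable (others j)" and h2: "integrable P (\<lambda>\<omega>. (h \<omega>)\<^sup>2)"
  shows "expectation (\<lambda>\<omega>. h \<omega> * (c j \<omega> * f (\<xi> j \<omega>) * g j \<omega>)) = 0"
proof -
  have [measurable]: "h \<in> borel_measurable P" using measurable_from_subalg[OF subalgebra_others h] .
  note h[measurable]
  have "integrable P (\<lambda>\<omega>. h \<omega> * (c j \<omega> * f (\<xi> j \<omega>)))"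
  proof (rule Bochner_Integration.integrable_bound[of _ "\<lambda>\<omega>. (h \<omega>)\<^sup>2 + (c j \<omega> * f (\<xi> j \<omega>))\<^sup>2"])
    show "AE \<omega> in P. norm (h \<omega> * (c j \<omega> * f (\<xi> j \<omega>))) \<le> norm ((h \<omega>)\<^sup>2 + (c j \<omega> * f (\<xi> j \<omega>))\<^sup>2)"
    proof (rule AE_I2)
      fix \<omega>
      have "2 * \<bar>h \<omega> * (c j \<omega> * f (\<xi> j \<omega>))\<bar> \<le> (h \<omega>)\<^sup>2 + (c j \<omega> * f (\<xi> j \<omega>))\<^sup>2"
        using sum_squares_bound[of "\<bar>h \<omega>\<bar>" "\<bar>c j \<omega> * f (\<xi> j \<omega>)\<bar>"]
        by (simp only: abs_mult[of "h \<omega>"] power2_abs mult.assoc)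
      then show "norm (h \<omega> * (c j \<omega> * f (\<xi> j \<omega>))) \<le> norm ((h \<omega>)\<^sup>2 + (c j \<omega> * f (\<xi> j \<omega>))\<^sup>2)" by simp
    qed
  qed (use h2 weight_square_integrable in auto)
  from expectation_others_times_g[OF _ this] show ?thesis by (simp add: mult.assoc)
qed

lemma term_others: "i < j \<Longrightarrow> (\<lambda>\<omega>. c i \<omega> * f (\<xi> i \<omega>) * g i \<omega>) \<in> borel_measurable (others j)"
  using g_others[of i j] by simp

text \<open>The algebras \<open>others\<close> take the place of a filtration: the j-th one contains
  all earlier terms and is independent of the centered factor of the j-th term.\<close>

lemma weighted_terms_orthogonal: "orthogonal_terms P (\<lambda>k \<omega>. c k \<omega> * f (\<xi> k \<omega>) * g k \<omega>) others"
  by unfold_locales (auto intro: subalgebra_others term_others term_square_integrable term_orthogonal)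

lemma weighted_series_summable: "AE \<omega> in P. summable (\<lambda>k. c k \<omega> * f (\<xi> k \<omega>) * g k \<omega>)"
proof (rule orthogonal_terms.orthogonal_series_converges[OF weighted_terms_orthogonal])
  show "summable (\<lambda>k. expectation (\<lambda>\<omega>. (c k \<omega> * f (\<xi> k \<omega>) * g k \<omega>)\<^sup>2))"
  proof (rule summable_comparison_test')
    show "summable (\<lambda>k. (d k)\<^sup>2 * (W\<^sup>2 * V))" by (intro summable_mult2 d_square_summable)
    show "norm (expectation (\<lambda>\<omega>. (c k \<omega> * f (\<xi> k \<omega>) * g k \<omega>)\<^sup>2)) \<le> (d k)\<^sup>2 * (W\<^sup>2 * V)" if "0 \<le> k" for k
      using term_square_expectation[of k] by (simp add: mult.assoc)
  qed
qed

text \<open>The \<open>L\<^sup>2\<close> bound for finite blocks passes to the limit by Fatou.\<close>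
lemma weighted_series_remainder:
  "(\<integral>\<^sup>+\<omega>. ennreal \<bar>(\<Sum>k. c k \<omega> * f (\<xi> k \<omega>) * g k \<omega>) - (\<Sum>k<n. c k \<omega> * f (\<xi> k \<omega>) * g k \<omega>)\<bar> \<partial>P)
     \<le> ennreal (W * tail_bound n)"
proof (rule nn_integral_abs_le_of_square)
  define X where "X k \<omega> = c k \<omega> * f (\<xi> k \<omega>) * g k \<omega>" for k \<omega>
  have [measurable]: "X k \<in> borel_measurable P" for k unfolding X_def by measurable
  define Q where "Q = W\<^sup>2 * (V * (\<Sum>i. (d (i + n))\<^sup>2))"
  have block: "(\<integral>\<^sup>+\<omega>. ennreal ((\<Sum>i=n..<n+m. X i \<omega>)\<^sup>2) \<partial>P) \<le> ennreal Q" for m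
  proof -
    have "integrable P (\<lambda>\<omega>. (\<Sum>i=n..<n+m. X i \<omega>)\<^sup>2) \<and>
       expectation (\<lambda>\<omega>. (\<Sum>i=n..<n+m. X i \<omega>)\<^sup>2) = (\<Sum>i=n..<n+m. expectation (\<lambda>\<omega>. (X i \<omega>)\<^sup>2))"
      unfolding X_def
      by (rule orthogonal_terms.orthogonal_sum_square[OF weighted_terms_orthogonal])
    then have "(\<integral>\<^sup>+\<omega>. ennreal ((\<Sum>i=n..<n+m. X i \<omega>)\<^sup>2) \<partial>P) = ennreal (\<Sum>i=n..<n+m. expectation (\<lambda>\<omega>. (X i \<omega>)\<^sup>2))"
      by (subst nn_integral_eq_integral) auto
    also have "\<dots> \<le> ennreal (\<Sum>i=n..<n+m. (d i)\<^sup>2 * W\<^sup>2 * V)"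
      unfolding X_def by (intro ennreal_leI sum_mono term_square_expectation)
    also have "(\<Sum>i=n..<n+m. (d i)\<^sup>2 * W\<^sup>2 * V) = W\<^sup>2 * (V * (\<Sum>i<m. (d (i + n))\<^sup>2))"
      using sum.shift_bounds_nat_ivl[of "\<lambda>i. (d i)\<^sup>2 * W\<^sup>2 * V" 0 n m]
      by (simp add: lessThan_atLeast0 add.commute sum_distrib_left sum_distrib_right ac_simps)
    also have "ennreal \<dots> \<le> ennreal Q"
      unfolding Q_def using V_nonneg d_square_tail_summable
      by (intro ennreal_leI mult_left_mono sum_le_suminf) (auto)
    finally show ?thesis .
  qed
  have "(\<integral>\<^sup>+\<omega>. ennreal (((\<Sum>k. X k \<omega>) - (\<Sum>k<n. X k \<omega>))\<^sup>2) \<partial>P) =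
      (\<integral>\<^sup>+\<omega>. liminf (\<lambda>m. ennreal ((\<Sum>i=n..<n+m. X i \<omega>)\<^sup>2)) \<partial>P)"
  \<comment> \<open>Where the series diverges, its sum is a default value unrelated to the blocks.
    Almost sure convergence makes this set negligible; elsewhere the lower limit is a limit.\<close>
  proof (rule nn_integral_cong_AE)
    show "AE \<omega> in P. ennreal (((\<Sum>k. X k \<omega>) - (\<Sum>k<n. X k \<omega>))\<^sup>2) = liminf (\<lambda>m. ennreal ((\<Sum>i=n..<n+m. X i \<omega>)\<^sup>2))"
      using weighted_series_summable
    proof eventually_elim
      case (elim \<omega>)
      have "(\<lambda>m. \<Sum>i<m+n. X i \<omega>) \<longlonglongrightarrow> (\<Sum>k. X k \<omega>)"
        using elim by (intro LIMSEQ_ignore_initial_segment summable_LIMSEQ) (simp add: X_def)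
      moreover have "(\<Sum>i=n..<n+m. X i \<omega>) = (\<Sum>i<m+n. X i \<omega>) - (\<Sum>k<n. X k \<omega>)" for m
        using sum.atLeastLessThan_concat[of 0 n "n + m" "\<lambda>i. X i \<omega>"] by (simp add: lessThan_atLeast0 add.commute)
      ultimately have "(\<lambda>m. ennreal ((\<Sum>i=n..<n+m. X i \<omega>)\<^sup>2)) \<longlonglongrightarrow> ennreal (((\<Sum>k. X k \<omega>) - (\<Sum>k<n. X k \<omega>))\<^sup>2)"
        by (auto intro!: tendsto_intros)
      then show ?case by (intro lim_imp_Liminf[symmetric]) simp_all
    qed
  qed
  also have "\<dots> \<le> liminf (\<lambda>m. \<integral>\<^sup>+\<omega>. ennreal ((\<Sum>i=n..<n+m. X i \<omega>)\<^sup>2) \<partial>P)"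
    by (rule nn_integral_liminf) measurable
  also have "\<dots> \<le> ennreal Q" using block by (intro Liminf_le) auto
  also have "Q = (W * tail_bound n)\<^sup>2"
    unfolding Q_def tail_bound_def using V_nonneg d_square_tail_summable
    by (subst power_mult_distrib, subst real_sqrt_pow2)
       (auto intro!: mult_nonneg_nonneg suminf_nonneg)
  finally show "(\<integral>\<^sup>+\<omega>. ennreal (((\<Sum>k. c k \<omega> * f (\<xi> k \<omega>) * g k \<omega>) - (\<Sum>k<n. c k \<omega> * f (\<xi> k \<omega>) * g k \<omega>))\<^sup>2) \<partial>P)
    \<le> ennreal ((W * tail_bound n)\<^sup>2)" by (simp add: X_def)
qed (use W tail_bound_nonneg in auto)

end

text \<open>The mean remainder at parameter \<open>p\<close> is at most \<open>w p\<close> times a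
  factor tending to 0 that does not depend on \<open>p\<close>. Integrating over \<open>p\<close>
  and exchanging with the expectation by Tonelli bounds the expected \<open>L^1\<close> distance
  between the series and its partial sums. Finite sums commute with the integral, so the second
  claim compares the integrated series directly with partial sums of the integrated kernel.\<close>

lemma stochastic_fubini:
  fixes \<mu> :: "'p measure" and F :: "'p \<Rightarrow> real \<times> real \<Rightarrow> real"
  assumes \<mu>: "sigma_finite_measure \<mu>"
    and F: "(\<lambda>(p, y). F p y) \<in> borel_measurable (\<mu> \<Otimes>\<^sub>M borel)"
    and w: "integrable \<mu> w" "\<And>p. 0 \<le> w p"
    and sq: "\<And>p. p \<in> space \<mu> \<Longrightarrow> (\<integral>\<^sup>+y. ennreal ((F p y)\<^sup>2) * ennreal (\<phi> y) \<partial>lborel) \<le> ennreal ((w p)\<^sup>2)"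
    and Fint: "\<And>y. integrable \<mu> (\<lambda>p. F p y)"
  shows "AE \<omega> in P. (AE p in \<mu>. summable (\<lambda>k. c k \<omega> * F p (\<xi> k \<omega>) * g k \<omega>)) \<and>
           integrable \<mu> (\<lambda>p. \<Sum>k. c k \<omega> * F p (\<xi> k \<omega>) * g k \<omega>)" (is ?A)
    and "(\<integral>\<^sup>+\<omega>. ennreal \<bar>(\<integral>p. (\<Sum>k. c k \<omega> * F p (\<xi> k \<omega>) * g k \<omega>) \<partial>\<mu>)
           - (\<Sum>k<n. c k \<omega> * (\<integral>p. F p (\<xi> k \<omega>) \<partial>\<mu>) * g k \<omega>)\<bar> \<partial>P) \<le> ennreal (tail_bound n * (\<integral>p. w p \<partial>\<mu>))" (is ?B)
    and "(\<lambda>\<omega>. \<integral>p. (\<Sum>k. c k \<omega> * F p (\<xi> k \<omega>) * g k \<omega>) \<partial>\<mu>) \<in> borel_measurable P" (is ?C)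
proof -
  interpret \<mu>: sigma_finite_measure \<mu> by fact
  interpret pr: pair_sigma_finite \<mu> P ..
  define X where "X k p \<omega> = c k \<omega> * F p (\<xi> k \<omega>) * g k \<omega>" for k p \<omega>
  have F1 [measurable]: "F p \<in> borel_measurable borel" if "p \<in> space \<mu>" for p
    using measurable_compose[OF measurable_Pair1'[OF that] F] by simp
  have Fm: "(\<lambda>q. F (u q) (v q)) \<in> borel_measurable M" if "u \<in> M \<rightarrow>\<^sub>M \<mu>" "v \<in> borel_measurable M" for u v and M :: "('p \<times> 'a) measure"
    using measurable_compose[OF measurable_Pair[OF that] F] by simp
  have [measurable]: "(\<lambda>q. F (fst q) (\<xi> k (snd q))) \<in> borel_measurable (\<mu> \<Otimes>\<^sub>M P)" for k
    by (rule Fm) measurable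
  have Xm [measurable]: "(\<lambda>q. X k (fst q) (snd q)) \<in> borel_measurable (\<mu> \<Otimes>\<^sub>M P)" for k
    unfolding X_def by measurable
  define U where "U p \<omega> = (\<Sum>k. X k p \<omega>)" for p \<omega>
  have Um [measurable]: "(\<lambda>q. U (fst q) (snd q)) \<in> borel_measurable (\<mu> \<Otimes>\<^sub>M P)"
    unfolding U_def by measurable
  have rem: "(\<integral>\<^sup>+\<omega>. (\<integral>\<^sup>+p. ennreal \<bar>U p \<omega> - (\<Sum>k<n. X k p \<omega>)\<bar> \<partial>\<mu>) \<partial>P) \<le> ennreal (tail_bound n * (\<integral>p. w p \<partial>\<mu>))" for n
  proof -
    have "(\<integral>\<^sup>+\<omega>. (\<integral>\<^sup>+p. ennreal \<bar>U p \<omega> - (\<Sum>k<n. X k p \<omega>)\<bar> \<partial>\<mu>) \<partial>P) = (\<integral>\<^sup>+p. (\<integral>\<^sup>+\<omega>. ennreal \<bar>U p \<omega> - (\<Sum>k<n. X k p \<omega>)\<bar> \<partial>P) \<partial>\<mu>)"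
      by (rule pr.Fubini') (simp add: split_beta')
    also have "\<dots> \<le> (\<integral>\<^sup>+p. ennreal (tail_bound n) * ennreal (w p) \<partial>\<mu>)"
    proof (rule nn_integral_mono)
      fix p assume "p \<in> space \<mu>"
      from weighted_series_remainder[OF F1[OF this] sq[OF this] w(2), of n]
      show "(\<integral>\<^sup>+\<omega>. ennreal \<bar>U p \<omega> - (\<Sum>k<n. X k p \<omega>)\<bar> \<partial>P) \<le> ennreal (tail_bound n) * ennreal (w p)"
        using w(2)[of p] tail_bound_nonneg[of n] by (simp add: U_def X_def ennreal_mult'[symmetric] mult.commute)
    qed
    also have "\<dots> = ennreal (tail_bound n) * (\<integral>\<^sup>+p. ennreal (w p) \<partial>\<mu>)"
      using w(1) by (intro nn_integral_cmult) auto
    also have "(\<integral>\<^sup>+p. ennreal (w p) \<partial>\<mu>) = ennreal (\<integral>p. w p \<partial>\<mu>)"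
      by (rule nn_integral_eq_integral) (use w in auto)
    also have "ennreal (tail_bound n) * \<dots> = ennreal (tail_bound n * (\<integral>p. w p \<partial>\<mu>))"
      using tail_bound_nonneg[of n] by (simp add: ennreal_mult')
    finally show ?thesis .
  qed
  have meas_rem [measurable]: "(\<lambda>\<omega>. \<integral>\<^sup>+p. ennreal \<bar>U p \<omega> - (\<Sum>k<n. X k p \<omega>)\<bar> \<partial>\<mu>) \<in> borel_measurable P" for n
  proof -
    have "(\<lambda>q. ennreal \<bar>U (snd q) (fst q) - (\<Sum>k<n. X k (snd q) (fst q))\<bar>) \<in> borel_measurable (P \<Otimes>\<^sub>M \<mu>)"
      using measurable_compose[OF measurable_pair_swap', of "\<lambda>q. ennreal \<bar>U (fst q) (snd q) - (\<Sum>k<n. X k (fst q) (snd q))\<bar>" \<mu> P borel]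
      by (simp add: split_beta')
    from \<mu>.borel_measurable_nn_integral_fst[OF this] show ?thesis by simp
  qed
  have Us2: "(\<lambda>p. U p \<omega>) \<in> borel_measurable \<mu>" if "\<omega> \<in> space P" for \<omega>
    using measurable_compose[OF measurable_Pair2'[OF that] Um] by simp
  \<comment> \<open>For each parameter the series converges for almost every outcome. The product
    set being measurable, the quantifiers may be exchanged.\<close>
  have conv: "AE \<omega> in P. AE p in \<mu>. summable (\<lambda>k. X k p \<omega>)"
  proof (subst pr.AE_commute[symmetric])
    show "{q \<in> space (\<mu> \<Otimes>\<^sub>M P). summable (\<lambda>k. X k (fst q) (snd q))} \<in> sets (\<mu> \<Otimes>\<^sub>M P)"
      by (rule Collect_summable_sets) measurable
    show "AE p in \<mu>. AE \<omega> in P. summable (\<lambda>k. X k p \<omega>)"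
      unfolding X_def by (rule AE_I2) (rule weighted_series_summable[OF F1 sq w(2)])
  qed
  \<comment> \<open>For \<open>n = 0\<close> the remainder is the whole series, so its absolute
    value has a finite integral over outcomes and parameters.\<close>
  have "(\<integral>\<^sup>+\<omega>. (\<integral>\<^sup>+p. ennreal \<bar>U p \<omega>\<bar> \<partial>\<mu>) \<partial>P) < \<infinity>" using rem[of 0] by (auto intro: le_less_trans)
  then have "AE \<omega> in P. (\<integral>\<^sup>+p. ennreal \<bar>U p \<omega>\<bar> \<partial>\<mu>) \<noteq> \<infinity>"
    using meas_rem[of 0] by (intro nn_integral_noteq_infinite) auto
  with AE_space have Uint: "AE \<omega> in P. integrable \<mu> (\<lambda>p. U p \<omega>)"
    by eventually_elim (auto intro!: integrableI_bounded Us2 simp: less_top)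
  from conv Uint show ?A unfolding U_def X_def by eventually_elim simp
  have Xint: "integrable \<mu> (\<lambda>p. X k p \<omega>)" for k \<omega> unfolding X_def using Fint by simp
  have "(\<integral>\<^sup>+\<omega>. ennreal \<bar>(\<integral>p. U p \<omega> \<partial>\<mu>) - (\<Sum>k<n. c k \<omega> * (\<integral>p. F p (\<xi> k \<omega>) \<partial>\<mu>) * g k \<omega>)\<bar> \<partial>P)
      \<le> (\<integral>\<^sup>+\<omega>. (\<integral>\<^sup>+p. ennreal \<bar>U p \<omega> - (\<Sum>k<n. X k p \<omega>)\<bar> \<partial>\<mu>) \<partial>P)"
  proof (rule nn_integral_mono_AE)
    show "AE \<omega> in P. ennreal \<bar>(\<integral>p. U p \<omega> \<partial>\<mu>) - (\<Sum>k<n. c k \<omega> * (\<integral>p. F p (\<xi> k \<omega>) \<partial>\<mu>) * g k \<omega>)\<bar>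
       \<le> (\<integral>\<^sup>+p. ennreal \<bar>U p \<omega> - (\<Sum>k<n. X k p \<omega>)\<bar> \<partial>\<mu>)"
      using Uint
    proof eventually_elim
      case (elim \<omega>)
      have "(\<integral>p. U p \<omega> \<partial>\<mu>) - (\<Sum>k<n. c k \<omega> * (\<integral>p. F p (\<xi> k \<omega>) \<partial>\<mu>) * g k \<omega>) = (\<integral>p. U p \<omega> - (\<Sum>k<n. X k p \<omega>) \<partial>\<mu>)"
        using elim Xint by (simp add: Bochner_Integration.integral_sum) (simp add: X_def)
      also have "ennreal \<bar>\<dots>\<bar> \<le> (\<integral>\<^sup>+p. ennreal \<bar>U p \<omega> - (\<Sum>k<n. X k p \<omega>)\<bar> \<partial>\<mu>)"
        using integral_norm_bound_ennreal[of \<mu> "\<lambda>p. U p \<omega> - (\<Sum>k<n. X k p \<omega>)"] elim Xint by simp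
      finally show ?case .
    qed
  qed
  with rem[of n] show ?B unfolding U_def X_def by (rule order_trans[rotated])
  have "(\<lambda>(\<omega>, p). U p \<omega>) \<in> borel_measurable (P \<Otimes>\<^sub>M \<mu>)"
    using measurable_compose[OF measurable_pair_swap' Um] by (simp add: split_beta')
  from \<mu>.borel_measurable_lebesgue_integral[of "\<lambda>\<omega> p. U p \<omega>", OF this] show ?C
    unfolding U_def X_def .
qed

text \<open>The two kernels may live on different parameter spaces, here space-time and time. Once
  integrated they are the same function of \<open>y\<close>, so both random variables are
  approximated in mean by the same partial sums and must coincide almost surely.\<close>

lemma stochastic_fubini_eq:
  fixes \<mu>1 :: "'p measure" and F1 :: "'p \<Rightarrow> real \<times> real \<Rightarrow> real"
    and \<mu>2 :: "'q measure" and F2 :: "'q \<Rightarrow> real \<times> real \<Rightarrow> real"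
  assumes \<mu>1: "sigma_finite_measure \<mu>1"
    and F1: "(\<lambda>(p, y). F1 p y) \<in> borel_measurable (\<mu>1 \<Otimes>\<^sub>M borel)"
    and w1: "integrable \<mu>1 w1" "\<And>p. 0 \<le> w1 p"
    and sq1: "\<And>p. p \<in> space \<mu>1 \<Longrightarrow> (\<integral>\<^sup>+y. ennreal ((F1 p y)\<^sup>2) * ennreal (\<phi> y) \<partial>lborel) \<le> ennreal ((w1 p)\<^sup>2)"
    and Fint1: "\<And>y. integrable \<mu>1 (\<lambda>p. F1 p y)"
    and \<mu>2: "sigma_finite_measure \<mu>2"
    and F2: "(\<lambda>(p, y). F2 p y) \<in> borel_measurable (\<mu>2 \<Otimes>\<^sub>M borel)"
    and w2: "integrable \<mu>2 w2" "\<And>p. 0 \<le> w2 p"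
    and sq2: "\<And>p. p \<in> space \<mu>2 \<Longrightarrow> (\<integral>\<^sup>+y. ennreal ((F2 p y)\<^sup>2) * ennreal (\<phi> y) \<partial>lborel) \<le> ennreal ((w2 p)\<^sup>2)"
    and Fint2: "\<And>y. integrable \<mu>2 (\<lambda>p. F2 p y)"
    and eq: "\<And>y. (\<integral>p. F1 p y \<partial>\<mu>1) = (\<integral>p. F2 p y \<partial>\<mu>2)"
  shows "AE \<omega> in P. (\<integral>p. (\<Sum>k. c k \<omega> * F1 p (\<xi> k \<omega>) * g k \<omega>) \<partial>\<mu>1) = (\<integral>p. (\<Sum>k. c k \<omega> * F2 p (\<xi> k \<omega>) * g k \<omega>) \<partial>\<mu>2)"
proof -
  note S1 = stochastic_fubini[OF \<mu>1 F1 w1 sq1 Fint1] and S2 = stochastic_fubini[OF \<mu>2 F2 w2 sq2 Fint2]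
  define I1 I2 where "I1 \<omega> = (\<integral>p. (\<Sum>k. c k \<omega> * F1 p (\<xi> k \<omega>) * g k \<omega>) \<partial>\<mu>1)"
    and "I2 \<omega> = (\<integral>p. (\<Sum>k. c k \<omega> * F2 p (\<xi> k \<omega>) * g k \<omega>) \<partial>\<mu>2)" for \<omega>
  have [measurable]: "I1 \<in> borel_measurable P" "I2 \<in> borel_measurable P"
    using S1(3) S2(3) by (simp_all add: I1_def[abs_def] I2_def[abs_def])
  define fb where "fb y = (\<integral>p. F1 p y \<partial>\<mu>1)" for y
  have fbm [measurable]: "fb \<in> borel_measurable borel"
  proof -
    interpret sigma_finite_measure \<mu>1 by fact
    have "(\<lambda>(y, p). F1 p y) \<in> borel_measurable (borel \<Otimes>\<^sub>M \<mu>1)"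
      using measurable_compose[OF measurable_pair_swap' F1] by (simp add: split_beta')
    from borel_measurable_lebesgue_integral[of "\<lambda>y p. F1 p y", OF this] show ?thesis
      by (simp add: fb_def[abs_def])
  qed
  define s where "s n \<omega> = (\<Sum>k<n. c k \<omega> * fb (\<xi> k \<omega>) * g k \<omega>)" for n \<omega>
  have [measurable]: "s n \<in> borel_measurable P" for n unfolding s_def by measurable
  let ?w = "(\<integral>p. w1 p \<partial>\<mu>1) + (\<integral>p. w2 p \<partial>\<mu>2)"
  have w0: "0 \<le> (\<integral>p. w1 p \<partial>\<mu>1)" "0 \<le> (\<integral>p. w2 p \<partial>\<mu>2)" using w1 w2 by simp_all
  have le: "(\<integral>\<^sup>+\<omega>. ennreal \<bar>I1 \<omega> - I2 \<omega>\<bar> \<partial>P) \<le> ennreal (tail_bound n * ?w)" for n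
  proof -
    have "(\<integral>\<^sup>+\<omega>. ennreal \<bar>I1 \<omega> - I2 \<omega>\<bar> \<partial>P) \<le> (\<integral>\<^sup>+\<omega>. ennreal \<bar>I1 \<omega> - s n \<omega>\<bar> + ennreal \<bar>I2 \<omega> - s n \<omega>\<bar> \<partial>P)"
      by (intro nn_integral_mono) (auto simp: ennreal_plus[symmetric] simp del: ennreal_plus intro!: ennreal_leI)
    also have "\<dots> = (\<integral>\<^sup>+\<omega>. ennreal \<bar>I1 \<omega> - s n \<omega>\<bar> \<partial>P) + (\<integral>\<^sup>+\<omega>. ennreal \<bar>I2 \<omega> - s n \<omega>\<bar> \<partial>P)"
      by (rule nn_integral_add) measurable
    also have "\<dots> \<le> ennreal (tail_bound n * (\<integral>p. w1 p \<partial>\<mu>1)) + ennreal (tail_bound n * (\<integral>p. w2 p \<partial>\<mu>2))"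
      using S1(2)[of n] S2(2)[of n] by (intro add_mono) (simp_all add: I1_def I2_def s_def fb_def eq)
    also have "\<dots> = ennreal (tail_bound n * ?w)"
      using w0 tail_bound_nonneg[of n] by (simp add: ennreal_plus[symmetric] distrib_left del: ennreal_plus)
    finally show ?thesis .
  qed
  have "(\<lambda>n. ennreal (tail_bound n * ?w)) \<longlonglongrightarrow> ennreal (0 * ?w)"
    by (intro tendsto_intros tail_bound_tendsto)
  then have "(\<integral>\<^sup>+\<omega>. ennreal \<bar>I1 \<omega> - I2 \<omega>\<bar> \<partial>P) \<le> ennreal (0 * ?w)" using le by (intro LIMSEQ_le_const) auto
  then have "(\<integral>\<^sup>+\<omega>. ennreal \<bar>I1 \<omega> - I2 \<omega>\<bar> \<partial>P) = 0" by simp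
  then have "AE \<omega> in P. ennreal \<bar>I1 \<omega> - I2 \<omega>\<bar> = 0" by (subst (asm) nn_integral_0_iff_AE) auto
  then show ?thesis unfolding I1_def I2_def by eventually_elim simp
qed

end

section \<open>The wave kernel\<close>

definition wave_kernel :: "real \<Rightarrow> real \<Rightarrow> real \<times> real \<Rightarrow> real" where
  "wave_kernel a s z =
     (if norm z < a * s then 1 / (2 * pi * a * sqrt ((a * s)\<^sup>2 - (norm z)\<^sup>2)) else 0)"

lemma wave_kernel_measurable [measurable]:
  "(\<lambda>p. wave_kernel a (f p) (h p)) \<in> borel_measurable M"
  if [measurable]: "f \<in> borel_measurable M" "h \<in> M \<rightarrow>\<^sub>M borel"
  unfolding wave_kernel_def by measurable

lemma wave_kernel_measurable_pair [measurable]: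
  "(\<lambda>p. wave_kernel a (fst p) (snd p)) \<in> borel_measurable borel"
  by (subst borel_prod[symmetric]) measurable

lemma wave_kernel_nonneg: "0 < a \<Longrightarrow> 0 \<le> wave_kernel a s z"
  by (auto simp: wave_kernel_def intro!: mult_nonneg_nonneg power_mono)

lemma wave_kernel_nonpos_time:
  assumes "0 < a" "s \<le> 0"
  shows "wave_kernel a s z = 0"
proof -
  have "a * s \<le> norm z" using assms by (intro order_trans[OF _ norm_ge_zero]) (simp add: mult_le_0_iff)
  then show ?thesis by (simp add: wave_kernel_def)
qed

text \<open>The map u to c sin u is monotone on the closed interval, with derivative c cos u \<ge>
  0. This Jacobian is what absorbs the inverse square root in the kernel.\<close>

lemma nn_integral_sine_substitution:
  fixes f :: "real \<Rightarrow> ennreal"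
  assumes "f \<in> borel_measurable borel" "0 \<le> c" "\<And>x. c < \<bar>x\<bar> \<Longrightarrow> f x = 0"
  shows "(\<integral>\<^sup>+x. f x \<partial>lborel) =
    (\<integral>\<^sup>+u. f (c * sin u) * ennreal (c * cos u) * indicator {-(pi/2)..pi/2} u \<partial>lborel)"
proof -
  have "(\<integral>\<^sup>+x. f x \<partial>lborel) = (\<integral>\<^sup>+x. f x * indicator {c * sin (-(pi/2))..c * sin (pi/2)} x \<partial>lborel)"
    using assms(3) by (intro nn_integral_cong) (auto simp: indicator_def abs_le_iff not_le abs_if)
  also have "\<dots> = (\<integral>\<^sup>+u. f (c * sin u) * ennreal (c * cos u) * indicator {-(pi/2)..pi/2} u \<partial>lborel)"
    using assms(2)
    by (intro nn_integral_substitution_aux assms(1))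
       (auto intro!: derivative_eq_intros continuous_intros mult_nonneg_nonneg cos_ge_zero)
  finally show ?thesis .
qed

lemma abs_less_iff_square_less: "\<bar>x\<bar> < \<bar>y\<bar> \<longleftrightarrow> x\<^sup>2 < (y::real)\<^sup>2"
  using abs_le_square_iff[of y x] by (simp add: not_le[symmetric])

text \<open>The weight is the surface measure of the upper hemisphere seen from above. Spherical coordinates
  with the pole on the second axis, \<open>z = r (cos u sin v, sin u)\<close>, turn it into \<open>r cos u\<close>
  by two one-dimensional sine substitutions.\<close>

lemma nn_integral_hemisphere:
  fixes h :: "real \<times> real \<Rightarrow> ennreal"
  assumes h [measurable]: "h \<in> borel_measurable borel" and r: "0 < r"
  shows "(\<integral>\<^sup>+z. h z * ennreal (if norm z < r then 1 / sqrt (r\<^sup>2 - (norm z)\<^sup>2) else 0) \<partial>lborel) =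
    (\<integral>\<^sup>+u. (\<integral>\<^sup>+v. h (r * cos u * sin v, r * sin u) * ennreal (r * cos u)
        * indicator ({-(pi/2)..pi/2} \<times> {-(pi/2)..pi/2}) (u, v) \<partial>lborel) \<partial>lborel)"
proof -
  define \<kappa> where "\<kappa> = (\<lambda>z::real \<times> real. if norm z < r then 1 / sqrt (r\<^sup>2 - (norm z)\<^sup>2) else 0)"
  have [measurable]: "\<kappa> \<in> borel_measurable borel" unfolding \<kappa>_def by measurable
  have norm_lt: "norm (x, y) < r \<longleftrightarrow> x\<^sup>2 + y\<^sup>2 < r\<^sup>2" for x y :: real
    using r abs_less_iff_square_less[of "norm (x, y)" r] by (simp add: norm_prod_def)
  have norm_sq: "(norm (x, y))\<^sup>2 = x\<^sup>2 + y\<^sup>2" for x y :: real by (simp add: norm_prod_def)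
  define O' where "O' = (\<lambda>y. \<integral>\<^sup>+x. h (x, y) * ennreal (\<kappa> (x, y)) \<partial>lborel)"
  have [measurable]: "O' \<in> borel_measurable borel" unfolding O'_def by measurable
  have O'_eq: "O' (r * sin u) * ennreal (r * cos u) =
      (\<integral>\<^sup>+v. h (r * cos u * sin v, r * sin u) * ennreal (r * cos u) * indicator {-(pi/2)..pi/2} v \<partial>lborel)"
    if u: "-(pi/2) < u" "u < pi/2" for u
  proof -
    have cu: "0 < cos u" using u by (intro cos_gt_zero_pi) auto
    have "O' (r * sin u) = (\<integral>\<^sup>+v. h (r * cos u * sin v, r * sin u) * ennreal (\<kappa> (r * cos u * sin v, r * sin u))
        * ennreal (r * cos u * cos v) * indicator {-(pi/2)..pi/2} v \<partial>lborel)"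
      unfolding O'_def
    proof (rule nn_integral_sine_substitution)
      fix x assume "r * cos u < \<bar>x\<bar>"
      then have "(r * cos u)\<^sup>2 < x\<^sup>2"
        using r cu abs_less_iff_square_less[of "r * cos u" x] by simp
      moreover have "r\<^sup>2 = (r * cos u)\<^sup>2 + (r * sin u)\<^sup>2"
        by (simp add: power_mult_distrib flip: distrib_left)
      ultimately have "\<not> x\<^sup>2 + (r * sin u)\<^sup>2 < r\<^sup>2" by linarith
      then show "h (x, r * sin u) * ennreal (\<kappa> (x, r * sin u)) = 0"
        by (simp add: \<kappa>_def norm_lt)
    qed (use r cu in auto)
    also have "\<dots> = (\<integral>\<^sup>+v. h (r * cos u * sin v, r * sin u) * indicator {-(pi/2)..pi/2} v \<partial>lborel)"
    proof (rule nn_integral_cong_AE)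
      \<comment> \<open>At both ends cos v = 0: the Jacobian vanishes and the kernel has its default
        value 0, so the product is 0 there instead of 1. Two points do not matter.\<close>
      have "AE v in lborel. v \<noteq> pi/2" "AE v in lborel. v \<noteq> -(pi/2)" by (rule AE_lborel_singleton)+
      then show "AE v in lborel. h (r * cos u * sin v, r * sin u) * ennreal (\<kappa> (r * cos u * sin v, r * sin u))
        * ennreal (r * cos u * cos v) * indicator {-(pi/2)..pi/2} v =
        h (r * cos u * sin v, r * sin u) * indicator {-(pi/2)..pi/2} v"
      proof eventually_elim
        case (elim v)
        show ?case
        proof (cases "v \<in> {-(pi/2)..pi/2}")
          case True
          then have cv: "0 < cos v" using elim by (intro cos_gt_zero_pi) auto
          \<comment> \<open>The right-hand side is the squared height of the point of the hemisphere
            above \<open>z\<close>.\<close>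
          have eq: "r\<^sup>2 - ((r * cos u * sin v)\<^sup>2 + (r * sin u)\<^sup>2) = (r * cos u * cos v)\<^sup>2"
            unfolding power_mult_distrib sin_squared_eq by (simp add: algebra_simps)
          have pos: "0 < r * cos u * cos v" using r cu cv by simp
          have "(r * cos u * sin v)\<^sup>2 + (r * sin u)\<^sup>2 < r\<^sup>2"
            using eq zero_less_power[OF pos, of 2] by linarith
          then have "\<kappa> (r * cos u * sin v, r * sin u) = 1 / (r * cos u * cos v)"
            using pos unfolding \<kappa>_def norm_lt norm_sq eq by (simp only: if_True real_sqrt_abs abs_of_pos)
          then have "ennreal (\<kappa> (r * cos u * sin v, r * sin u)) * ennreal (r * cos u * cos v) = 1"
            using r cu cv by (simp flip: ennreal_mult)
          then show ?thesis by (simp add: mult.assoc)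
        qed simp
      qed
    qed
    finally have "O' (r * sin u) = \<dots>" .
    then show ?thesis
      by (simp add: nn_integral_multc[symmetric] mult.assoc)
         (simp add: mult.commute[of "indicator _ _ :: ennreal"])
  qed
  have "(\<integral>\<^sup>+z. h z * ennreal (\<kappa> z) \<partial>lborel) = (\<integral>\<^sup>+y. O' y \<partial>lborel)"
    unfolding O'_def by (subst lborel_pair.nn_integral_snd) (auto simp: lborel_prod)
  also have "\<dots> = (\<integral>\<^sup>+u. O' (r * sin u) * ennreal (r * cos u) * indicator {-(pi/2)..pi/2} u \<partial>lborel)"
  proof (rule nn_integral_sine_substitution)
    fix y assume "r < \<bar>y\<bar>"
    then have "r\<^sup>2 < y\<^sup>2" using r abs_less_iff_square_less[of r y] by simp
    then have "\<not> x\<^sup>2 + y\<^sup>2 < r\<^sup>2" for x :: real using zero_le_power2[of x] by linarith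
    then show "O' y = 0" by (simp add: O'_def \<kappa>_def norm_lt)
  qed (use r in auto)
  also have "\<dots> = (\<integral>\<^sup>+u. (\<integral>\<^sup>+v. h (r * cos u * sin v, r * sin u) * ennreal (r * cos u)
        * indicator ({-(pi/2)..pi/2} \<times> {-(pi/2)..pi/2}) (u, v) \<partial>lborel) \<partial>lborel)"
  proof (rule nn_integral_cong_AE)
    have "AE v in lborel. v \<noteq> pi/2" "AE v in lborel. v \<noteq> -(pi/2)" by (rule AE_lborel_singleton)+
    then show "AE u in lborel. O' (r * sin u) * ennreal (r * cos u) * indicator {-(pi/2)..pi/2} u = 
       (\<integral>\<^sup>+v. h (r * cos u * sin v, r * sin u) * ennreal (r * cos u)
        * indicator ({-(pi/2)..pi/2} \<times> {-(pi/2)..pi/2}) (u, v) \<partial>lborel)"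
    proof eventually_elim
      case (elim u)
      then show ?case using O'_eq[of u]
        by (cases "u \<in> {-(pi/2)..pi/2}") (auto simp: indicator_times)
    qed
  qed
  finally show ?thesis unfolding \<kappa>_def .
qed

text \<open>Elapsed time \<open>s\<close> together with the projection to the plane of the point at
  radius \<open>a * s\<close> in direction (cos u sin v, sin u, cos u cos v); the third coordinate
  is dropped.\<close>

definition cone_param :: "real \<Rightarrow> real \<times> real \<times> real \<Rightarrow> real \<times> (real \<times> real)" where
  "cone_param a = (\<lambda>(s, u, v). (s, (a * s * cos u * sin v, a * s * sin u)))"

text \<open>The hemisphere of radius \<open>a * s\<close> contributes \<open>a * s * cos u\<close>,
  and the factor 1/(2 \<pi> a) of the kernel cancels the speed. The indicator selects positive times
  and the upper hemisphere.\<close>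

definition cone_weight :: "real \<times> real \<times> real \<Rightarrow> real" where
  "cone_weight = (\<lambda>(s, u, v). s * cos u / (2 * pi) *
     indicator ({0..} \<times> {-(pi/2)..pi/2} \<times> {-(pi/2)..pi/2}) (s, u, v))"

lemma cone_param_measurable [measurable]: "cone_param a \<in> borel \<rightarrow>\<^sub>M borel"
  unfolding cone_param_def by (intro borel_measurable_continuous_onI) (auto intro!: continuous_intros simp: split_beta')

lemma cone_weight_measurable [measurable]: "cone_weight \<in> borel_measurable borel"
proof -
  have [measurable]: "{0..} \<times> {-(pi/2)..pi/2} \<times> {-(pi/2)..pi/2} \<in> sets (borel :: (real \<times> real \<times> real) measure)"
    by (intro borel_closed closed_Times) auto
  show ?thesis unfolding cone_weight_def split_beta' prod.collapse
    by (intro borel_measurable_times borel_measurable_indicator)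
       (auto intro!: borel_measurable_continuous_onI continuous_intros)
qed

lemma cone_weight_nonneg: "0 \<le> cone_weight p"
  by (auto simp: cone_weight_def indicator_def split: prod.split
      intro!: mult_nonneg_nonneg divide_nonneg_nonneg cos_ge_zero)

lemma wave_kernel_slice:
  fixes h :: "real \<times> real \<Rightarrow> ennreal"
  assumes [measurable]: "h \<in> borel_measurable borel" and a: "0 < a"
  shows "(\<integral>\<^sup>+z. h z * ennreal (wave_kernel a s z) \<partial>lborel) =
    (\<integral>\<^sup>+u. (\<integral>\<^sup>+v. h (snd (cone_param a (s, u, v))) * ennreal (cone_weight (s, u, v)) \<partial>lborel) \<partial>lborel)"
proof (cases "0 < s")
  case False
  then have "wave_kernel a s z = 0" for z using a by (simp add: wave_kernel_nonpos_time)
  moreover have "cone_weight (s, u, v) = 0" for u v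
    using False by (auto simp: cone_weight_def indicator_def)
  ultimately show ?thesis by simp
next
  case True
  then have r: "0 < a * s" using a by simp
  define \<kappa> where "\<kappa> = (\<lambda>z::real \<times> real. if norm z < a * s then 1 / sqrt ((a * s)\<^sup>2 - (norm z)\<^sup>2) else 0)"
  have [measurable]: "\<kappa> \<in> borel_measurable borel" unfolding \<kappa>_def by measurable
  have \<kappa>0: "0 \<le> \<kappa> z" for z unfolding \<kappa>_def by (auto intro!: power_mono)
  have k: "wave_kernel a s z = 1 / (2 * pi * a) * \<kappa> z" for z
    by (simp add: wave_kernel_def \<kappa>_def)
  have w: "h (snd (cone_param a (s, u, v))) * ennreal (cone_weight (s, u, v)) =
      ennreal (1 / (2 * pi * a)) * (h (a * s * cos u * sin v, a * s * sin u) * ennreal (a * s * cos u)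
        * indicator ({-(pi/2)..pi/2} \<times> {-(pi/2)..pi/2}) (u, v))" for u v
  proof (cases "(u, v) \<in> {-(pi/2)..pi/2} \<times> {-(pi/2)..pi/2}")
    case T: True
    then have "0 \<le> cos u" by (auto intro: cos_ge_zero)
    moreover have "cone_weight (s, u, v) = 1 / (2 * pi * a) * (a * s * cos u)"
      using T True a by (simp add: cone_weight_def)
    ultimately have "ennreal (cone_weight (s, u, v)) = ennreal (1 / (2 * pi * a)) * ennreal (a * s * cos u)"
      using a r by (subst ennreal_mult[symmetric]) (auto intro!: mult_nonneg_nonneg)
    then show ?thesis using T by (simp add: cone_param_def ac_simps)
  qed (auto simp: cone_weight_def indicator_def)
  have "(\<integral>\<^sup>+z. h z * ennreal (wave_kernel a s z) \<partial>lborel) = (\<integral>\<^sup>+z. ennreal (1 / (2 * pi * a)) * (h z * ennreal (\<kappa> z)) \<partial>lborel)"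
    unfolding k using a \<kappa>0 by (intro nn_integral_cong, subst ennreal_mult) (auto simp: ac_simps)
  also have "\<dots> = ennreal (1 / (2 * pi * a)) * (\<integral>\<^sup>+z. h z * ennreal (\<kappa> z) \<partial>lborel)"
    by (rule nn_integral_cmult) measurable
  also have "(\<integral>\<^sup>+z. h z * ennreal (\<kappa> z) \<partial>lborel) = (\<integral>\<^sup>+u. (\<integral>\<^sup>+v. h (a * s * cos u * sin v, a * s * sin u) * ennreal (a * s * cos u)
        * indicator ({-(pi/2)..pi/2} \<times> {-(pi/2)..pi/2}) (u, v) \<partial>lborel) \<partial>lborel)"
    unfolding \<kappa>_def by (rule nn_integral_hemisphere[OF _ r]) measurable
  finally show ?thesis unfolding w by (subst (asm) nn_integral_cmult[symmetric], measurable)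
     (subst (asm) nn_integral_cmult[symmetric], measurable)
qed

text \<open>Slice by slice in time this is the hemisphere formula. As an equality of measures it
  transfers to integrands of either sign and gives integrability along with the value of the
  integral.\<close>

lemma wave_kernel_eq_distr:
  assumes a: "0 < a"
  shows "density lborel (\<lambda>p. ennreal (wave_kernel a (fst p) (snd p))) =
    distr (density lborel (\<lambda>p. ennreal (cone_weight p))) borel (cone_param a)"
proof (rule measure_eqI)
  fix A :: "(real \<times> real \<times> real) set" assume "A \<in> sets (density lborel (\<lambda>p. ennreal (wave_kernel a (fst p) (snd p))))"
  then have A [measurable]: "A \<in> sets borel" by simp
  have sl: "(\<lambda>z. indicator A (s, z)) \<in> borel_measurable borel" for s
    by (rule measurable_compose[OF _ borel_measurable_indicator[OF A]])
       (intro borel_measurable_continuous_onI continuous_intros)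
  have "emeasure (density lborel (\<lambda>p. ennreal (wave_kernel a (fst p) (snd p)))) A =
      (\<integral>\<^sup>+p. indicator A p * ennreal (wave_kernel a (fst p) (snd p)) \<partial>lborel)"
    by (subst emeasure_density) (auto simp: mult.commute)
  also have "\<dots> = (\<integral>\<^sup>+s. \<integral>\<^sup>+z. indicator A (s, z) * ennreal (wave_kernel a s z) \<partial>lborel \<partial>lborel)"
    by (subst lborel_prod[symmetric], subst lborel.nn_integral_fst[symmetric]) (auto simp: lborel_prod)
  also have "\<dots> = (\<integral>\<^sup>+s. \<integral>\<^sup>+u. \<integral>\<^sup>+v. indicator A (s, snd (cone_param a (s, u, v))) * ennreal (cone_weight (s, u, v)) \<partial>lborel \<partial>lborel \<partial>lborel)"
    by (subst wave_kernel_slice[OF _ a]) (auto intro: sl)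
  also have "\<dots> = (\<integral>\<^sup>+s. \<integral>\<^sup>+u. \<integral>\<^sup>+v. indicator A (cone_param a (s, u, v)) * ennreal (cone_weight (s, u, v)) \<partial>lborel \<partial>lborel \<partial>lborel)"
    by (simp add: cone_param_def)
  also have "\<dots> = (\<integral>\<^sup>+s. \<integral>\<^sup>+w. indicator A (cone_param a (s, w)) * ennreal (cone_weight (s, w)) \<partial>lborel \<partial>lborel)"
    by (subst lborel_prod[symmetric], subst lborel.nn_integral_fst[symmetric]) (auto simp: lborel_prod)
  also have "\<dots> = (\<integral>\<^sup>+p. indicator A (cone_param a p) * ennreal (cone_weight p) \<partial>lborel)"
    using lborel.nn_integral_fst[where ?M1.0=lborel and f="\<lambda>p. indicator A (cone_param a p) * ennreal (cone_weight p)"]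
    by (simp add: lborel_prod)
  also have "\<dots> = emeasure (distr (density lborel (\<lambda>p. ennreal (cone_weight p))) borel (cone_param a)) A"
    by (subst emeasure_distr, measurable)
       (auto simp: emeasure_density mult.commute indicator_vimage measurable_sets_borel[OF cone_param_measurable A] intro!: nn_integral_cong split: split_indicator)
  finally show "emeasure (density lborel (\<lambda>p. ennreal (wave_kernel a (fst p) (snd p)))) A =
     emeasure (distr (density lborel (\<lambda>p. ennreal (cone_weight p))) borel (cone_param a)) A" .
qed simp

lemma wave_kernel_change_of_variables:
  fixes f :: "real \<times> (real \<times> real) \<Rightarrow> real"
  assumes a: "0 < a" and f [measurable]: "f \<in> borel_measurable borel"
  shows "integrable lborel (\<lambda>p. wave_kernel a (fst p) (snd p) * f p) \<longleftrightarrow>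
           integrable lborel (\<lambda>p. cone_weight p * f (cone_param a p))" (is ?thesis1)
    and "(\<integral>p. wave_kernel a (fst p) (snd p) * f p \<partial>lborel) =
           (\<integral>p. cone_weight p * f (cone_param a p) \<partial>lborel)" (is ?thesis2)
proof -
  let ?M = "density lborel (\<lambda>p. ennreal (wave_kernel a (fst p) (snd p)))"
  let ?N = "density lborel (\<lambda>p. ennreal (cone_weight p))"
  have 1: "integrable lborel (\<lambda>p. wave_kernel a (fst p) (snd p) * f p) \<longleftrightarrow> integrable ?M f"
    by (subst integrable_density) (auto simp: wave_kernel_nonneg a)
  have 2: "integrable (distr ?N borel (cone_param a)) f \<longleftrightarrow> integrable lborel (\<lambda>p. cone_weight p * f (cone_param a p))"
    by (subst integrable_distr_eq) (auto simp: integrable_density cone_weight_nonneg)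
  have 3: "(\<integral>p. wave_kernel a (fst p) (snd p) * f p \<partial>lborel) = integral\<^sup>L ?M f"
    by (subst integral_density) (auto simp: wave_kernel_nonneg a)
  have 4: "integral\<^sup>L (distr ?N borel (cone_param a)) f = (\<integral>p. cone_weight p * f (cone_param a p) \<partial>lborel)"
    by (subst integral_distr) (auto simp: integral_density cone_weight_nonneg)
  show ?thesis1 unfolding 1 2[symmetric] wave_kernel_eq_distr[OF a] ..
  show ?thesis2 unfolding 3 4[symmetric] wave_kernel_eq_distr[OF a] ..
qed

section \<open>Smooth functions of a point and time\<close>

lemma smooth3_pdiff: "smooth3 f \<Longrightarrow> i \<in> {0,1,2} \<Longrightarrow> smooth3 (pdiff i f)"
  unfolding smooth3_def
proof (intro allI impI)
  fix ds assume *: "\<forall>ds. set ds \<subseteq> {0,1,2} \<longrightarrow>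
     continuous_on UNIV (\<lambda>(x, t). foldr pdiff ds f x t) \<and>
     (\<forall>i\<in>{0,1,2}. partial_exists i (foldr pdiff ds f))"
    and i: "i \<in> {0,1,2}" and ds: "set ds \<subseteq> {0,1,2::nat}"
  then show "continuous_on UNIV (\<lambda>(x, t). foldr pdiff ds (pdiff i f) x t) \<and>
     (\<forall>ia\<in>{0,1,2}. partial_exists ia (foldr pdiff ds (pdiff i f)))"
    using *[rule_format, of "ds @ [i]"] by simp
qed

lemma smooth3_continuous: "smooth3 f \<Longrightarrow> continuous_on UNIV (\<lambda>(x, t). f x t)"
  unfolding smooth3_def by (drule spec[of _ "[]"]) simp

lemma smooth3_continuous_on:
  assumes "smooth3 f" "continuous_on S X" "continuous_on S T"
  shows "continuous_on S (\<lambda>p. f (X p) (T p))"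
  using continuous_on_compose2[OF smooth3_continuous[OF assms(1)] continuous_on_Pair[OF assms(2,3)]]
  by simp

section \<open>Total derivatives and the chain rule\<close>

lemma smooth3_partials:
  assumes "smooth3 f"
  shows "((\<lambda>s. f (s, x2) t) has_real_derivative pdiff 0 f (x1, x2) t) (at x1)"
    and "((\<lambda>s. f (x1, s) t) has_real_derivative pdiff 1 f (x1, x2) t) (at x2)"
    and "((\<lambda>s. f x s) has_real_derivative pdiff 2 f x t) (at t)"
proof -
  have *: "partial_exists i f" if "i \<in> {0,1,2}" for i
    using assms[unfolded smooth3_def, THEN spec[of _ "[]"]] that by auto
  show "((\<lambda>s. f (s, x2) t) has_real_derivative pdiff 0 f (x1, x2) t) (at x1)"
    using *[of 0] by (auto simp: partial_exists_def pdiff_def DERIV_deriv_iff_real_differentiable)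
  show "((\<lambda>s. f (x1, s) t) has_real_derivative pdiff 1 f (x1, x2) t) (at x2)"
    using *[of 1] by (auto simp: partial_exists_def pdiff_def DERIV_deriv_iff_real_differentiable)
  show "((\<lambda>s. f x s) has_real_derivative pdiff 2 f x t) (at t)"
    using *[of 2] by (cases x) (auto simp: partial_exists_def pdiff_def DERIV_deriv_iff_real_differentiable)
qed

text \<open>Adds one real variable to a function already differentiable in the others, at the price
  of continuity of the new partial derivative. Applied twice, it turns the partial derivatives of a
  smooth function into a total derivative.\<close>

lemma has_derivative_partials_real:
  fixes F :: "'a::real_normed_vector \<Rightarrow> real \<Rightarrow> real"
  assumes "((\<lambda>x. F x y) has_derivative D) (at x)"
    and "\<And>x y. ((\<lambda>y. F x y) has_real_derivative G x y) (at y)"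
    and "continuous_on UNIV (\<lambda>(x, y). G x y)"
  shows "((\<lambda>(x, y). F x y) has_derivative (\<lambda>(h, k). D h + k * G x y)) (at (x, y))"
proof -
  have "((\<lambda>(x, y). F x y) has_derivative (\<lambda>(h, k). D h + blinfun_apply (blinfun_scaleR_left (G x y)) k)) (at (x, y) within UNIV \<times> UNIV)"
  proof (rule has_derivative_partialsI)
    show "(F x has_derivative blinfun_apply (blinfun_scaleR_left (G x y))) (at y within UNIV)" for x y
      using assms(2)[of x y] by (simp add: has_field_derivative_def mult_commute_abs)
    have "isCont (\<lambda>p. G (fst p) (snd p)) (x, y)"
      using assms(3) by (simp add: continuous_on_eq_continuous_at split_beta')
    then show "continuous (at (x, y) within UNIV \<times> UNIV) (\<lambda>(x, y). blinfun_scaleR_left (G x y))"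
      by (simp add: split_beta' bounded_linear.continuous[OF bounded_linear_blinfun_scaleR_left])
  qed (use assms(1) in auto)
  then show ?thesis by (simp add: mult.commute)
qed

lemma smooth3_has_derivative:
  assumes f: "smooth3 f"
  shows "((\<lambda>(x, t). f x t) has_derivative
     (\<lambda>((h1, h2), k). h1 * pdiff 0 f (x1, x2) t + h2 * pdiff 1 f (x1, x2) t + k * pdiff 2 f (x1, x2) t)) (at ((x1, x2), t))"
proof -
  have c: "continuous_on UNIV (\<lambda>(x1, x2). pdiff 1 f (x1, x2) t)"
    unfolding split_beta' by (intro smooth3_continuous_on[OF smooth3_pdiff[OF f]] continuous_intros) auto
  have "((\<lambda>(x1, x2). f (x1, x2) t) has_derivative (\<lambda>(h1, h2). h1 * pdiff 0 f (x1, x2) t + h2 * pdiff 1 f (x1, x2) t)) (at (x1, x2))"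
  proof (rule has_derivative_partials_real[OF _ smooth3_partials(2)[OF f] c])
    show "((\<lambda>x. f (x, x2) t) has_derivative (\<lambda>h1. h1 * pdiff 0 f (x1, x2) t)) (at x1)"
      using smooth3_partials(1)[OF f, where ?x1.0=x1 and ?x2.0=x2 and t=t]
      unfolding has_field_derivative_def by (rule has_derivative_eq_rhs) (simp add: fun_eq_iff)
  qed
  then have "((\<lambda>(x, t). f x t) has_derivative
     (\<lambda>(h, k). (\<lambda>(h1, h2). h1 * pdiff 0 f (x1, x2) t + h2 * pdiff 1 f (x1, x2) t) h + k * pdiff 2 f (x1, x2) t)) (at ((x1, x2), t))"
    by (intro has_derivative_partials_real[OF _ smooth3_partials(3)[OF f] smooth3_continuous[OF smooth3_pdiff[OF f]]])
       (auto simp only: split_beta' prod.collapse)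
  then show ?thesis unfolding split_beta' by simp
qed

lemma smooth3_chain:
  assumes f: "smooth3 f"
    and "(X1 has_real_derivative d1) (at r within S)" "(X2 has_real_derivative d2) (at r within S)"
      "(X3 has_real_derivative d3) (at r within S)"
  shows "((\<lambda>r. f (X1 r, X2 r) (X3 r)) has_real_derivative
     d1 * pdiff 0 f (X1 r, X2 r) (X3 r) + d2 * pdiff 1 f (X1 r, X2 r) (X3 r) + d3 * pdiff 2 f (X1 r, X2 r) (X3 r))
     (at r within S)"
proof -
  have "((\<lambda>r. ((X1 r, X2 r), X3 r)) has_derivative (\<lambda>h. ((d1 * h, d2 * h), d3 * h))) (at r within S)"
    using assms(2-4) unfolding has_field_derivative_def by (intro has_derivative_Pair)
  from has_derivative_compose[OF this smooth3_has_derivative[OF f]]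
  show ?thesis unfolding has_field_derivative_def prod.case
    by (rule has_derivative_eq_rhs) (simp add: fun_eq_iff algebra_simps)
qed

text \<open>Schwarz's theorem by the second difference over a square of side \<open>h\<close>: two
  applications of the mean value theorem, in either order, express it through either mixed
  derivative at some interior point. By continuity both values are close to those at the
  corner.\<close>

lemma mixed_partials_eq:
  fixes F :: "real \<Rightarrow> real \<Rightarrow> real"
  assumes x: "\<And>x y. ((\<lambda>x. F x y) has_real_derivative Fx x y) (at x)"
    and y: "\<And>x y. ((\<lambda>y. F x y) has_real_derivative Fy x y) (at y)"
    and xy: "\<And>x y. ((\<lambda>y. Fx x y) has_real_derivative Fxy x y) (at y)"
    and yx: "\<And>x y. ((\<lambda>x. Fy x y) has_real_derivative Fyx x y) (at x)"
    and cxy: "continuous_on UNIV (\<lambda>(x, y). Fxy x y)" and cyx: "continuous_on UNIV (\<lambda>(x, y). Fyx x y)"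
  shows "Fxy x y = Fyx x y"
proof (rule ccontr)
  assume "Fxy x y \<noteq> Fyx x y"
  define e where "e = \<bar>Fxy x y - Fyx x y\<bar> / 2"
  have e: "0 < e" using \<open>Fxy x y \<noteq> Fyx x y\<close> by (simp add: e_def)
  have "\<forall>e>0. \<exists>d>0. \<forall>p. dist p (x, y) < d \<longrightarrow> dist (Fxy (fst p) (snd p)) (Fxy x y) < e"
    using cxy by (auto simp: continuous_on_iff split_beta')
  with e obtain d1 where d1: "d1 > 0" "\<And>p. dist p (x, y) < d1 \<Longrightarrow> dist (Fxy (fst p) (snd p)) (Fxy x y) < e" by blast
  have "\<forall>e>0. \<exists>d>0. \<forall>p. dist p (x, y) < d \<longrightarrow> dist (Fyx (fst p) (snd p)) (Fyx x y) < e"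
    using cyx by (auto simp: continuous_on_iff split_beta')
  with e obtain d2 where d2: "d2 > 0" "\<And>p. dist p (x, y) < d2 \<Longrightarrow> dist (Fyx (fst p) (snd p)) (Fyx x y) < e" by blast
  define h where "h = min d1 d2 / 2"
  have h: "0 < h" using d1 d2 by (simp add: h_def)
  \<comment> \<open>The distance to the corner is less than the sum of the coordinate differences,
    hence less than \<open>2 * h\<close>; this explains the factor 1/2 in \<open>h\<close>.\<close>
  have near: "dist (p, q) (x, y) < min d1 d2" if "x < p" "p < x + h" "y < q" "q < y + h" for p q
  proof -
    have "dist (p, q) (x, y) \<le> \<bar>p - x\<bar> + \<bar>q - y\<bar>"
      unfolding dist_prod_def by (simp add: dist_real_def sqrt_sum_squares_le_sum_abs)
    also have "\<dots> < h + h" using that by (intro add_strict_mono) auto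
    also have "\<dots> = min d1 d2" by (simp add: h_def)
    finally show ?thesis .
  qed
  obtain p1 where p1: "x < p1" "p1 < x + h"
    "(F (x + h) (y + h) - F (x + h) y) - (F x (y + h) - F x y) = (x + h - x) * (Fx p1 (y + h) - Fx p1 y)"
    using MVT2[of x "x + h" "\<lambda>x. F x (y + h) - F x y", OF _ DERIV_diff[OF x x]] h by auto
  obtain q1 where q1: "y < q1" "q1 < y + h" "Fx p1 (y + h) - Fx p1 y = (y + h - y) * Fxy p1 q1"
    using MVT2[of y "y + h" "Fx p1" "Fxy p1"] h xy by auto
  obtain q2 where q2: "y < q2" "q2 < y + h"
    "(F (x + h) (y + h) - F x (y + h)) - (F (x + h) y - F x y) = (y + h - y) * (Fy (x + h) q2 - Fy x q2)"
    using MVT2[of y "y + h" "\<lambda>y. F (x + h) y - F x y", OF _ DERIV_diff[OF y y]] h by auto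
  obtain p2 where p2: "x < p2" "p2 < x + h" "Fy (x + h) q2 - Fy x q2 = (x + h - x) * Fyx p2 q2"
    using MVT2[of x "x + h" "\<lambda>x. Fy x q2" "\<lambda>x. Fyx x q2"] h yx by auto
  have "h * (h * Fxy p1 q1) = h * (h * Fyx p2 q2)"
    using p1(3) q1(3) q2(3) p2(3) by (simp add: algebra_simps)
  then have "Fxy p1 q1 = Fyx p2 q2" using h by simp
  moreover have "\<bar>Fxy p1 q1 - Fxy x y\<bar> < e" using d1(2)[of "(p1, q1)"] near[of p1 q1] p1 q1 by (simp add: dist_real_def)
  moreover have "\<bar>Fyx p2 q2 - Fyx x y\<bar> < e" using d2(2)[of "(p2, q2)"] near[of p2 q2] p2 q2 by (simp add: dist_real_def)
  ultimately have "\<bar>Fxy x y - Fyx x y\<bar> < 2 * e" by linarith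
  then show False by (simp add: e_def)
qed

text \<open>Differentiating Kirchhoff's primitive along the cone produces mixed time-space
  derivatives in both orders with opposite signs; they cancel because the orders agree.\<close>

lemma smooth3_time_space_commute:
  assumes f: "smooth3 f"
  shows "pdiff 2 (pdiff 0 f) = pdiff 0 (pdiff 2 f)" "pdiff 2 (pdiff 1 f) = pdiff 1 (pdiff 2 f)"
proof -
  have s: "smooth3 (pdiff 0 f)" "smooth3 (pdiff 1 f)" "smooth3 (pdiff 2 f)" by (auto intro: smooth3_pdiff f)
  have "pdiff 2 (pdiff 0 f) (x1, x2) t = pdiff 0 (pdiff 2 f) (x1, x2) t" for x1 x2 t
    by (rule mixed_partials_eq[where F="\<lambda>x1 t. f (x1, x2) t" and Fx="\<lambda>x1 t. pdiff 0 f (x1, x2) t"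
          and Fy="\<lambda>x1 t. pdiff 2 f (x1, x2) t" and Fxy="\<lambda>x1 t. pdiff 2 (pdiff 0 f) (x1, x2) t"
          and Fyx="\<lambda>x1 t. pdiff 0 (pdiff 2 f) (x1, x2) t"],
        rule smooth3_partials[OF f], rule smooth3_partials[OF f], rule smooth3_partials[OF s(1)],
        rule smooth3_partials[OF s(3)])
       (unfold split_beta', intro smooth3_continuous_on[OF smooth3_pdiff[OF s(1)]] smooth3_continuous_on[OF smooth3_pdiff[OF s(3)]] continuous_intros; simp)+
  then show "pdiff 2 (pdiff 0 f) = pdiff 0 (pdiff 2 f)" by (auto simp: fun_eq_iff)
  have "pdiff 2 (pdiff 1 f) (x1, x2) t = pdiff 1 (pdiff 2 f) (x1, x2) t" for x1 x2 t
    by (rule mixed_partials_eq[where F="\<lambda>x2 t. f (x1, x2) t" and Fx="\<lambda>x2 t. pdiff 1 f (x1, x2) t"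
          and Fy="\<lambda>x2 t. pdiff 2 f (x1, x2) t" and Fxy="\<lambda>x2 t. pdiff 2 (pdiff 1 f) (x1, x2) t"
          and Fyx="\<lambda>x2 t. pdiff 1 (pdiff 2 f) (x1, x2) t"],
        rule smooth3_partials[OF f], rule smooth3_partials[OF f], rule smooth3_partials[OF s(2)],
        rule smooth3_partials[OF s(3)])
       (unfold split_beta', intro smooth3_continuous_on[OF smooth3_pdiff[OF s(2)]] smooth3_continuous_on[OF smooth3_pdiff[OF s(3)]] continuous_intros; simp)+
  then show "pdiff 2 (pdiff 1 f) = pdiff 1 (pdiff 2 f)" by (auto simp: fun_eq_iff)
qed

text \<open>Only positive times count: a test function may have unbounded support in negative time.\<close>

definition vanishes_beyond :: "real \<Rightarrow> (real \<times> real \<Rightarrow> real \<Rightarrow> real) \<Rightarrow> bool" where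
  "vanishes_beyond R f \<longleftrightarrow> (\<forall>x t. 0 < t \<longrightarrow> R < norm x \<or> R < t \<longrightarrow> f x t = 0)"

text \<open>The region in question is open, as all its inequalities are strict, so the function is 0
  near each of its points. At time 0 this would fail: the derivative in time also sees negative
  times.\<close>

lemma vanishes_beyond_pdiff:
  assumes v: "vanishes_beyond R f"
  shows "vanishes_beyond R (pdiff i f)"
  unfolding vanishes_beyond_def
proof (intro allI impI)
  fix x :: "real \<times> real" and t :: real
  assume t: "0 < t" and far: "R < norm x \<or> R < t"
  have op: "open {s. 0 < snd (c s) \<and> (R < norm (fst (c s)) \<or> R < snd (c s))}"
    if "continuous_on UNIV c" for c :: "real \<Rightarrow> (real \<times> real) \<times> real"
    using that by (intro open_Collect_conj open_Collect_disj open_Collect_less continuous_intros)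
  have d: "deriv (\<lambda>s. f (fst (c s)) (snd (c s))) s0 = 0"
    if "continuous_on UNIV c" "c s0 = (x, t)" for c :: "real \<Rightarrow> (real \<times> real) \<times> real" and s0
  proof -
    have "\<forall>\<^sub>F s in nhds s0. 0 < snd (c s) \<and> (R < norm (fst (c s)) \<or> R < snd (c s))"
      using eventually_nhds_in_open[OF op[OF that(1)], of s0] that(2) t far by simp
    then have "\<forall>\<^sub>F s in nhds s0. f (fst (c s)) (snd (c s)) = 0"
      by eventually_elim (rule v[unfolded vanishes_beyond_def, rule_format]; blast)
    then have "deriv (\<lambda>s. f (fst (c s)) (snd (c s))) s0 = deriv (\<lambda>_. 0) s0"
      by (intro deriv_cong_ev) auto
    then show ?thesis by simp
  qed
  have "continuous_on UNIV (\<lambda>s. ((s, snd x), t))" "continuous_on UNIV (\<lambda>s. ((fst x, s), t))" "continuous_on UNIV (\<lambda>s. (x, s))"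
    by (intro continuous_intros)+
  from d[OF this(1), of "fst x"] d[OF this(2), of "snd x"] d[OF this(3), of t]
  show "pdiff i f x t = 0" by (simp add: pdiff_def)
qed

lemma test_fun_vanishes:
  assumes "test_fun \<theta>"
  obtains R where "0 < R" "vanishes_beyond R \<theta>" "\<And>x t. 0 \<le> t \<Longrightarrow> R < norm x \<or> R < t \<Longrightarrow> \<theta> x t = 0"
proof -
  from assms have "bounded {(x, t). 0 \<le> t \<and> \<theta> x t \<noteq> 0}" by (simp add: test_fun_def)
  then obtain R where R: "0 < R" "\<And>p. p \<in> {(x, t). 0 \<le> t \<and> \<theta> x t \<noteq> 0} \<Longrightarrow> norm p \<le> R"
    by (auto simp: bounded_pos)
  have "\<theta> x t = 0" if "0 \<le> t" "R < norm x \<or> R < t" for x t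
  proof (rule ccontr)
    assume "\<theta> x t \<noteq> 0"
    then have "norm (x, t) \<le> R" using R(2)[of "(x, t)"] that by auto
    moreover have "norm x \<le> norm (x, t)" "\<bar>t\<bar> \<le> norm (x, t)"
      using norm_fst_le[of x t] norm_snd_le[of t x] by auto
    ultimately show False using that by linarith
  qed
  then show ?thesis using that[of R] R(1) unfolding vanishes_beyond_def by auto
qed

section \<open>Fundamental solution\<close>

lemma smooth3_wave_op_continuous:
  "smooth3 f \<Longrightarrow> continuous_on S X \<Longrightarrow> continuous_on S T \<Longrightarrow> continuous_on S (\<lambda>p. wave_op a f (X p) (T p))"
  unfolding wave_op_def
  by (intro continuous_intros smooth3_continuous_on[OF smooth3_pdiff[OF smooth3_pdiff]]) auto

lemma vanishes_beyond_wave_op: "vanishes_beyond R f \<Longrightarrow> vanishes_beyond R (wave_op a f)"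
  using vanishes_beyond_pdiff[of R f] vanishes_beyond_pdiff[of R "pdiff _ f"]
  by (auto simp: vanishes_beyond_def wave_op_def)

lemma integral_FTC_real:
  fixes F :: "real \<Rightarrow> real"
  assumes "a \<le> b" "\<And>x. x \<in> {a..b} \<Longrightarrow> (F has_real_derivative F' x) (at x within {a..b})"
  shows "integral {a..b} F' = F b - F a"
  using fundamental_theorem_of_calculus[OF assms(1), of F F'] assms(2)
  by (auto simp: has_real_derivative_iff_has_vector_derivative intro: integral_unique)

text \<open>The divergence theorem on a box, one component at a time. The component in
  \<open>s\<close> leaves its values on two faces; the other two have no flux when the primitive
  agrees on opposite faces.\<close>

lemma integral_box3_FTC:
  fixes F F' :: "real \<Rightarrow> real \<Rightarrow> real \<Rightarrow> real"
  assumes cont: "continuous_on (cbox (s0, u0, v0) (s1, u1, v1)) (\<lambda>(s, u, v). F' s u v)"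
    and le: "s0 \<le> s1" "u0 \<le> u1" "v0 \<le> v1"
  shows "(\<And>s u v. ((\<lambda>s. F s u v) has_real_derivative F' s u v) (at s)) \<Longrightarrow>
      integral (cbox (s0, u0, v0) (s1, u1, v1)) (\<lambda>(s, u, v). F' s u v) =
      integral (cbox (u0, v0) (u1, v1)) (\<lambda>(u, v). F s1 u v - F s0 u v)"
    and "(\<And>s u v. ((\<lambda>u. F s u v) has_real_derivative F' s u v) (at u)) \<Longrightarrow>
      (\<And>s v. F s u1 v = F s u0 v) \<Longrightarrow>
      integral (cbox (s0, u0, v0) (s1, u1, v1)) (\<lambda>(s, u, v). F' s u v) = 0"
    and "(\<And>s u v. ((\<lambda>v. F s u v) has_real_derivative F' s u v) (at v)) \<Longrightarrow>
      (\<And>s u. F s u v1 = F s u v0) \<Longrightarrow>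
      integral (cbox (s0, u0, v0) (s1, u1, v1)) (\<lambda>(s, u, v). F' s u v) = 0"
proof -
  have cont2: "continuous_on (cbox (u0, v0) (u1, v1)) (\<lambda>(u, v). F' s u v)" if "s \<in> {s0..s1}" for s
    by (rule continuous_on_compose2[OF cont, of _ "\<lambda>w. (s, w)", simplified split_beta' fst_conv snd_conv, folded split_beta'])
       (use that in \<open>auto intro!: continuous_intros simp: cbox_Pair_eq\<close>)
  have it: "integral (cbox (s0, u0, v0) (s1, u1, v1)) (\<lambda>(s, u, v). F' s u v) =
      integral (cbox s0 s1) (\<lambda>s. integral (cbox (u0, v0) (u1, v1)) (\<lambda>(u, v). F' s u v))"
    using integral_prod_continuous[OF cont] by simp
  {
    assume d: "\<And>s u v. ((\<lambda>s. F s u v) has_real_derivative F' s u v) (at s)"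
    have "integral (cbox s0 s1) (\<lambda>s. integral (cbox (u0, v0) (u1, v1)) (\<lambda>(u, v). F' s u v)) =
      integral (cbox (u0, v0) (u1, v1)) (\<lambda>w. integral (cbox s0 s1) (\<lambda>s. (\<lambda>(u, v). F' s u v) w))"
      by (rule integral_swap_continuous) (use cont in \<open>simp add: split_beta'\<close>)
    also have "\<dots> = integral (cbox (u0, v0) (u1, v1)) (\<lambda>(u, v). F s1 u v - F s0 u v)"
      using le d by (intro integral_cong) (auto intro!: integral_FTC_real DERIV_subset[OF d])
    finally show "integral (cbox (s0, u0, v0) (s1, u1, v1)) (\<lambda>(s, u, v). F' s u v) =
      integral (cbox (u0, v0) (u1, v1)) (\<lambda>(u, v). F s1 u v - F s0 u v)" using it by simp
  }
  {
    assume d: "\<And>s u v. ((\<lambda>u. F s u v) has_real_derivative F' s u v) (at u)" and b: "\<And>s v. F s u1 v = F s u0 v"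
    have "integral (cbox (u0, v0) (u1, v1)) (\<lambda>(u, v). F' s u v) = 0" if s: "s \<in> cbox s0 s1" for s
    proof -
      have c: "continuous_on (cbox (u0, v0) (u1, v1)) (\<lambda>(u, v). F' s u v)" using cont2 s by simp
      have "integral (cbox (u0, v0) (u1, v1)) (\<lambda>(u, v). F' s u v) = integral (cbox v0 v1) (\<lambda>v. integral (cbox u0 u1) (\<lambda>u. F' s u v))"
        using integral_prod_continuous[OF c] integral_swap_continuous[OF c] by simp
      also have "\<dots> = integral (cbox v0 v1) (\<lambda>v. F s u1 v - F s u0 v)"
        using le d by (intro integral_cong) (auto intro!: integral_FTC_real DERIV_subset[OF d])
      finally show ?thesis using b by simp
    qed
    then show "integral (cbox (s0, u0, v0) (s1, u1, v1)) (\<lambda>(s, u, v). F' s u v) = 0"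
      unfolding it by (subst integral_cong[of "cbox s0 s1" _ "\<lambda>_. 0"]) auto
  }
  {
    assume d: "\<And>s u v. ((\<lambda>v. F s u v) has_real_derivative F' s u v) (at v)" and b: "\<And>s u. F s u v1 = F s u v0"
    have "integral (cbox (u0, v0) (u1, v1)) (\<lambda>(u, v). F' s u v) = 0" if s: "s \<in> cbox s0 s1" for s
    proof -
      have c: "continuous_on (cbox (u0, v0) (u1, v1)) (\<lambda>(u, v). F' s u v)" using cont2 s by simp
      have "integral (cbox (u0, v0) (u1, v1)) (\<lambda>(u, v). F' s u v) = integral (cbox u0 u1) (\<lambda>u. integral (cbox v0 v1) (\<lambda>v. F' s u v))"
        using integral_prod_continuous[OF c] by simp
      also have "\<dots> = integral (cbox u0 u1) (\<lambda>u. F s u v1 - F s u v0)"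
        using le d by (intro integral_cong) (auto intro!: integral_FTC_real DERIV_subset[OF d])
      finally show ?thesis using b by simp
    qed
    then show "integral (cbox (s0, u0, v0) (s1, u1, v1)) (\<lambda>(s, u, v). F' s u v) = 0"
      unfolding it by (subst integral_cong[of "cbox s0 s1" _ "\<lambda>_. 0"]) auto
  }
qed

text \<open>In cone coordinates based at the apex \<open>(y, \<tau>)\<close> the weighted wave
  operator is \<open>A' - B' - D'\<close> with exact derivatives. \<open>B\<close> and
  \<open>D\<close> vanish at both ends since their angles reach \<plusminus>\<pi>/2, where the
  cosine is 0. \<open>A\<close> vanishes at late times, and at the apex it gives
  \<open>cos u * \<theta> y \<tau>\<close>, whose integral over the hemisphere is 2 \<pi>
  \<open>\<theta> y \<tau>\<close>.\<close>

lemma wave_kernel_fundamental_solution: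
  assumes \<theta>: "smooth3 \<theta>" and a: "0 < a" and \<tau>: "0 \<le> \<tau>"
    and R: "vanishes_beyond R \<theta>" "0 < R"
  shows "integrable lborel (\<lambda>p. wave_kernel a (fst p) (snd p) * wave_op a \<theta> (y + snd p) (\<tau> + fst p))" (is ?int)
    and "(\<integral>p. wave_kernel a (fst p) (snd p) * wave_op a \<theta> (y + snd p) (\<tau> + fst p) \<partial>lborel) = \<theta> y \<tau>" (is ?eq)
proof -
  obtain y1 y2 where y: "y = (y1, y2)" by (cases y)
  \<comment> \<open>Beyond \<open>R\<close> by a margin: since \<tau> \<ge> 0, the top
    \<open>s = T\<close> of the box lies strictly outside the support, where \<theta> and its
    derivatives vanish.\<close>
  define T where "T = R + 1"
  define Q where "Q = (\<lambda>f s u v. f (y1 + a * s * cos u * sin v, y2 + a * s * sin u) (\<tau> + s) :: real)"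
  \<comment> \<open>With \<open>n = (cos u sin v, sin u)\<close>, the terms \<open>B\<close> and \<open>D\<close> are the two components of the spherical gradient,
    whose divergence is the Laplace-Beltrami operator, and \<open>A\<close> is Kirchhoff's primitive
    \<open>(r F)\<^sub>t - (r F)\<^sub>r\<close> on the light cone \<open>r = t\<close>.\<close>
  define A where "A = (\<lambda>s u v. cos u * (s * Q (pdiff 2 \<theta>) s u v - Q \<theta> s u v
     - s * a * (cos u * sin v * Q (pdiff 0 \<theta>) s u v + sin u * Q (pdiff 1 \<theta>) s u v)))"
  define B where "B = (\<lambda>s u v. a * cos u * (cos u * Q (pdiff 1 \<theta>) s u v - sin u * sin v * Q (pdiff 0 \<theta>) s u v))"
  define D where "D = (\<lambda>s u v. a * cos v * Q (pdiff 0 \<theta>) s u v)"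
  define \<theta>1 where "\<theta>1 i = pdiff i \<theta>" for i
  define \<theta>2 where "\<theta>2 i j = pdiff i (pdiff j \<theta>)" for i j
  have sm: "smooth3 (\<theta>1 0)" "smooth3 (\<theta>1 1)" "smooth3 (\<theta>1 2)" unfolding \<theta>1_def by (auto intro!: smooth3_pdiff \<theta>)
  have sm2: "smooth3 (\<theta>2 i j)" if "i \<in> {0,1,2}" "j \<in> {0,1,2}" for i j
    unfolding \<theta>2_def using that by (intro smooth3_pdiff \<theta>) auto
  define A' where "A' = (\<lambda>s u v. cos u * (s * Q (\<theta>2 2 2) s u v
     - 2 * a * (cos u * sin v * Q (\<theta>1 0) s u v + sin u * Q (\<theta>1 1) s u v)
     - s * a\<^sup>2 * ((cos u * sin v)\<^sup>2 * Q (\<theta>2 0 0) s u v + cos u * sin v * sin u * (Q (\<theta>2 0 1) s u v + Q (\<theta>2 1 0) s u v)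
        + (sin u)\<^sup>2 * Q (\<theta>2 1 1) s u v)))"
  define B' where "B' = (\<lambda>s u v. - a * sin u * (cos u * Q (\<theta>1 1) s u v - sin u * sin v * Q (\<theta>1 0) s u v)
     + a * cos u * (- sin u * Q (\<theta>1 1) s u v - cos u * sin v * Q (\<theta>1 0) s u v
       + cos u * (- a * s * sin u * sin v * Q (\<theta>2 0 1) s u v + a * s * cos u * Q (\<theta>2 1 1) s u v)
       - sin u * sin v * (- a * s * sin u * sin v * Q (\<theta>2 0 0) s u v + a * s * cos u * Q (\<theta>2 1 0) s u v)))"
  define D' where "D' = (\<lambda>s u v. - a * sin v * Q (\<theta>1 0) s u v + a * cos v * (a * s * cos u * cos v * Q (\<theta>2 0 0) s u v))"
  have Qs: "((\<lambda>s. Q f s u v) has_real_derivative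
      a * cos u * sin v * Q (pdiff 0 f) s u v + a * sin u * Q (pdiff 1 f) s u v + Q (pdiff 2 f) s u v) (at s)"
    if "smooth3 f" for f s u v
    unfolding Q_def
    by (rule DERIV_cong[OF smooth3_chain[OF that, of "\<lambda>s. y1 + a * s * cos u * sin v" "a * cos u * sin v" s UNIV
       "\<lambda>s. y2 + a * s * sin u" "a * sin u" "\<lambda>s. \<tau> + s" 1]])
       (auto intro!: derivative_eq_intros)
  have Qu: "((\<lambda>u. Q f s u v) has_real_derivative
      - a * s * sin u * sin v * Q (pdiff 0 f) s u v + a * s * cos u * Q (pdiff 1 f) s u v) (at u)"
    if "smooth3 f" for f s u v
    unfolding Q_def
    by (rule DERIV_cong[OF smooth3_chain[OF that, of "\<lambda>u. y1 + a * s * cos u * sin v" "- a * s * sin u * sin v" u UNIV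
       "\<lambda>u. y2 + a * s * sin u" "a * s * cos u" "\<lambda>u. \<tau> + s" 0]])
       (auto intro!: derivative_eq_intros)
  have Qv: "((\<lambda>v. Q f s u v) has_real_derivative a * s * cos u * cos v * Q (pdiff 0 f) s u v) (at v)"
    if "smooth3 f" for f s u v
    unfolding Q_def
    by (rule DERIV_cong[OF smooth3_chain[OF that, of "\<lambda>v. y1 + a * s * cos u * sin v" "a * s * cos u * cos v" v UNIV
       "\<lambda>v. y2 + a * s * sin u" "0" "\<lambda>v. \<tau> + s" 0]])
       (auto intro!: derivative_eq_intros)
  note comm = smooth3_time_space_commute[OF \<theta>]
  have dA: "((\<lambda>s. A s u v) has_real_derivative A' s u v) (at s)" for s u v
  proof -
    have gen: "((\<lambda>s. cos u * (s * q2 s - q s - s * a * (cos u * sin v * q0 s + sin u * q1 s))) has_real_derivative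
        cos u * (q2 s + s * d2 - d - a * (cos u * sin v * q0 s + sin u * q1 s) - s * a * (cos u * sin v * d0 + sin u * d1))) (at s)"
      if "(q has_real_derivative d) (at s)" "(q0 has_real_derivative d0) (at s)"
        "(q1 has_real_derivative d1) (at s)" "(q2 has_real_derivative d2) (at s)" for q q0 q1 q2 d d0 d1 d2
      using that by (auto intro!: derivative_eq_intros simp: algebra_simps)
    show ?thesis unfolding A_def A'_def
      by (rule DERIV_cong[OF gen[OF Qs[OF \<theta>] Qs[OF sm(1)[unfolded \<theta>1_def]] Qs[OF sm(2)[unfolded \<theta>1_def]] Qs[OF sm(3)[unfolded \<theta>1_def]]]])
         (simp add: \<theta>1_def \<theta>2_def comm comm(2)[unfolded One_nat_def] algebra_simps power2_eq_square)
  qed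
  have dB: "((\<lambda>u. B s u v) has_real_derivative B' s u v) (at u)" for s u v
  proof -
    have gen: "((\<lambda>u. a * cos u * (cos u * q1 u - sin u * sin v * q0 u)) has_real_derivative
        - a * sin u * (cos u * q1 u - sin u * sin v * q0 u)
        + a * cos u * (- sin u * q1 u + cos u * d1 - cos u * sin v * q0 u - sin u * sin v * d0)) (at u)"
      if "(q0 has_real_derivative d0) (at u)" "(q1 has_real_derivative d1) (at u)" for q0 q1 d0 d1
      using that by (auto intro!: derivative_eq_intros simp: algebra_simps)
    show ?thesis unfolding B_def B'_def
      by (rule DERIV_cong[OF gen[OF Qu[OF sm(1)[unfolded \<theta>1_def]] Qu[OF sm(2)[unfolded \<theta>1_def]]]])
         (simp add: \<theta>1_def \<theta>2_def algebra_simps)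
  qed
  have dD: "((\<lambda>v. D s u v) has_real_derivative D' s u v) (at v)" for s u v
    unfolding D_def D'_def
    by (rule DERIV_cong[OF DERIV_mult[OF DERIV_cmult[OF DERIV_cos] Qv[OF sm(1)[unfolded \<theta>1_def]]]])
       (simp add: \<theta>1_def \<theta>2_def algebra_simps)
  have Qc: "continuous_on S (\<lambda>p. Q f (fst p) (fst (snd p)) (snd (snd p)))" if "smooth3 f" for S f
    unfolding Q_def by (intro smooth3_continuous_on[OF that] continuous_intros)
  let ?box = "cbox (0, -(pi/2), -(pi/2)) (T, pi/2, pi/2)"
  have cA: "continuous_on ?box (\<lambda>(s, u, v). A' s u v)" and cB: "continuous_on ?box (\<lambda>(s, u, v). B' s u v)"
    and cD: "continuous_on ?box (\<lambda>(s, u, v). D' s u v)"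
    unfolding A'_def B'_def D'_def split_beta' by (intro continuous_intros Qc sm sm2; simp)+
  have key: "s * cos u * Q (wave_op a \<theta>) s u v = A' s u v - B' s u v - D' s u v" for s u v
  proof -
    define S0 S1 S2 S3 where S: "S0 = Q (\<theta>1 0) s u v" "S1 = Q (\<theta>1 1) s u v" "S2 = Q (\<theta>2 0 0) s u v" "S3 = Q (\<theta>2 1 1) s u v"
    have W: "Q (wave_op a \<theta>) s u v = Q (\<theta>2 2 2) s u v - a\<^sup>2 * (S2 + S3)"
      by (simp add: Q_def wave_op_def \<theta>2_def S)
    \<comment> \<open>Collected by derivatives of \<theta>, each coefficient contains a factor that
      vanishes by sin^2 + cos^2 = 1. The rules for that identity are withheld so that the grouping
      matches before it is used.\<close>
    have "A' s u v - B' s u v - D' s u v - s * cos u * Q (wave_op a \<theta>) s u v =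
       a * S0 * sin v * (1 - (sin u)\<^sup>2 - (cos u)\<^sup>2)
       + s * a\<^sup>2 * cos u * S2 * (1 - (cos u)\<^sup>2 * (sin v)\<^sup>2 - (sin u)\<^sup>2 * (sin v)\<^sup>2 - (cos v)\<^sup>2)
       + s * a\<^sup>2 * cos u * S3 * (1 - (sin u)\<^sup>2 - (cos u)\<^sup>2)"
      unfolding W unfolding A'_def B'_def D'_def S[symmetric] by (simp add: algebra_simps power2_eq_square del: sin_cos_squared_add sin_cos_squared_add2 sin_cos_squared_add3)
    also have "\<dots> = 0" by (simp add: sin_squared_eq algebra_simps)
    finally show ?thesis by simp
  qed
  define L where "L = (\<lambda>(s, u, v). s * cos u / (2 * pi) * Q (wave_op a \<theta>) s u v)"
  have L: "L = (\<lambda>p. 1 / (2 * pi) * ((\<lambda>(s, u, v). A' s u v) p - (\<lambda>(s, u, v). B' s u v) p - (\<lambda>(s, u, v). D' s u v) p))"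
    unfolding L_def by (auto simp: fun_eq_iff key[symmetric])
  have cL: "continuous_on ?box L" unfolding L by (intro continuous_intros cA cB cD)
  have far: "f x t = 0" if "f \<in> {\<theta>, pdiff 0 \<theta>, pdiff 1 \<theta>, pdiff 2 \<theta>, wave_op a \<theta>}" "R < t" for f x t
  proof -
    have "vanishes_beyond R f"
      using that(1) R(1) vanishes_beyond_pdiff[OF R(1)] vanishes_beyond_wave_op[OF R(1), of a] by auto
    then show ?thesis using that(2) R(2) by (simp add: vanishes_beyond_def del: split_paired_All)
  qed
  have "T \<ge> 0" using R(2) by (simp add: T_def)
  have QT: "Q f T u v = 0" if "f \<in> {\<theta>, pdiff 0 \<theta>, pdiff 1 \<theta>, pdiff 2 \<theta>}" for f u v
    unfolding Q_def by (rule far) (use that \<tau> in \<open>auto simp: T_def\<close>)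
  \<comment> \<open>At \<open>s = 0\<close> every summand of \<open>A\<close> carries a factor
    \<open>s\<close> except \<open>- cos u * Q \<theta> s u v\<close>, and all points of the slice
    collapse to the apex.\<close>
  have AT: "A T u v - A 0 u v = cos u * \<theta> y \<tau>" for u v
    by (simp add: A_def QT) (simp add: Q_def y)
  have iA: "integral ?box (\<lambda>(s, u, v). A' s u v) = 2 * pi * \<theta> y \<tau>"
  proof -
    have "integral ?box (\<lambda>(s, u, v). A' s u v) = integral (cbox (-(pi/2), -(pi/2)) (pi/2, pi/2)) (\<lambda>(u, v). cos u * \<theta> y \<tau>)"
      unfolding integral_box3_FTC(1)[OF cA \<open>T \<ge> 0\<close> _ _ dA, simplified] AT by simp
    also have "\<dots> = integral (cbox (-(pi/2)) (pi/2)) (\<lambda>u. integral (cbox (-(pi/2)) (pi/2)) (\<lambda>v. cos u * \<theta> y \<tau>))"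
      by (subst integral_prod_continuous) (auto intro!: continuous_intros simp: split_beta')
    \<comment> \<open>The range of \<open>v\<close> has length \<pi>, and the cosine integrates to 2
      over the range of \<open>u\<close>: the area of the unit hemisphere.\<close>
    also have "\<dots> = pi * \<theta> y \<tau> * integral {-(pi/2)..pi/2} cos" by (simp add: ac_simps)
    also have "integral {-(pi/2)..pi/2} cos = sin (pi/2) - sin (-(pi/2))"
      by (rule integral_FTC_real) (auto intro!: derivative_eq_intros)
    finally show ?thesis by simp
  qed
  have iB: "integral ?box (\<lambda>(s, u, v). B' s u v) = 0"
    by (rule integral_box3_FTC(2)[OF cB \<open>T \<ge> 0\<close> _ _ dB]) (auto simp: B_def)
  have iD: "integral ?box (\<lambda>(s, u, v). D' s u v) = 0"
    by (rule integral_box3_FTC(3)[OF cD \<open>T \<ge> 0\<close> _ _ dD]) (auto simp: D_def)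
  have iL: "integral ?box L = \<theta> y \<tau>"
  proof -
    have "integral ?box (\<lambda>p. 1 / (2 * pi) * (f p - g p - h p)) =
        1 / (2 * pi) * (integral ?box f - integral ?box g - integral ?box h)"
      if "continuous_on ?box f" "continuous_on ?box g" "continuous_on ?box h" for f g h :: "real \<times> real \<times> real \<Rightarrow> real"
      using that
      by (simp add: Henstock_Kurzweil_Integration.integral_diff integrable_continuous integrable_diff)
    from this[OF cA cB cD] show ?thesis unfolding L iA iB iD by simp
  qed
  define f where "f = (\<lambda>p. wave_op a \<theta> (y + snd p) (\<tau> + fst p))"
  have fm: "f \<in> borel_measurable borel" unfolding f_def
    by (intro borel_measurable_continuous_onI smooth3_wave_op_continuous[OF \<theta>] continuous_intros)
  \<comment> \<open>The infinite cone may be cut at \<open>T\<close>, because the wave operator of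
    \<theta> vanishes later. What is left is continuous on a compact box, hence integrable.\<close>
  have eq: "cone_weight p * f (cone_param a p) = indicator ?box p *\<^sub>R L p" for p
  proof (cases p)
    case (fields s u v)
    have "wave_op a \<theta> (y + (a * s * cos u * sin v, a * s * sin u)) (\<tau> + s) = 0" if "T < s"
      by (rule far) (use that \<tau> in \<open>auto simp: T_def\<close>)
    then show ?thesis unfolding fields
      by (auto simp: cone_weight_def cone_param_def f_def L_def Q_def y indicator_def cbox_Pair_eq)
  qed
  have "integrable lborel (\<lambda>p. indicator ?box p *\<^sub>R L p)"
    by (rule borel_integrable_compact[OF compact_cbox cL])
  then have si: "set_integrable lborel ?box L" by (simp add: set_integrable_def)
  then have "integrable lborel (\<lambda>p. wave_kernel a (fst p) (snd p) * f p)"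
    unfolding wave_kernel_change_of_variables(1)[OF a fm] eq set_integrable_def .
  then show ?int by (simp add: f_def)
  have "(\<integral>p. wave_kernel a (fst p) (snd p) * f p \<partial>lborel) = integral ?box L"
    unfolding wave_kernel_change_of_variables(2)[OF a fm] eq
    using set_borel_integral_eq_integral(2)[OF si] by (simp add: set_lebesgue_integral_def)
  then show ?eq using iL by (simp add: f_def)
qed

section \<open>The Green function\<close>

lemma lborel_translation:
  fixes f :: "'a::euclidean_space \<Rightarrow> real"
  assumes [measurable]: "f \<in> borel_measurable borel"
  shows "integrable lborel (\<lambda>p. f (c + p)) \<longleftrightarrow> integrable lborel f"
    and "(\<integral>p. f (c + p) \<partial>lborel) = (\<integral>p. f p \<partial>lborel)"
proof -
  have [measurable]: "(+) c \<in> borel_measurable borel" by (intro borel_measurable_continuous_onI continuous_intros)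
  show "integrable lborel (\<lambda>p. f (c + p)) \<longleftrightarrow> integrable lborel f"
    by (subst (2) lborel_distr_plus[of c, symmetric], subst integrable_distr_eq) auto
  show "(\<integral>p. f (c + p) \<partial>lborel) = (\<integral>p. f p \<partial>lborel)"
    by (subst (2) lborel_distr_plus[of c, symmetric], subst integral_distr) auto
qed

section \<open>Size of the Green function near its singularity\<close>

lemma nn_integral_powr_from_0:
  assumes "-1 < b" "0 \<le> c"
  shows "(\<integral>\<^sup>+x. ennreal (x powr b * indicator {0..c} x) \<partial>lborel) = ennreal (c powr (b + 1) / (b + 1))"
proof (rule nn_integral_has_integral_lborel)
  show "((\<lambda>x. x powr b * indicat_real {0..c} x) has_integral c powr (b + 1) / (b + 1)) UNIV"
    using has_integral_powr_from_0[OF assms]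
    by (subst (asm) has_integral_restrict_UNIV[symmetric]) (simp add: indicator_def of_bool_def if_distrib[of "(*) _"] cong: if_cong)
qed auto

text \<open>The norm dominates the first coordinate, so the integrand is at most |x|^(-1/2) on a
  square, which is integrable in \<open>x\<close> alone; polar coordinates are avoided.\<close>

lemma nn_integral_inverse_sqrt_norm_finite:
  "(\<integral>\<^sup>+z. ennreal (if norm z < \<rho> then norm z powr (-1/2) else 0) \<partial>(lborel :: (real \<times> real) measure)) < \<infinity>"
proof -
  define \<rho>' where "\<rho>' = max \<rho> 0"
  define f :: "real \<Rightarrow> real" where "f x = x powr (-1/2) * indicator {0..\<rho>'} x" for x
  have f0: "0 \<le> f x" for x by (simp add: f_def)
  have [measurable]: "f \<in> borel_measurable borel" unfolding f_def by measurable
  have "(\<integral>\<^sup>+x. ennreal (f x) \<partial>lborel) = ennreal (\<rho>' powr (-1/2 + 1) / (-1/2 + 1))"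
    unfolding f_def by (rule nn_integral_powr_from_0) (auto simp: \<rho>'_def)
  then have fin: "(\<integral>\<^sup>+x. ennreal (f x) \<partial>lborel) < \<infinity>" by simp
  have "(\<integral>\<^sup>+x. ennreal (f x) \<partial>lborel) = (\<integral>\<^sup>+x. ennreal (f (- x)) \<partial>lborel)"
    using nn_integral_real_affine[of "\<lambda>x. ennreal (f x)" "-1" 0] by simp
  with fin have fin': "(\<integral>\<^sup>+x. ennreal (f x) + ennreal (f (- x)) \<partial>lborel) < \<infinity>"
    by (subst nn_integral_add) auto
  have "(\<integral>\<^sup>+z. ennreal (if norm z < \<rho> then norm z powr (-1/2) else 0) \<partial>(lborel :: (real \<times> real) measure)) =
    (\<integral>\<^sup>+y. \<integral>\<^sup>+x. ennreal (if norm (x::real, y::real) < \<rho> then norm (x, y) powr (-1/2) else 0) \<partial>lborel \<partial>lborel)"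
    using lborel_pair.nn_integral_snd[where f="\<lambda>z::real \<times> real. ennreal (if norm z < \<rho> then norm z powr (-1/2) else 0)"]
    by (simp add: lborel_prod)
  also have "\<dots> \<le> (\<integral>\<^sup>+y. (\<integral>\<^sup>+x. ennreal (f x) + ennreal (f (- x)) \<partial>lborel) * indicator {-\<rho>'..\<rho>'} y \<partial>lborel)"
  proof (rule nn_integral_mono)
    fix y :: real
    have "(\<integral>\<^sup>+x. ennreal (if norm (x::real, y) < \<rho> then norm (x, y) powr (-1/2) else 0) \<partial>lborel) \<le>
       (\<integral>\<^sup>+x. (ennreal (f x) + ennreal (f (- x))) * indicator {-\<rho>'..\<rho>'} y \<partial>lborel)"
    proof (rule nn_integral_mono_AE)
      show "AE x in lborel. ennreal (if norm (x::real, y) < \<rho> then norm (x, y) powr (-1/2) else 0)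
        \<le> (ennreal (f x) + ennreal (f (- x))) * indicator {-\<rho>'..\<rho>'} y"
        using AE_lborel_singleton[of 0]
      proof eventually_elim
        case (elim x)
        have n: "\<bar>x\<bar> \<le> norm (x, y)" "\<bar>y\<bar> \<le> norm (x, y)" using norm_fst_le[of x y] norm_snd_le[of y x] by auto
        show ?case
        proof (cases "norm (x, y) < \<rho>")
          case True
          then have le: "\<bar>x\<bar> \<le> \<rho>'" "\<bar>y\<bar> \<le> \<rho>'" using n by (auto simp: \<rho>'_def)
          have "norm (x, y) powr (-1/2) \<le> \<bar>x\<bar> powr (-1/2)" using n elim by (intro powr_mono2') auto
          also have "\<dots> \<le> f x + f (- x)" using le(1) by (cases "x < 0") (auto simp: f_def indicator_def)
          finally show ?thesis using True le f0 by (auto simp: indicator_def ennreal_plus[symmetric] intro!: ennreal_leI simp del: ennreal_plus)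
        qed simp
      qed
    qed
    also have "\<dots> = (\<integral>\<^sup>+x. ennreal (f x) + ennreal (f (- x)) \<partial>lborel) * indicator {-\<rho>'..\<rho>'} y"
      by (rule nn_integral_multc) measurable
    finally show "(\<integral>\<^sup>+x. ennreal (if norm (x::real, y) < \<rho> then norm (x, y) powr (-1/2) else 0) \<partial>lborel) \<le> \<dots>" .
  qed
  also have "\<dots> = (\<integral>\<^sup>+x. ennreal (f x) + ennreal (f (- x)) \<partial>lborel) * emeasure lborel {-\<rho>'..\<rho>'}"
    by (rule nn_integral_cmult_indicator) auto
  also have "\<dots> < \<infinity>" using fin' by (simp add: ennreal_mult_less_top \<rho>'_def)
  finally show ?thesis .
qed

text \<open>With d = |z| and w = a r - d, the radicand factors as w (w + 2 d), and w + 2 d dominates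
  the geometric mean of w and d. The exponents are a compromise: w^(-3/4) is integrable in time, and
  the square of d^(-1/4) is locally integrable in the plane. A power thus replaces the true
  logarithmic singularity.\<close>

lemma wave_kernel_le:
  assumes a: "0 < a" and z: "z \<noteq> 0"
  shows "wave_kernel a r z \<le> norm z powr (-1/4) / (2 * pi * a) * (if norm z < a * r then (a * r - norm z) powr (-3/4) else 0)"
proof (cases "norm z < a * r")
  case True
  define d w where "d = norm z" and "w = a * r - norm z"
  have d: "0 < d" and w: "0 < w" using True z by (auto simp: d_def w_def)
  have "w powr (3/2) * d powr (1/2) = w * (w powr (1/2) * d powr (1/2))"
    using w powr_add[of w 1 "1/2"] by simp
  also have "\<dots> = w * sqrt (w * d)" using w d by (simp add: powr_half_sqrt real_sqrt_mult)
  also have "sqrt (w * d) \<le> sqrt ((w + 2 * d)\<^sup>2)"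
    using w d by (intro real_sqrt_le_mono) (simp add: power2_eq_square algebra_simps)
  also have "\<dots> = w + 2 * d" using w d by simp
  finally have "w powr (3/2) * d powr (1/2) \<le> w * (w + 2 * d)" using w by (simp add: mult_left_mono)
  also have "\<dots> = (a * r)\<^sup>2 - (norm z)\<^sup>2" by (simp add: w_def d_def power2_eq_square algebra_simps)
  finally have "sqrt (w powr (3/2) * d powr (1/2)) \<le> sqrt ((a * r)\<^sup>2 - (norm z)\<^sup>2)" by simp
  moreover have "sqrt (w powr (3/2) * d powr (1/2)) = w powr (3/4) * d powr (1/4)"
    using w d by (simp add: real_sqrt_mult powr_half_sqrt[symmetric] powr_powr)
  ultimately have le: "w powr (3/4) * d powr (1/4) \<le> sqrt ((a * r)\<^sup>2 - (norm z)\<^sup>2)" by simp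
  have pos: "0 < w powr (3/4) * d powr (1/4)" using w d by simp
  have "1 / sqrt ((a * r)\<^sup>2 - (norm z)\<^sup>2) \<le> 1 / (w powr (3/4) * d powr (1/4))"
    using le pos by (intro divide_left_mono mult_pos_pos[OF _ pos]) linarith+
  then have "1 / (2 * pi * a) * (1 / sqrt ((a * r)\<^sup>2 - (norm z)\<^sup>2)) \<le> 1 / (2 * pi * a) * (1 / (w powr (3/4) * d powr (1/4)))"
    using a by (intro mult_left_mono) auto
  also have "1 / (2 * pi * a) * (1 / (w powr (3/4) * d powr (1/4))) = d powr (-1/4) / (2 * pi * a) * w powr (-3/4)"
    by (simp add: powr_minus_divide)
  finally show ?thesis using True by (simp add: wave_kernel_def d_def w_def)
qed (simp add: wave_kernel_def)

text \<open>The integral of w^(-3/4) over [0, L] is 4 L^(1/4). With 1/(2 \<pi> a) from the kernel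
  and 1/a from the change from time to distance, this is the constant of the bound.\<close>

lemma wave_kernel_time_integral_le:
  assumes a: "0 < a" and z: "z \<noteq> 0" and t: "t \<le> T"
  shows "(\<integral>\<^sup>+r. ennreal (if r \<le> t then wave_kernel a r z else 0) \<partial>lborel) \<le>
    ennreal ((2 * (a * T) powr (1/4) / (pi * a\<^sup>2)) * (if norm z < a * T then norm z powr (-1/4) else 0))"
proof (cases "norm z < a * T")
  case False
  have "wave_kernel a r z = 0" if "r \<le> t" for r
  proof -
    have "a * r \<le> a * T" using that t a by simp
    then show ?thesis using False by (simp add: wave_kernel_def)
  qed
  then have "(\<lambda>r. ennreal (if r \<le> t then wave_kernel a r z else 0)) = (\<lambda>r. 0)" by auto
  then show ?thesis using False by simp
next
  case True
  define K where "K = norm z powr (-1/4) / (2 * pi * a)"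
  have K: "0 \<le> K" using a by (simp add: K_def)
  define L where "L = a * T - norm z"
  have L: "0 \<le> L" using True by (simp add: L_def)
  define h :: "real \<Rightarrow> real" where "h r = (if norm z < a * r \<and> r \<le> T then (a * r - norm z) powr (-3/4) else 0)" for r
  have [measurable]: "h \<in> borel_measurable borel" unfolding h_def by measurable
  have "(\<integral>\<^sup>+r. ennreal (if r \<le> t then wave_kernel a r z else 0) \<partial>lborel) \<le> (\<integral>\<^sup>+r. ennreal K * ennreal (h r) \<partial>lborel)"
  proof (intro nn_integral_mono)
    fix r
    have "(if r \<le> t then wave_kernel a r z else 0) \<le> K * h r"
      using wave_kernel_le[OF a z, of r] t K mult_nonneg_nonneg[OF K, of "h r"]
      unfolding h_def K_def by (cases "norm z < a * r") auto
    then show "ennreal (if r \<le> t then wave_kernel a r z else 0) \<le> ennreal K * ennreal (h r)"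
      using K by (simp only: ennreal_mult'[symmetric] ennreal_leI)
  qed
  also have "\<dots> = ennreal K * (\<integral>\<^sup>+r. ennreal (h r) \<partial>lborel)" by (rule nn_integral_cmult) measurable
  also have "(\<integral>\<^sup>+r. ennreal (h r) \<partial>lborel) = ennreal (1/a) * (\<integral>\<^sup>+w. ennreal (h (norm z / a + 1/a * w)) \<partial>lborel)"
    using nn_integral_real_affine[of "\<lambda>r. ennreal (h r)" "1/a" "norm z / a"] a by simp
  also have "(\<integral>\<^sup>+w. ennreal (h (norm z / a + 1/a * w)) \<partial>lborel) = (\<integral>\<^sup>+w. ennreal (w powr (-3/4) * indicator {0..L} w) \<partial>lborel)"
  proof (intro nn_integral_cong)
    fix w
    have 1: "a * (norm z / a + 1/a * w) = norm z + w" using a by (simp add: distrib_left)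
    have 2: "norm z / a + 1/a * w \<le> T \<longleftrightarrow> w \<le> L" using a by (simp add: L_def field_simps)
    show "ennreal (h (norm z / a + 1/a * w)) = ennreal (w powr (-3/4) * indicator {0..L} w)"
      unfolding h_def 1 2 by (auto simp: indicator_def)
  qed
  also have "\<dots> = ennreal (L powr (-3/4 + 1) / (-3/4 + 1))"
    by (rule nn_integral_powr_from_0[OF _ L]) simp
  also have "ennreal K * (ennreal (1/a) * ennreal (L powr (-3/4 + 1) / (-3/4 + 1))) = ennreal (K * (1/a * (4 * L powr (1/4))))"
    using K a by (simp add: ennreal_mult'[symmetric] del: ennreal_mult')
  also have "\<dots> \<le> ennreal (K * (1/a * (4 * (a * T) powr (1/4))))"
    using K a L by (intro ennreal_leI mult_left_mono powr_mono2) (auto simp: L_def)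
  also have "K * (1/a * (4 * (a * T) powr (1/4))) = (2 * (a * T) powr (1/4) / (pi * a\<^sup>2)) * norm z powr (-1/4)"
    by (simp add: K_def power2_eq_square ac_simps)
  finally show ?thesis using True by simp
qed

text \<open>Duhamel's form: signals emitted from \<open>y\<close> at times \<tau> \<ge> 0 with
  strength \<sigma>, each travelling for the time \<open>t - \<tau>\<close>. The kernel's own
  support replaces the moving upper limit of integration.\<close>

lemma green_kernel_eq:
  assumes a: "0 < a"
  shows "green_kernel a \<sigma> x y t = (\<integral>\<tau>. (if 0 \<le> \<tau> then \<sigma> y \<tau> else 0) * wave_kernel a (t - \<tau>) (x - y) \<partial>lborel)"
proof (cases "dist x y < a * t")
  case False
  have "(if 0 \<le> \<tau> then \<sigma> y \<tau> else 0) * wave_kernel a (t - \<tau>) (x - y) = 0" for \<tau>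
  proof (cases "0 \<le> \<tau>")
    case True
    then have "a * (t - \<tau>) \<le> a * t" using a by simp
    then show ?thesis using False by (simp add: wave_kernel_def dist_norm)
  qed simp
  then show ?thesis using False by (simp only: green_kernel_def) simp
next
  case True
  define d where "d = dist x y"
  have d: "dist y x = d" "norm (x - y) = d" by (simp_all add: d_def dist_norm norm_minus_commute)
  have "green_kernel a \<sigma> x y t = (\<integral>\<tau>. 1 / (2 * pi * a) * (indicator {0..t - d / a} \<tau> * (\<sigma> y \<tau> / sqrt ((a * (t - \<tau>))\<^sup>2 - d\<^sup>2))) \<partial>lborel)"
    unfolding Bochner_Integration.integral_mult_right_zero
    using True by (simp add: green_kernel_def set_lebesgue_integral_def d d_def)
  also have "\<dots> = (\<integral>\<tau>. (if 0 \<le> \<tau> then \<sigma> y \<tau> else 0) * wave_kernel a (t - \<tau>) (x - y) \<partial>lborel)"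
  proof (rule Bochner_Integration.integral_cong[OF refl])
    fix \<tau>
    \<comment> \<open>The definition includes the endpoint and the kernel does not; there the
      definition divides by \<open>sqrt 0\<close>, which has the value 0.\<close>
    have 1: "\<tau> \<le> t - d / a \<longleftrightarrow> d \<le> a * (t - \<tau>)" using a by (simp add: field_simps)
    show "1 / (2 * pi * a) * (indicator {0..t - d / a} \<tau> * (\<sigma> y \<tau> / sqrt ((a * (t - \<tau>))\<^sup>2 - d\<^sup>2))) =
      (if 0 \<le> \<tau> then \<sigma> y \<tau> else 0) * wave_kernel a (t - \<tau>) (x - y)"
      unfolding wave_kernel_def d by (auto simp: indicator_def 1)
  qed
  finally show ?thesis .
qed

lemma borel_measurable_continuous_curried:
  fixes \<sigma> :: "'a::second_countable_topology \<Rightarrow> 'b::second_countable_topology \<Rightarrow> real"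
  assumes "continuous_on UNIV (\<lambda>(x, t). \<sigma> x t)" "f \<in> M \<rightarrow>\<^sub>M borel" "h \<in> M \<rightarrow>\<^sub>M borel"
  shows "(\<lambda>p. \<sigma> (f p) (h p)) \<in> borel_measurable M"
  using measurable_compose[OF borel_measurable_Pair[OF assms(2,3)] borel_measurable_continuous_onI[OF assms(1)]]
  by simp

lemma green_kernel_measurable:
  assumes a: "0 < a" and \<sigma>: "continuous_on UNIV (\<lambda>(x, t). \<sigma> x t)"
    and [measurable]: "X \<in> N \<rightarrow>\<^sub>M borel" "Y \<in> N \<rightarrow>\<^sub>M borel" "T \<in> borel_measurable N"
  shows "(\<lambda>p. green_kernel a \<sigma> (X p) (Y p) (T p)) \<in> borel_measurable N"
proof -
  note [measurable] = borel_measurable_continuous_curried[OF \<sigma>]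
  show ?thesis unfolding green_kernel_eq[OF a] by measurable
qed

text \<open>The pointwise bound depends on \<open>y - x\<close> alone, so translation makes
  \<open>K\<close> uniform in \<open>x\<close>; time enters only through its upper limit
  \<open>T\<close>. This uniformity yields an integrable majorant over the support of the test
  function.\<close>

lemma green_kernel_square_integral:
  fixes \<sigma> :: "real \<times> real \<Rightarrow> real \<Rightarrow> real"
  assumes a: "0 < a" and \<sigma>: "continuous_on UNIV (\<lambda>(x, t). \<sigma> x t)" and bd: "\<And>x t. \<bar>\<sigma> x t\<bar> \<le> C"
  obtains K where "0 \<le> K" "\<And>x t. t \<le> T \<Longrightarrow> (\<integral>\<^sup>+y. ennreal ((green_kernel a \<sigma> x y t)\<^sup>2) \<partial>lborel) \<le> ennreal K"
proof -
  have C: "0 \<le> C" using bd[of 0 0] by linarith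
  define c where "c = C * (2 * (a * T) powr (1/4) / (pi * a\<^sup>2))"
  have c: "0 \<le> c" using C by (simp add: c_def)
  define I where "I = (\<integral>\<^sup>+z. ennreal (if norm z < a * T then norm z powr (-1/2) else 0) \<partial>(lborel :: (real \<times> real) measure))"
  have I: "I < \<infinity>" unfolding I_def by (rule nn_integral_inverse_sqrt_norm_finite)
  have G: "\<bar>green_kernel a \<sigma> x y t\<bar> \<le> c * (if norm (y - x) < a * T then norm (y - x) powr (-1/4) else 0)"
    if "y \<noteq> x" "t \<le> T" for x y t
  proof -
    let ?f = "\<lambda>\<tau>. (if 0 \<le> \<tau> then \<sigma> y \<tau> else 0) * wave_kernel a (t - \<tau>) (x - y)"
    \<comment> \<open>If the integrand is not integrable, the Green function is the default 0 and
      the bound is trivial.\<close>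
    have "ennreal \<bar>green_kernel a \<sigma> x y t\<bar> \<le> (\<integral>\<^sup>+\<tau>. ennreal (norm (?f \<tau>)) \<partial>lborel)"
      unfolding green_kernel_eq[OF a]
      using integral_norm_bound_ennreal[of lborel ?f]
      by (cases "integrable lborel ?f") (simp_all add: not_integrable_integral_eq)
    also have "\<dots> \<le> (\<integral>\<^sup>+\<tau>. ennreal C * ennreal (if t - \<tau> \<le> t then wave_kernel a (t - \<tau>) (x - y) else 0) \<partial>lborel)"
      using C wave_kernel_nonneg[OF a, of _ "x - y"] bd[of y]
      by (intro nn_integral_mono) (auto simp: abs_mult ennreal_mult''[symmetric] intro!: ennreal_leI mult_right_mono)
    also have "\<dots> = ennreal C * (\<integral>\<^sup>+\<tau>. ennreal (if t - \<tau> \<le> t then wave_kernel a (t - \<tau>) (x - y) else 0) \<partial>lborel)"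
      by (rule nn_integral_cmult) measurable
    also have "(\<integral>\<^sup>+\<tau>. ennreal (if t - \<tau> \<le> t then wave_kernel a (t - \<tau>) (x - y) else 0) \<partial>lborel) =
        (\<integral>\<^sup>+r. ennreal (if r \<le> t then wave_kernel a r (x - y) else 0) \<partial>lborel)"
      by (rule sym, rule trans[OF nn_integral_real_affine[of _ "-1" t]])
         (auto intro!: nn_integral_cong simp: minus_mult_left[symmetric])
    also have "\<dots> \<le> ennreal ((2 * (a * T) powr (1/4) / (pi * a\<^sup>2)) * (if norm (x - y) < a * T then norm (x - y) powr (-1/4) else 0))"
      by (rule wave_kernel_time_integral_le[OF a _ that(2)]) (use that in auto)
    finally have "ennreal \<bar>green_kernel a \<sigma> x y t\<bar> \<le> ennreal C * \<dots>" by (simp add: mult_left_mono)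
    also have "\<dots> = ennreal (c * (if norm (x - y) < a * T then norm (x - y) powr (-1/4) else 0))"
      using C by (simp add: c_def ennreal_mult'[symmetric] mult.assoc)
    finally show ?thesis using c by (subst (asm) ennreal_le_iff) (auto simp: norm_minus_commute)
  qed
  show thesis
  proof (rule that)
    fix x t assume t: "t \<le> T"
    have "(\<integral>\<^sup>+y. ennreal ((green_kernel a \<sigma> x y t)\<^sup>2) \<partial>lborel) \<le>
        (\<integral>\<^sup>+y. ennreal (c\<^sup>2) * ennreal (if norm (y - x) < a * T then norm (y - x) powr (-1/2) else 0) \<partial>lborel)"
    proof (rule nn_integral_mono_AE)
      have "AE y in lborel. y \<noteq> x" by (rule AE_lborel_singleton)
      then show "AE y in lborel. ennreal ((green_kernel a \<sigma> x y t)\<^sup>2) \<le> ennreal (c\<^sup>2) * ennreal (if norm (y - x) < a * T then norm (y - x) powr (-1/2) else 0)"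
      proof eventually_elim
        case (elim y)
        have "(green_kernel a \<sigma> x y t)\<^sup>2 \<le> (c * (if norm (y - x) < a * T then norm (y - x) powr (-1/4) else 0))\<^sup>2"
          using power_mono[OF G[OF elim t], of 2] by simp
        also have "\<dots> = c\<^sup>2 * (if norm (y - x) < a * T then norm (y - x) powr (-1/2) else 0)"
          by (simp add: power_mult_distrib power2_eq_square[of "_ powr _"] powr_add[symmetric])
        finally show ?case by (simp add: ennreal_mult'[symmetric] ennreal_leI)
      qed
    qed
    also have "\<dots> = ennreal (c\<^sup>2) * (\<integral>\<^sup>+y. ennreal (if norm (y - x) < a * T then norm (y - x) powr (-1/2) else 0) \<partial>lborel)"
      by (rule nn_integral_cmult) measurable
    also have "(\<integral>\<^sup>+y. ennreal (if norm (y - x) < a * T then norm (y - x) powr (-1/2) else 0) \<partial>lborel) = I"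
    proof -
      have [measurable]: "(+) x \<in> borel_measurable borel" by (intro borel_measurable_continuous_onI continuous_intros)
      show ?thesis unfolding I_def
        by (subst lborel_distr_plus[of x, symmetric], subst nn_integral_distr) (auto cong: if_cong)
    qed
    also have "ennreal (c\<^sup>2) * I = ennreal (c\<^sup>2 * enn2real I)" using I by (simp add: ennreal_mult')
    finally show "(\<integral>\<^sup>+y. ennreal ((green_kernel a \<sigma> x y t)\<^sup>2) \<partial>lborel) \<le> ennreal (c\<^sup>2 * enn2real I)" .
  qed simp
qed

text \<open>In cone coordinates a bounded time range is a box with a continuous weight, so the
  kernel has finite mass there.\<close>

lemma wave_kernel_truncated_integrable:
  assumes a: "0 < a"
  shows "integrable lborel (\<lambda>p. wave_kernel a (fst p) (snd p) * indicator {..R} (fst p))"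
proof -
  have [measurable]: "(\<lambda>p :: real \<times> (real \<times> real). indicator {..R} (fst p) :: real) \<in> borel_measurable borel"
    by (subst borel_prod[symmetric]) measurable
  let ?box = "cbox (0, -(pi/2), -(pi/2)) (R, pi/2, pi/2)"
  have "cone_weight p * indicator {..R} (fst (cone_param a p)) = indicator ?box p *\<^sub>R (\<lambda>(s, u, v). s * cos u / (2 * pi)) p" for p
    by (cases p) (auto simp: cone_weight_def cone_param_def indicator_def cbox_Pair_eq)
  moreover have "integrable lborel (\<lambda>p. indicator ?box p *\<^sub>R (\<lambda>(s, u, v). s * cos u / (2 * pi)) p)"
    by (rule borel_integrable_compact[OF compact_cbox]) (auto intro!: continuous_intros simp: split_beta')
  ultimately show ?thesis
    by (subst wave_kernel_change_of_variables(1)[OF a]) simp_all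
qed

text \<open>\<open>I\<close> will be the positive times for the wave operator, whose vanishing is
  known only there, and the nonnegative times for the test function itself.\<close>

lemma bounded_of_support:
  fixes f :: "real \<times> real \<Rightarrow> real \<Rightarrow> real"
  assumes "continuous_on UNIV (\<lambda>(x, t). f x t)" "I \<subseteq> {0..}"
    and z: "\<And>x t. t \<in> I \<Longrightarrow> R < norm x \<or> R < t \<Longrightarrow> f x t = 0"
  obtains B where "0 \<le> B" "\<And>x t. t \<in> I \<Longrightarrow> \<bar>f x t\<bar> \<le> B"
proof -
  let ?K = "cball (0 :: real \<times> real) R \<times> {0..R}"
  have "compact ((\<lambda>(x, t). f x t) ` ?K)"
    by (intro compact_continuous_image continuous_on_subset[OF assms(1)] compact_Times) auto
  then obtain B where B: "\<And>y. y \<in> (\<lambda>(x, t). f x t) ` ?K \<Longrightarrow> norm y \<le> B"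
    using compact_imp_bounded bounded_iff by metis
  have "\<bar>f x t\<bar> \<le> max B 0" if "t \<in> I" for x t
  proof (cases "norm x \<le> R \<and> t \<le> R")
    case True
    then have "f x t \<in> (\<lambda>(x, t). f x t) ` ?K" using that assms(2) by (intro image_eqI[of _ _ "(x, t)"]) auto
    from B[OF this] show ?thesis by simp
  next
    case False
    then show ?thesis using z[OF that, of x] by (auto simp: not_le)
  qed
  then show ?thesis using that[of "max B 0"] by simp
qed

text \<open>With Duhamel's form inserted, the emission time is exchanged with the space-time point,
  and the fundamental solution at apex \<open>(y, \<tau>)\<close> evaluates the inner integral. The
  absolute bound that justifies Fubini also gives \<open>K\<close>, uniform in \<open>y\<close>, as
  needed for the absolutely summable case.\<close>

lemma green_kernel_wave_op_integral:
  assumes a: "0 < a" and \<sigma>: "continuous_on UNIV (\<lambda>(x, t). \<sigma> x t)" and bd: "\<And>x t. \<bar>\<sigma> x t\<bar> \<le> C"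
    and \<theta>: "smooth3 \<theta>" and R: "vanishes_beyond R \<theta>" "0 < R"
  obtains K where "0 \<le> K"
    "\<And>y. integrable lborel (\<lambda>p. green_kernel a \<sigma> (snd p) y (fst p) * wave_op a \<theta> (snd p) (fst p))"
    "\<And>y. (\<integral>p. \<bar>green_kernel a \<sigma> (snd p) y (fst p) * wave_op a \<theta> (snd p) (fst p)\<bar> \<partial>lborel) \<le> K"
    "\<And>y. (\<integral>p. green_kernel a \<sigma> (snd p) y (fst p) * wave_op a \<theta> (snd p) (fst p) \<partial>lborel) =
       (\<integral>t. (if 0 \<le> t then \<theta> y t * \<sigma> y t else 0) \<partial>lborel)"
proof -
  have C: "0 \<le> C" using bd[of 0 0] by linarith
  define L where "L = wave_op a \<theta>"
  have contL: "continuous_on UNIV (\<lambda>(x, t). L x t)"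
    unfolding L_def split_beta' by (intro smooth3_wave_op_continuous[OF \<theta>] continuous_intros)
  have vL: "vanishes_beyond R L" unfolding L_def by (rule vanishes_beyond_wave_op[OF R(1)])
  obtain B where B: "0 \<le> B" "\<And>x t. 0 < t \<Longrightarrow> \<bar>L x t\<bar> \<le> B" 
    by (rule bounded_of_support[OF contL, of "{0<..}" R])
       (use vL in \<open>auto simp: vanishes_beyond_def simp del: split_paired_All\<close>)
  note [measurable] = borel_measurable_continuous_curried[OF \<sigma>] borel_measurable_continuous_curried[OF contL]
  define m where "m = (\<integral>p. wave_kernel a (fst p) (snd p) * indicator {..R} (fst p) \<partial>lborel)"
  have m0: "0 \<le> m" unfolding m_def by (intro Bochner_Integration.integral_nonneg) (simp add: wave_kernel_nonneg a)
  define s where "s y \<tau> = (if 0 \<le> \<tau> then \<sigma> y \<tau> else 0)" for y and \<tau> :: real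
  have [measurable]: "s y \<in> borel_measurable borel" for y unfolding s_def by measurable
  define h where "h y \<tau> p = wave_kernel a (fst p - \<tau>) (snd p - y) * L (snd p) (fst p)" for y \<tau> and p :: "real \<times> real \<times> real"
  have hm: "(\<lambda>q. h y (fst q) (snd q)) \<in> borel_measurable (borel \<Otimes>\<^sub>M (borel \<Otimes>\<^sub>M borel))" for y
    unfolding h_def by measurable
  have hm1 [measurable]: "h y \<tau> \<in> borel_measurable borel" for y \<tau>
    by (subst borel_prod[symmetric]) (unfold h_def, measurable)
  \<comment> \<open>Moving the origin to the apex \<open>(\<tau>, y)\<close> brings the integrand
    into the form of the fundamental solution.\<close>
  have tr: "h y \<tau> ((\<tau>, y) + q) = wave_kernel a (fst q) (snd q) * wave_op a \<theta> (y + snd q) (\<tau> + fst q)" for y \<tau> q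
    by (cases q) (simp add: h_def L_def)
  have hint: "integrable lborel (h y \<tau>)" and heq: "(\<integral>p. h y \<tau> p \<partial>lborel) = \<theta> y \<tau>" if "0 \<le> \<tau>" for y \<tau>
    using wave_kernel_fundamental_solution[OF \<theta> a that R, of y] lborel_translation[OF hm1, of y \<tau> "(\<tau>, y)"]
    unfolding tr by auto
  \<comment> \<open>The kernel lives at positive elapsed times, so a signal emitted after
    \<open>R\<close> meets only times where the wave operator vanishes; earlier ones contribute at
    most its supremum times the mass of the kernel.\<close>
  have habs: "(\<integral>p. \<bar>h y \<tau> p\<bar> \<partial>lborel) \<le> B * m * indicator {0..R} \<tau>" if \<tau>: "0 \<le> \<tau>" for y \<tau>
  proof -
    have "(\<integral>p. \<bar>h y \<tau> p\<bar> \<partial>lborel) = (\<integral>q. \<bar>h y \<tau> ((\<tau>, y) + q)\<bar> \<partial>lborel)"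
      by (rule lborel_translation(2)[symmetric]) measurable
    also have "\<dots> \<le> (\<integral>q. B * indicator {0..R} \<tau> * (wave_kernel a (fst q) (snd q) * indicator {..R} (fst q)) \<partial>lborel)"
    proof (rule integral_mono)
      show "integrable lborel (\<lambda>q. \<bar>h y \<tau> ((\<tau>, y) + q)\<bar>)"
        using lborel_translation(1)[of "\<lambda>p. \<bar>h y \<tau> p\<bar>" "(\<tau>, y)"] hint[OF \<tau>, of y] by auto
      show "integrable lborel (\<lambda>q. B * indicator {0..R} \<tau> * (wave_kernel a (fst q) (snd q) * indicator {..R} (fst q)))"
        by (intro integrable_mult_right wave_kernel_truncated_integrable a)
      fix q :: "real \<times> real \<times> real"
      show "\<bar>h y \<tau> ((\<tau>, y) + q)\<bar> \<le> B * indicator {0..R} \<tau> * (wave_kernel a (fst q) (snd q) * indicator {..R} (fst q))"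
      proof (cases "0 < fst q")
        case True
        have "\<bar>L (y + snd q) (\<tau> + fst q)\<bar> \<le> B * indicator {0..R} \<tau> * indicator {..R} (fst q)"
        proof (cases "\<tau> + fst q \<le> R")
          case T: True
          then show ?thesis using B(2)[of "\<tau> + fst q" "y + snd q"] True \<tau> by (auto simp: indicator_def)
        next
          case False
          then have "L (y + snd q) (\<tau> + fst q) = 0"
            using vL True \<tau> unfolding vanishes_beyond_def by (simp del: split_paired_All)
          then show ?thesis using B(1) by simp
        qed
        from mult_left_mono[OF this wave_kernel_nonneg[OF a, of "fst q" "snd q"]]
        show ?thesis unfolding tr L_def[symmetric] by (simp add: abs_mult wave_kernel_nonneg a ac_simps)
      next
        case False
        then have "wave_kernel a (fst q) (snd q) = 0" using a by (simp add: wave_kernel_nonpos_time)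
        then show ?thesis unfolding tr by simp
      qed
    qed
    finally show ?thesis
      unfolding Bochner_Integration.integral_mult_right_zero m_def[symmetric] by (simp add: ac_simps)
  qed
  \<comment> \<open>Bound of \<sigma>, bound of the wave operator, mass of the kernel up to time
    \<open>R\<close>, and length of the interval of emission times.\<close>
  define K where "K = C * B * m * R"
  have K0: "0 \<le> K" using C B m0 R by (simp add: K_def)
  define J where "J y q = s y (fst q) * h y (fst q) (snd q)" for y and q :: "real \<times> real \<times> real \<times> real"
  have Jm: "J y \<in> borel_measurable (lborel \<Otimes>\<^sub>M lborel)" for y
  proof -
    have "(\<lambda>q. h y (fst q) (snd q)) \<in> borel_measurable (lborel \<Otimes>\<^sub>M lborel)"
      using hm[of y] by (simp add: borel_prod lborel_prod)
    then show ?thesis unfolding J_def by measurable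
  qed
  have Jabs: "(\<integral>p. norm (J y (\<tau>, p)) \<partial>lborel) \<le> C * B * m * indicator {0..R} \<tau>" for y \<tau>
  proof (cases "0 \<le> \<tau>")
    case True
    have "(\<integral>p. norm (J y (\<tau>, p)) \<partial>lborel) = \<bar>\<sigma> y \<tau>\<bar> * (\<integral>p. \<bar>h y \<tau> p\<bar> \<partial>lborel)"
      using True by (simp add: J_def s_def abs_mult)
    also have "\<dots> \<le> C * (B * m * indicator {0..R} \<tau>)"
      using C by (intro mult_mono bd habs True) auto
    finally show ?thesis by (simp add: ac_simps)
  qed (use C B m0 in \<open>simp add: J_def s_def\<close>)
  have iI: "integrable lborel (\<lambda>\<tau>. C * B * m * indicator {0..R} \<tau> :: real)"
    by (intro integrable_mult_right) (simp add: integrable_indicator_iff emeasure_lborel_Icc_eq)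
  have Jint1: "integrable lborel (\<lambda>\<tau>. \<integral>p. norm (J y (\<tau>, p)) \<partial>lborel)" for y
  proof (rule Bochner_Integration.integrable_bound[of _ "\<lambda>\<tau>. C * B * m * indicator {0..R} \<tau>"])
    show "(\<lambda>\<tau>. \<integral>p. norm (J y (\<tau>, p)) \<partial>lborel) \<in> borel_measurable lborel"
      using Jm[of y] by (intro lborel.borel_measurable_lebesgue_integral) (simp add: split_beta')
    show "AE \<tau> in lborel. norm (\<integral>p. norm (J y (\<tau>, p)) \<partial>lborel) \<le> norm (C * B * m * indicator {0..R} \<tau>)"
    proof (rule AE_I2)
      fix \<tau>
      have "0 \<le> (\<integral>p. norm (J y (\<tau>, p)) \<partial>lborel)" by simp
      then show "norm (\<integral>p. norm (J y (\<tau>, p)) \<partial>lborel) \<le> norm (C * B * m * indicator {0..R} \<tau>)"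
        using Jabs[of y \<tau>] by simp
    qed
  qed (rule iI)
  have Jint: "integrable (lborel \<Otimes>\<^sub>M lborel) (J y)" for y
    by (rule lborel_pair.Fubini_integrable[OF Jm Jint1]) (use hint in \<open>auto simp: J_def s_def\<close>)
  have GJ: "green_kernel a \<sigma> (snd p) y (fst p) * wave_op a \<theta> (snd p) (fst p) = (\<integral>\<tau>. J y (\<tau>, p) \<partial>lborel)" for y p
  proof -
    have "(\<integral>\<tau>. J y (\<tau>, p) \<partial>lborel) = (\<integral>\<tau>. s y \<tau> * wave_kernel a (fst p - \<tau>) (snd p - y) * L (snd p) (fst p) \<partial>lborel)"
      by (simp add: J_def h_def mult.assoc)
    then show ?thesis by (simp add: green_kernel_eq[OF a] s_def L_def)
  qed
  show ?thesis
  proof (rule that[OF K0])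
    fix y
    have Jint': "integrable (lborel \<Otimes>\<^sub>M lborel) (\<lambda>(\<tau>, p). J y (\<tau>, p))"
      and Jn: "integrable (lborel \<Otimes>\<^sub>M lborel) (\<lambda>(\<tau>, p). norm (J y (\<tau>, p)))"
      using Jint[of y] integrable_norm[OF Jint[of y]] by (simp_all add: split_beta')
    show i: "integrable lborel (\<lambda>p. green_kernel a \<sigma> (snd p) y (fst p) * wave_op a \<theta> (snd p) (fst p))"
      unfolding GJ by (rule lborel_pair.integrable_snd[OF Jint'])
    have "(\<integral>p. \<bar>\<integral>\<tau>. J y (\<tau>, p) \<partial>lborel\<bar> \<partial>lborel) \<le> (\<integral>p. (\<integral>\<tau>. norm (J y (\<tau>, p)) \<partial>lborel) \<partial>lborel)"
    proof (rule integral_mono)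
      show "\<bar>\<integral>\<tau>. J y (\<tau>, p) \<partial>lborel\<bar> \<le> (\<integral>\<tau>. norm (J y (\<tau>, p)) \<partial>lborel)" for p
        using integral_norm_bound[of lborel "\<lambda>\<tau>. J y (\<tau>, p)"] by simp
    qed (use i[unfolded GJ] lborel_pair.integrable_snd[OF Jn] in auto)
    also have "\<dots> = (\<integral>\<tau>. (\<integral>p. norm (J y (\<tau>, p)) \<partial>lborel) \<partial>lborel)"
      by (rule lborel_pair.Fubini_integral[OF Jn])
    also have "\<dots> \<le> (\<integral>\<tau>. C * B * m * indicator {0..R} \<tau> \<partial>lborel)"
      by (rule integral_mono[OF Jint1 iI Jabs])
    also have "\<dots> = K" using R by (simp add: K_def)
    finally show "(\<integral>p. \<bar>green_kernel a \<sigma> (snd p) y (fst p) * wave_op a \<theta> (snd p) (fst p)\<bar> \<partial>lborel) \<le> K"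
      unfolding GJ .
    have "(\<integral>p. (\<integral>\<tau>. J y (\<tau>, p) \<partial>lborel) \<partial>lborel) = (\<integral>\<tau>. (\<integral>p. J y (\<tau>, p) \<partial>lborel) \<partial>lborel)"
      by (rule lborel_pair.Fubini_integral[OF Jint'])
    also have "\<dots> = (\<integral>t. (if 0 \<le> t then \<theta> y t * \<sigma> y t else 0) \<partial>lborel)"
      by (intro Bochner_Integration.integral_cong refl) (simp add: J_def s_def heq)
    finally show "(\<integral>p. green_kernel a \<sigma> (snd p) y (fst p) * wave_op a \<theta> (snd p) (fst p) \<partial>lborel) =
       (\<integral>t. (if 0 \<le> t then \<theta> y t * \<sigma> y t else 0) \<partial>lborel)" unfolding GJ .
  qed
qed

section \<open>Interchange of series and integral\<close>

text \<open>The pathwise interchange. Terms with \<open>x k\<close> outside the ball vanish, the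
  others have \<open>L^1\<close> norm at most \<open>\<bar>b k\<bar> * K\<close>, so the norms are
  summable and dominated convergence applies.\<close>

lemma integral_suminf_kernel:
  fixes b :: "nat \<Rightarrow> real" and F :: "'p \<Rightarrow> 'b::real_normed_vector \<Rightarrow> real"
  assumes b: "summable (\<lambda>k. \<bar>b k\<bar> * indicator (cball 0 R) (x k))"
    and Fint: "\<And>y. integrable \<mu> (\<lambda>p. F p y)" and FK: "\<And>y. (\<integral>p. \<bar>F p y\<bar> \<partial>\<mu>) \<le> K"
    and F0: "\<And>p y. R < norm y \<Longrightarrow> F p y = 0"
  shows "AE p in \<mu>. summable (\<lambda>k. b k * F p (x k))"
    and "integrable \<mu> (\<lambda>p. \<Sum>k. b k * F p (x k))"
    and "(\<integral>p. (\<Sum>k. b k * F p (x k)) \<partial>\<mu>) = (\<Sum>k. b k * (\<integral>p. F p (x k) \<partial>\<mu>))"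
proof -
  have i: "integrable \<mu> (\<lambda>p. b k * F p (x k))" for k using Fint by simp
  have [measurable]: "(\<lambda>p. F p y) \<in> borel_measurable \<mu>" for y using Fint by (rule borel_measurable_integrable)
  have le: "(\<integral>p. norm (b k * F p (x k)) \<partial>\<mu>) \<le> \<bar>b k\<bar> * indicator (cball 0 R) (x k) * K" for k
  proof (cases "norm (x k) \<le> R")
    case True
    then show ?thesis using mult_left_mono[OF FK, of "\<bar>b k\<bar>"] by (simp add: abs_mult)
  qed (simp add: F0)
  have s: "summable (\<lambda>k. \<integral>p. norm (b k * F p (x k)) \<partial>\<mu>)"
    by (rule summable_comparison_test'[OF summable_mult2[OF b, of K], of 0]) (use le in auto)
  have "(\<integral>\<^sup>+p. (\<Sum>k. ennreal (norm (b k * F p (x k)))) \<partial>\<mu>) = (\<Sum>k. \<integral>\<^sup>+p. ennreal (norm (b k * F p (x k))) \<partial>\<mu>)"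
    by (rule nn_integral_suminf) measurable
  also have "\<dots> = (\<Sum>k. ennreal (\<integral>p. norm (b k * F p (x k)) \<partial>\<mu>))"
    using i by (intro suminf_cong nn_integral_eq_integral integrable_norm) auto
  also have "\<dots> = ennreal (\<Sum>k. \<integral>p. norm (b k * F p (x k)) \<partial>\<mu>)"
    by (rule suminf_ennreal2[OF _ s]) simp
  finally have fin: "(\<integral>\<^sup>+p. (\<Sum>k. ennreal (norm (b k * F p (x k)))) \<partial>\<mu>) \<noteq> \<infinity>" by simp
  have "AE p in \<mu>. (\<Sum>k. ennreal (norm (b k * F p (x k)))) \<noteq> \<infinity>"
    by (rule nn_integral_noteq_infinite[OF _ fin]) measurable
  then have a: "AE p in \<mu>. summable (\<lambda>k. norm (b k * F p (x k)))"
    by eventually_elim (intro summable_suminf_not_top; simp)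
  then show "AE p in \<mu>. summable (\<lambda>k. b k * F p (x k))"
    by eventually_elim (rule summable_norm_cancel)
  show "integrable \<mu> (\<lambda>p. \<Sum>k. b k * F p (x k))" by (rule integrable_suminf[OF i a s])
  show "(\<integral>p. (\<Sum>k. b k * F p (x k)) \<partial>\<mu>) = (\<Sum>k. b k * (\<integral>p. F p (x k) \<partial>\<mu>))"
    using integral_suminf[OF i a s] by simp
qed

lemma powr_Suc_summable: "s < -1 \<Longrightarrow> summable (\<lambda>k. real (Suc k) powr s)"
  using summable_Suc_iff[of "\<lambda>n. real n powr s"] by (simp add: summable_real_powr_iff)

context lepage_series
begin

lemma density_bounds:
  obtains m M where "0 < m" "0 < M" "\<And>y. norm y \<le> R \<Longrightarrow> m \<le> \<phi> y" "\<And>y. norm y \<le> R \<Longrightarrow> \<phi> y \<le> M"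
proof -
  \<comment> \<open>The maximum with 0 keeps the ball nonempty, so that extrema are attained for
    every \<open>R\<close>.\<close>
  define K :: "(real \<times> real) set" where "K = cball 0 (max R 0)"
  have K: "compact K" "K \<noteq> {}" "continuous_on K \<phi>" "\<And>y. norm y \<le> R \<Longrightarrow> y \<in> K"
    by (auto simp: K_def intro: continuous_on_subset[OF density_continuous])
  obtain y z where "\<forall>x\<in>K. \<phi> y \<le> \<phi> x" "\<forall>x\<in>K. \<phi> x \<le> \<phi> z"
    using continuous_attains_inf[OF K(1-3)] continuous_attains_sup[OF K(1-3)] by blast
  then show ?thesis using that[of "\<phi> y" "\<phi> z"] density_pos K(4) by blast
qed

lemma density_measurable [measurable]: "\<phi> \<in> borel_measurable borel"
  by (rule borel_measurable_continuous_onI[OF density_continuous])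

section \<open>Almost sure control of the LePage coefficients\<close>

definition coefficient :: "nat \<Rightarrow> 'w \<Rightarrow> real" where
  "coefficient k \<omega> = arrival E k \<omega> powr (-1/\<alpha>) * \<phi> (\<xi> k \<omega>) powr (-1/\<alpha>) * g k \<omega>"

lemma lepage_term_eq: "lepage_term \<alpha> \<phi> E \<xi> g f k \<omega> = coefficient k \<omega> * f (\<xi> k \<omega>)"
  by (simp add: lepage_term_def coefficient_def)

text \<open>Linear growth bounds the arrival factors by a multiple of k^(-1/\<alpha>), summable as
  \<alpha> < 1, also after multiplication by the Gaussian factors, whose first absolute moments are
  bounded. The density factor is bounded on each ball. The exceptional set concerns only arrivals
  and Gaussians, so one set serves all \<open>R\<close>.\<close>

lemma coefficient_locally_summable:
  assumes \<alpha>: "0 < \<alpha>" "\<alpha> < 1"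
  shows "AE \<omega> in P. \<forall>R. summable (\<lambda>k. \<bar>coefficient k \<omega>\<bar> * indicator (cball 0 R) (\<xi> k \<omega>))"
proof -
  obtain V where V: "0 \<le> V" "\<And>k. integrable P (\<lambda>\<omega>. (g k \<omega>)\<^sup>2)" "\<And>k. expectation (\<lambda>\<omega>. (g k \<omega>)\<^sup>2) = V"
    using g_moments by metis
  have g1: "(\<integral>\<^sup>+\<omega>. ennreal \<bar>g k \<omega>\<bar> \<partial>P) \<le> ennreal (sqrt V)" for k
    using V(1) by (intro nn_integral_abs_le_of_square) (auto simp: nn_integral_eq_integral V)
  define s where "s = -1/\<alpha>"
  have s: "s < -1" using \<alpha> by (simp add: s_def field_simps)
  have "(\<integral>\<^sup>+\<omega>. (\<Sum>k. ennreal (real (Suc k) powr s * \<bar>g k \<omega>\<bar>)) \<partial>P) = (\<Sum>k. \<integral>\<^sup>+\<omega>. ennreal (real (Suc k) powr s * \<bar>g k \<omega>\<bar>) \<partial>P)"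
    by (rule nn_integral_suminf) measurable
  also have "\<dots> \<le> (\<Sum>k. ennreal (real (Suc k) powr s * sqrt V))"
  proof (rule suminf_le)
    fix k
    have "(\<integral>\<^sup>+\<omega>. ennreal (real (Suc k) powr s * \<bar>g k \<omega>\<bar>) \<partial>P) = ennreal (real (Suc k) powr s) * (\<integral>\<^sup>+\<omega>. ennreal \<bar>g k \<omega>\<bar> \<partial>P)"
      by (subst nn_integral_cmult[symmetric]) (auto simp: ennreal_mult')
    also have "\<dots> \<le> ennreal (real (Suc k) powr s) * ennreal (sqrt V)" by (intro mult_left_mono g1) simp
    finally show "(\<integral>\<^sup>+\<omega>. ennreal (real (Suc k) powr s * \<bar>g k \<omega>\<bar>) \<partial>P) \<le> ennreal (real (Suc k) powr s * sqrt V)"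
      by (simp add: ennreal_mult')
  qed auto
  also have "\<dots> = ennreal (\<Sum>k. real (Suc k) powr s * sqrt V)"
    using V(1) by (intro suminf_ennreal2 summable_mult2 powr_Suc_summable s) auto
  finally have fin: "(\<integral>\<^sup>+\<omega>. (\<Sum>k. ennreal (real (Suc k) powr s * \<bar>g k \<omega>\<bar>)) \<partial>P) \<noteq> \<infinity>"
    by (auto simp: top_unique)
  have "AE \<omega> in P. (\<Sum>k. ennreal (real (Suc k) powr s * \<bar>g k \<omega>\<bar>)) \<noteq> \<infinity>"
    by (rule nn_integral_noteq_infinite[OF _ fin]) measurable
  with arrival_linear_growth show ?thesis
  proof eventually_elim
    case (elim \<omega>)
    have sg: "summable (\<lambda>k. real (Suc k) powr s * \<bar>g k \<omega>\<bar>)"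
      using elim(2) by (intro summable_suminf_not_top) auto
    from elim(1) obtain N :: nat where N: "0 < N" "\<And>k. real (Suc k) / real N \<le> arrival E k \<omega>" by auto
    show ?case
    proof
      fix R
      obtain m where m: "0 < m" "\<And>y. norm y \<le> R \<Longrightarrow> m \<le> \<phi> y" using density_bounds by metis
      show "summable (\<lambda>k. \<bar>coefficient k \<omega>\<bar> * indicator (cball 0 R) (\<xi> k \<omega>))"
      proof (rule summable_comparison_test'[where N=0])
        show "summable (\<lambda>k. (1 / real N) powr s * m powr s * (real (Suc k) powr s * \<bar>g k \<omega>\<bar>))"
          by (intro summable_mult sg)
        fix k
        show "norm (\<bar>coefficient k \<omega>\<bar> * indicator (cball 0 R) (\<xi> k \<omega>))
          \<le> (1 / real N) powr s * m powr s * (real (Suc k) powr s * \<bar>g k \<omega>\<bar>)"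
        proof (cases "norm (\<xi> k \<omega>) \<le> R")
          case True
          have "arrival E k \<omega> powr s \<le> (real (Suc k) * (1 / real N)) powr s"
            using N(1) N(2)[of k] s by (intro powr_mono2') auto
          also have "\<dots> = real (Suc k) powr s * (1 / real N) powr s" by (rule powr_mult)
          finally have "arrival E k \<omega> powr s * \<phi> (\<xi> k \<omega>) powr s \<le> real (Suc k) powr s * (1 / real N) powr s * m powr s"
            using m True s by (intro mult_mono powr_mono2') auto
          from mult_right_mono[OF this abs_ge_zero[of "g k \<omega>"]]
          show ?thesis using True unfolding coefficient_def s_def[symmetric] by (simp add: abs_mult ac_simps)
        qed simp
      qed
    qed
  qed
qed

text \<open>Negative moments of the arrival times may be infinite; the truncation makes the coefficients
  square summable by a deterministic bound, and almost surely it is void for some \<open>N\<close>.\<close>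
definition truncated_arrival :: "nat \<Rightarrow> nat \<Rightarrow> 'w \<Rightarrow> real" where
  "truncated_arrival N k \<omega> = (if real (Suc k) / real N \<le> arrival E k \<omega> then arrival E k \<omega> powr (-1/\<alpha>) else 0)"

text \<open>The squared bounds decay like k^(-2/\<alpha>); their summability is where \<alpha> < 2
  enters.\<close>

lemma truncated_arrival_series:
  assumes \<alpha>: "0 < \<alpha>" "\<alpha> < 2" and N: "0 < N"
  shows "\<exists>V. weighted_lepage_series P \<alpha> \<phi> E \<xi> g (truncated_arrival N) (\<lambda>k. (real (Suc k) / real N) powr (-1/\<alpha>)) V"
proof -
  obtain V where V: "0 \<le> V" "\<And>k. integrable P (\<lambda>\<omega>. (g k \<omega>)\<^sup>2)" "\<And>k. expectation (\<lambda>\<omega>. (g k \<omega>)\<^sup>2) = V"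
    using g_moments by metis
  have "weighted_lepage_series P \<alpha> \<phi> E \<xi> g (truncated_arrival N) (\<lambda>k. (real (Suc k) / real N) powr (-1/\<alpha>)) V"
  proof (intro_locales, unfold_locales)
    show "truncated_arrival N k \<in> borel_measurable (others j)" for k j
      unfolding truncated_arrival_def by measurable
    show "\<bar>truncated_arrival N k \<omega>\<bar> \<le> (real (Suc k) / real N) powr (-1/\<alpha>)" for k \<omega>
      unfolding truncated_arrival_def using \<alpha> N by (auto intro!: powr_mono2')
    have "summable (\<lambda>k. real (Suc k) powr (-2/\<alpha>) * (1 / real N) powr (-2/\<alpha>))"
      using \<alpha> by (intro summable_mult2 powr_Suc_summable) (simp add: field_simps)
    also have "(\<lambda>k. real (Suc k) powr (-2/\<alpha>) * (1 / real N) powr (-2/\<alpha>)) = (\<lambda>k. ((real (Suc k) / real N) powr (-1/\<alpha>))\<^sup>2)"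
      by (simp add: power2_eq_square powr_add[symmetric] powr_mult[symmetric])
    finally show "summable (\<lambda>k. ((real (Suc k) / real N) powr (-1/\<alpha>))\<^sup>2)" .
    show "(\<integral>\<^sup>+\<omega>. ennreal ((g k \<omega>)\<^sup>2) \<partial>P) = ennreal V" for k by (simp add: nn_integral_eq_integral V)
  qed (rule V(1))
  then show ?thesis ..
qed

text \<open>The density factor is absorbed into the kernels, whose common bounded support makes it
  harmless. The result is proved for every truncation level, and almost every outcome satisfies the
  linear growth bound at some level, where truncated and true arrival factors coincide for all
  indices.\<close>

lemma lepage_fubini_eq:
  fixes \<mu>1 :: "'p measure" and F1 :: "'p \<Rightarrow> real \<times> real \<Rightarrow> real"
    and \<mu>2 :: "'q measure" and F2 :: "'q \<Rightarrow> real \<times> real \<Rightarrow> real"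
  assumes \<alpha>: "0 < \<alpha>" "\<alpha> < 2"
    and \<mu>1: "sigma_finite_measure \<mu>1"
    and F1: "(\<lambda>(p, y). F1 p y) \<in> borel_measurable (\<mu>1 \<Otimes>\<^sub>M borel)"
    and w1: "integrable \<mu>1 w1" "\<And>p. 0 \<le> w1 p"
    and sq1: "\<And>p. p \<in> space \<mu>1 \<Longrightarrow> (\<integral>\<^sup>+y. ennreal ((F1 p y)\<^sup>2) \<partial>lborel) \<le> ennreal ((w1 p)\<^sup>2)"
    and Fint1: "\<And>y. integrable \<mu>1 (\<lambda>p. F1 p y)"
    and \<mu>2: "sigma_finite_measure \<mu>2"
    and F2: "(\<lambda>(p, y). F2 p y) \<in> borel_measurable (\<mu>2 \<Otimes>\<^sub>M borel)"
    and w2: "integrable \<mu>2 w2" "\<And>p. 0 \<le> w2 p"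
    and sq2: "\<And>p. p \<in> space \<mu>2 \<Longrightarrow> (\<integral>\<^sup>+y. ennreal ((F2 p y)\<^sup>2) \<partial>lborel) \<le> ennreal ((w2 p)\<^sup>2)"
    and Fint2: "\<And>y. integrable \<mu>2 (\<lambda>p. F2 p y)"
    and supp: "\<And>p y. R < norm y \<Longrightarrow> F1 p y = 0" "\<And>p y. R < norm y \<Longrightarrow> F2 p y = 0"
    and eq: "\<And>y. (\<integral>p. F1 p y \<partial>\<mu>1) = (\<integral>p. F2 p y \<partial>\<mu>2)"
  shows "AE \<omega> in P. (AE p in \<mu>1. summable (\<lambda>k. coefficient k \<omega> * F1 p (\<xi> k \<omega>))) \<and>
    integrable \<mu>1 (\<lambda>p. \<Sum>k. coefficient k \<omega> * F1 p (\<xi> k \<omega>)) \<and>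
    (\<integral>p. (\<Sum>k. coefficient k \<omega> * F1 p (\<xi> k \<omega>)) \<partial>\<mu>1) = (\<integral>p. (\<Sum>k. coefficient k \<omega> * F2 p (\<xi> k \<omega>)) \<partial>\<mu>2)"
proof -
  define s where "s = -1/\<alpha>"
  have s: "s < 0" using \<alpha> by (simp add: s_def)
  obtain m M where m: "0 < m" "\<And>y. norm y \<le> R \<Longrightarrow> m \<le> \<phi> y" and M: "0 < M" "\<And>y. norm y \<le> R \<Longrightarrow> \<phi> y \<le> M"
    using density_bounds by metis
  \<comment> \<open>On the ball of radius \<open>R\<close>, \<open>D\<close> squared dominates
    \<open>(\<phi> y powr s)\<^sup>2 * \<phi> y\<close>: the negative power is largest at the lower
    bound \<open>m\<close>, the density at the upper bound \<open>M\<close>.\<close>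
  define D where "D = sqrt ((m powr s)\<^sup>2 * M)"
  have D: "0 \<le> D" "D\<^sup>2 = (m powr s)\<^sup>2 * M" using M by (simp_all add: D_def)
  have [measurable]: "(\<lambda>y. \<phi> y powr s) \<in> borel_measurable borel" by measurable
  have bound: "(\<integral>\<^sup>+y. ennreal ((\<phi> y powr s * f y)\<^sup>2) * ennreal (\<phi> y) \<partial>lborel) \<le> ennreal ((D * w)\<^sup>2)"
    if [measurable]: "f \<in> borel_measurable borel" and sq: "(\<integral>\<^sup>+y. ennreal ((f y)\<^sup>2) \<partial>lborel) \<le> ennreal (w\<^sup>2)"
      and f0: "\<And>y. R < norm y \<Longrightarrow> f y = 0" for f w
  proof -
    have "(\<integral>\<^sup>+y. ennreal ((\<phi> y powr s * f y)\<^sup>2) * ennreal (\<phi> y) \<partial>lborel) \<le> (\<integral>\<^sup>+y. ennreal (D\<^sup>2) * ennreal ((f y)\<^sup>2) \<partial>lborel)"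
    proof (rule nn_integral_mono)
      fix y
      show "ennreal ((\<phi> y powr s * f y)\<^sup>2) * ennreal (\<phi> y) \<le> ennreal (D\<^sup>2) * ennreal ((f y)\<^sup>2)"
      proof (cases "norm y \<le> R")
        case True
        have "\<phi> y powr s \<le> m powr s" using m True s by (intro powr_mono2') auto
        then have "(\<phi> y powr s)\<^sup>2 * \<phi> y \<le> (m powr s)\<^sup>2 * M" using M True density_pos[of y] by (intro mult_mono power_mono) (auto simp: less_imp_le)
        from mult_right_mono[OF this[folded D(2)], of "(f y)\<^sup>2"]
        have "(\<phi> y powr s * f y)\<^sup>2 * \<phi> y \<le> D\<^sup>2 * (f y)\<^sup>2" by (simp add: power_mult_distrib ac_simps)
        then show ?thesis using density_pos[of y] by (simp add: ennreal_mult'[symmetric] ennreal_leI)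
      qed (simp add: f0)
    qed
    also have "\<dots> = ennreal (D\<^sup>2) * (\<integral>\<^sup>+y. ennreal ((f y)\<^sup>2) \<partial>lborel)" by (rule nn_integral_cmult) measurable
    also have "\<dots> \<le> ennreal (D\<^sup>2) * ennreal (w\<^sup>2)" by (intro mult_left_mono sq) simp
    finally show ?thesis by (simp add: ennreal_mult' power_mult_distrib)
  qed
  have m1: "F1 p \<in> borel_measurable borel" if "p \<in> space \<mu>1" for p
    using measurable_compose[OF measurable_Pair1'[OF that] F1] by simp
  have m2: "F2 p \<in> borel_measurable borel" if "p \<in> space \<mu>2" for p
    using measurable_compose[OF measurable_Pair1'[OF that] F2] by simp
  define X1 X2 where X_def: "X1 N p k \<omega> = truncated_arrival N k \<omega> * (\<phi> (\<xi> k \<omega>) powr s * F1 p (\<xi> k \<omega>)) * g k \<omega>"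
    "X2 N q k \<omega> = truncated_arrival N k \<omega> * (\<phi> (\<xi> k \<omega>) powr s * F2 q (\<xi> k \<omega>)) * g k \<omega>" for N p q k \<omega>
  define Q where "Q N \<omega> \<longleftrightarrow> (AE p in \<mu>1. summable (\<lambda>k. X1 N p k \<omega>)) \<and>
    integrable \<mu>1 (\<lambda>p. \<Sum>k. X1 N p k \<omega>) \<and>
    (\<integral>p. (\<Sum>k. X1 N p k \<omega>) \<partial>\<mu>1) = (\<integral>p. (\<Sum>k. X2 N p k \<omega>) \<partial>\<mu>2)" for N \<omega>
  have each: "AE \<omega> in P. Q N \<omega>" if N: "0 < N" for N
  proof -
    obtain V where "weighted_lepage_series P \<alpha> \<phi> E \<xi> g (truncated_arrival N) (\<lambda>k. (real (Suc k) / real N) powr (-1/\<alpha>)) V"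
      using truncated_arrival_series[OF \<alpha> N] by blast
    then interpret W: weighted_lepage_series P \<alpha> \<phi> E \<xi> g "truncated_arrival N" "\<lambda>k. (real (Suc k) / real N) powr (-1/\<alpha>)" V .
    note F1[measurable] F2[measurable]
    have F1': "(\<lambda>(p, y). \<phi> y powr s * F1 p y) \<in> borel_measurable (\<mu>1 \<Otimes>\<^sub>M borel)" by measurable
    have F2': "(\<lambda>(p, y). \<phi> y powr s * F2 p y) \<in> borel_measurable (\<mu>2 \<Otimes>\<^sub>M borel)" by measurable
    have w1': "integrable \<mu>1 (\<lambda>p. D * w1 p)" "\<And>p. 0 \<le> D * w1 p" using w1 D(1) by auto
    have w2': "integrable \<mu>2 (\<lambda>p. D * w2 p)" "\<And>p. 0 \<le> D * w2 p" using w2 D(1) by auto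
    have sq1': "(\<integral>\<^sup>+y. ennreal ((\<phi> y powr s * F1 p y)\<^sup>2) * ennreal (\<phi> y) \<partial>lborel) \<le> ennreal ((D * w1 p)\<^sup>2)"
      if "p \<in> space \<mu>1" for p by (rule bound[OF m1[OF that] sq1[OF that] supp(1)])
    have sq2': "(\<integral>\<^sup>+y. ennreal ((\<phi> y powr s * F2 p y)\<^sup>2) * ennreal (\<phi> y) \<partial>lborel) \<le> ennreal ((D * w2 p)\<^sup>2)"
      if "p \<in> space \<mu>2" for p by (rule bound[OF m2[OF that] sq2[OF that] supp(2)])
    have i1: "integrable \<mu>1 (\<lambda>p. \<phi> y powr s * F1 p y)" for y using Fint1 by simp
    have i2: "integrable \<mu>2 (\<lambda>p. \<phi> y powr s * F2 p y)" for y using Fint2 by simp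
    have eq': "(\<integral>p. \<phi> y powr s * F1 p y \<partial>\<mu>1) = (\<integral>p. \<phi> y powr s * F2 p y \<partial>\<mu>2)" for y using eq by simp
    have "AE \<omega> in P. (AE p in \<mu>1. summable (\<lambda>k. X1 N p k \<omega>)) \<and>
      integrable \<mu>1 (\<lambda>p. \<Sum>k. X1 N p k \<omega>)"
      unfolding X_def by (rule W.stochastic_fubini(1)[OF \<mu>1 F1' w1' sq1' i1])
    moreover have "AE \<omega> in P. (\<integral>p. (\<Sum>k. X1 N p k \<omega>) \<partial>\<mu>1) =
      (\<integral>p. (\<Sum>k. X2 N p k \<omega>) \<partial>\<mu>2)"
      unfolding X_def by (rule W.stochastic_fubini_eq[OF \<mu>1 F1' w1' sq1' i1 \<mu>2 F2' w2' sq2' i2 eq'])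
    ultimately show ?thesis unfolding Q_def by eventually_elim simp
  qed
  \<comment> \<open>All levels must hold simultaneously, because the suitable one depends on the
    outcome.\<close>
  have "AE \<omega> in P. \<forall>N. 0 < N \<longrightarrow> Q N \<omega>"
    unfolding AE_all_countable using each by (auto intro: AE_impI)
  with arrival_linear_growth show ?thesis
  proof eventually_elim
    case (elim \<omega>)
    from elim(1) obtain N :: nat where N: "0 < N" "\<And>k. real (Suc k) / real N \<le> arrival E k \<omega>" by auto
    have "truncated_arrival N k \<omega> * (\<phi> (\<xi> k \<omega>) powr s * z) * g k \<omega> = coefficient k \<omega> * z" for k z
      using N(2)[of k] unfolding truncated_arrival_def coefficient_def s_def[symmetric] by simp
    then show ?case using elim(2)[rule_format, OF N(1)] unfolding Q_def X_def by (simp only:)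
  qed
qed

end

section \<open>The weak identity\<close>

lemma integrable_indicator_compact:
  fixes S :: "'a::euclidean_space set"
  assumes "compact S"
  shows "integrable lborel (\<lambda>x. c * indicator S x :: real)"
  using assms emeasure_compact_finite[OF assms]
  by (intro integrable_mult_right) (simp add: integrable_indicator_iff borel_compact)

locale wave_equation_data = lepage_series +
  fixes a C :: real and \<sigma> :: "real \<times> real \<Rightarrow> real \<Rightarrow> real"
  assumes a_pos: "0 < a"
    and \<alpha>_pos: "0 < \<alpha>"
    and sigma_bdd: "\<And>x t. \<bar>\<sigma> x t\<bar> \<le> C"
    and sigma_cont: "continuous_on UNIV (\<lambda>(x, t). \<sigma> x t)"
begin

text \<open>The parameter is (time, place), in the order of the iterated integral in
  \<open>weak_lhs\<close>; \<open>y\<close> is the place of the noise.\<close>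

definition lhs_kernel :: "(real \<times> real \<Rightarrow> real \<Rightarrow> real) \<Rightarrow> real \<times> (real \<times> real) \<Rightarrow> real \<times> real \<Rightarrow> real" where
  "lhs_kernel \<theta> p y = green_kernel a \<sigma> (snd p) y (fst p) * wave_op a \<theta> (snd p) (fst p)"

definition rhs_kernel :: "(real \<times> real \<Rightarrow> real \<Rightarrow> real) \<Rightarrow> real \<Rightarrow> real \<times> real \<Rightarrow> real" where
  "rhs_kernel \<theta> t y = (if 0 \<le> t then \<theta> y t * \<sigma> y t else 0)"

lemma lhs_kernel_measurable:
  assumes "smooth3 \<theta>"
  shows "(\<lambda>(p, y). lhs_kernel \<theta> p y) \<in> borel_measurable (lborel \<Otimes>\<^sub>M borel)"
proof -
  have L: "continuous_on UNIV (\<lambda>(x, t). wave_op a \<theta> x t)"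
    unfolding split_beta' by (intro smooth3_wave_op_continuous[OF assms] continuous_intros)
  note [measurable] = green_kernel_measurable[OF a_pos sigma_cont] borel_measurable_continuous_curried[OF L]
  have m: "(\<lambda>(p, y). lhs_kernel \<theta> p y) \<in> borel_measurable ((borel \<Otimes>\<^sub>M borel) \<Otimes>\<^sub>M borel)"
    unfolding lhs_kernel_def by measurable
  have "sets (lborel \<Otimes>\<^sub>M (borel :: (real \<times> real) measure)) = sets ((borel \<Otimes>\<^sub>M borel) \<Otimes>\<^sub>M borel)"
    by (rule sets_pair_measure_cong) (simp_all only: borel_prod sets_lborel)
  from measurable_cong_sets[OF this refl] m show ?thesis by blast
qed

lemma rhs_kernel_measurable:
  assumes "smooth3 \<theta>"
  shows "(\<lambda>(p, y). rhs_kernel \<theta> p y) \<in> borel_measurable (lborel \<Otimes>\<^sub>M borel)"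
proof -
  note [measurable] = borel_measurable_continuous_curried[OF smooth3_continuous[OF assms]]
    borel_measurable_continuous_curried[OF sigma_cont]
  show ?thesis unfolding rhs_kernel_def by measurable
qed

lemma green_kernel_eq_0: "a * t \<le> dist x y \<Longrightarrow> green_kernel a \<sigma> x y t = 0"
  by (simp add: green_kernel_def)

lemma green_kernel_nonpos_time: "t \<le> 0 \<Longrightarrow> green_kernel a \<sigma> x y t = 0"
  using a_pos by (intro green_kernel_eq_0 order_trans[OF _ zero_le_dist]) (simp add: mult_le_0_iff)

text \<open>All that the two interchange theorems ask of the kernels, with one radius and one
  constant for both sides. Within the support of the test function signals travel at most
  \<open>a * R\<close>, so noise beyond \<open>R + a * R\<close> is never felt.\<close>

lemma kernel_bounds:
  assumes \<theta>: "test_fun \<theta>"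
  obtains R K w1 w2 where
    "\<And>p y. R < norm y \<Longrightarrow> lhs_kernel \<theta> p y = 0" "\<And>t y. R < norm y \<Longrightarrow> rhs_kernel \<theta> t y = 0"
    "\<And>y. integrable lborel (\<lambda>p. lhs_kernel \<theta> p y)" "\<And>y. integrable lborel (\<lambda>t. rhs_kernel \<theta> t y)"
    "\<And>y. (\<integral>p. \<bar>lhs_kernel \<theta> p y\<bar> \<partial>lborel) \<le> K" "\<And>y. (\<integral>t. \<bar>rhs_kernel \<theta> t y\<bar> \<partial>lborel) \<le> K"
    "\<And>y. (\<integral>p. lhs_kernel \<theta> p y \<partial>lborel) = (\<integral>t. rhs_kernel \<theta> t y \<partial>lborel)"
    "integrable lborel w1" "\<And>p. 0 \<le> w1 p" "\<And>p. (\<integral>\<^sup>+y. ennreal ((lhs_kernel \<theta> p y)\<^sup>2) \<partial>lborel) \<le> ennreal ((w1 p)\<^sup>2)"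
    "integrable lborel w2" "\<And>t. 0 \<le> w2 t" "\<And>t. (\<integral>\<^sup>+y. ennreal ((rhs_kernel \<theta> t y)\<^sup>2) \<partial>lborel) \<le> ennreal ((w2 t)\<^sup>2)"
proof -
  have sm: "smooth3 \<theta>" using \<theta> by (simp add: test_fun_def)
  obtain R where R: "0 < R" "vanishes_beyond R \<theta>" "\<And>x t. 0 \<le> t \<Longrightarrow> R < norm x \<or> R < t \<Longrightarrow> \<theta> x t = 0"
    using test_fun_vanishes[OF \<theta>] by blast
  have C: "0 \<le> C" using sigma_bdd[of 0 0] by linarith
  have contL: "continuous_on UNIV (\<lambda>(x, t). wave_op a \<theta> x t)"
    unfolding split_beta' by (intro smooth3_wave_op_continuous[OF sm] continuous_intros)
  have L0: "wave_op a \<theta> x t = 0" if "t \<in> {0<..}" "R < norm x \<or> R < t" for x t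
    using vanishes_beyond_wave_op[OF R(2), of a] that unfolding vanishes_beyond_def by (auto simp del: split_paired_All)
  obtain B1 where B1: "0 \<le> B1" "\<And>x t. t \<in> {0<..} \<Longrightarrow> \<bar>wave_op a \<theta> x t\<bar> \<le> B1"
    by (rule bounded_of_support[OF contL _ L0, of "{0<..}"]) auto
  obtain B2 where B2: "0 \<le> B2" "\<And>x t. t \<in> {0..} \<Longrightarrow> \<bar>\<theta> x t\<bar> \<le> B2"
    by (rule bounded_of_support[OF smooth3_continuous[OF sm], of "{0..}" R]) (use R(3) in auto)
  obtain K1 where K1: "0 \<le> K1" "\<And>y. integrable lborel (\<lambda>p. lhs_kernel \<theta> p y)"
    "\<And>y. (\<integral>p. \<bar>lhs_kernel \<theta> p y\<bar> \<partial>lborel) \<le> K1" "\<And>y. (\<integral>p. lhs_kernel \<theta> p y \<partial>lborel) = (\<integral>t. rhs_kernel \<theta> t y \<partial>lborel)"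
    unfolding lhs_kernel_def rhs_kernel_def
    by (rule green_kernel_wave_op_integral[OF a_pos sigma_cont sigma_bdd sm R(2,1)]) blast
  obtain K2 where K2: "0 \<le> K2" "\<And>x t. t \<le> R \<Longrightarrow> (\<integral>\<^sup>+y. ennreal ((green_kernel a \<sigma> x y t)\<^sup>2) \<partial>lborel) \<le> ennreal K2"
    by (rule green_kernel_square_integral[OF a_pos sigma_cont sigma_bdd]) blast
  have rle: "\<bar>rhs_kernel \<theta> t y\<bar> \<le> B2 * C * indicator {0..R} t * indicator (cball 0 R) y" for t y
  proof (cases "t \<in> {0..R} \<and> norm y \<le> R")
    case True
    then show ?thesis using B2(1) B2(2)[of t y] C sigma_bdd[of y t] by (auto simp: rhs_kernel_def abs_mult intro!: mult_mono)
  next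
    case False
    then have "rhs_kernel \<theta> t y = 0" using R(3)[of t y] by (auto simp: rhs_kernel_def not_le)
    then show ?thesis using B2 C by simp
  qed
  have iI: "integrable lborel (\<lambda>t. B2 * C * indicator {0..R} t :: real)" by (rule integrable_indicator_compact) simp
  have rle': "norm (rhs_kernel \<theta> t y) \<le> B2 * C * indicator {0..R} t" for t y
  proof -
    have "B2 * C * indicator {0..R} t * indicator (cball 0 R) y \<le> B2 * C * indicator {0..R} t * 1"
      using B2 C by (intro mult_left_mono) (auto simp: indicator_def)
    then show ?thesis using rle[of t y] by simp
  qed
  have rint: "integrable lborel (\<lambda>t. rhs_kernel \<theta> t y)" for y
  proof (rule Bochner_Integration.integrable_bound[OF iI])
    show "(\<lambda>t. rhs_kernel \<theta> t y) \<in> borel_measurable lborel"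
      using measurable_compose[OF measurable_Pair2'[of y borel lborel] rhs_kernel_measurable[OF sm]] by simp
  qed (use rle'[of _ y] in \<open>auto intro!: AE_I2 order_trans[OF _ abs_ge_self]\<close>)
  have rK: "(\<integral>t. \<bar>rhs_kernel \<theta> t y\<bar> \<partial>lborel) \<le> B2 * C * R" for y
  proof -
    have "(\<integral>t. \<bar>rhs_kernel \<theta> t y\<bar> \<partial>lborel) \<le> (\<integral>t. B2 * C * indicator {0..R} t \<partial>lborel)"
      by (rule integral_mono[OF _ iI]) (use rint rle'[of _ y] in auto)
    then show ?thesis using R(1) by simp
  qed
  \<comment> \<open>\<open>w1\<close> and \<open>w2\<close> bound the \<open>L^2\<close> norms of
    the kernels in \<open>y\<close>: one uses the uniform square integral of the Green function, the
    other the area of the ball carrying the test function. Both have compact support in the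
    parameter.\<close>
  define w1 where "w1 p = sqrt K2 * B1 * indicator ({0..R} \<times> cball 0 R) p" for p :: "real \<times> real \<times> real"
  define w2 where "w2 t = B2 * C * sqrt (measure lborel (cball (0 :: real \<times> real) R)) * indicator {0..R} t" for t :: real
  have l0: "lhs_kernel \<theta> p y = 0" if "p \<notin> {0..R} \<times> cball 0 R" for p y
  proof (cases "0 < fst p")
    case True
    then have "wave_op a \<theta> (snd p) (fst p) = 0" using that L0[of "fst p" "snd p"] by (cases p) auto
    then show ?thesis by (simp add: lhs_kernel_def)
  next
    case False
    then show ?thesis by (simp add: lhs_kernel_def green_kernel_nonpos_time)
  qed
  have l1: "\<bar>lhs_kernel \<theta> p y\<bar> \<le> \<bar>green_kernel a \<sigma> (snd p) y (fst p)\<bar> * B1" for p y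
  proof (cases "0 < fst p")
    case True
    then show ?thesis using B1(2)[of "fst p" "snd p"] by (auto simp: lhs_kernel_def abs_mult intro!: mult_left_mono)
  next
    case False
    then show ?thesis by (simp add: lhs_kernel_def green_kernel_nonpos_time)
  qed
  show thesis
  proof (rule that[of "R + a * R" "max K1 (B2 * C * R)" w1 w2])
    show "lhs_kernel \<theta> p y = 0" if y: "R + a * R < norm y" for p y
    proof (cases "p \<in> {0..R} \<times> cball 0 R")
      case True
      then have "a * fst p \<le> a * R" "norm (snd p) \<le> R" using a_pos by auto
      moreover have "norm y \<le> norm (snd p) + dist (snd p) y"
        using norm_triangle_ineq2[of y "snd p"] by (simp add: dist_norm norm_minus_commute)
      ultimately have "a * fst p \<le> dist (snd p) y" using y by linarith
      then show ?thesis by (simp add: lhs_kernel_def green_kernel_eq_0)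
    qed (rule l0)
    show "rhs_kernel \<theta> t y = 0" if y: "R + a * R < norm y" for t y
    proof -
      have "R < norm y" using y mult_pos_pos[OF a_pos R(1)] by linarith
      then show ?thesis using R(3)[of t y] by (simp add: rhs_kernel_def)
    qed
    show "integrable lborel w1" unfolding w1_def by (rule integrable_indicator_compact) (auto intro: compact_Times)
    show "integrable lborel w2" unfolding w2_def by (rule integrable_indicator_compact) simp
    show "0 \<le> w1 p" for p using K2 B1 by (simp add: w1_def)
    show "0 \<le> w2 p" for p using B2 C by (simp add: w2_def)
    show "(\<integral>\<^sup>+y. ennreal ((lhs_kernel \<theta> p y)\<^sup>2) \<partial>lborel) \<le> ennreal ((w1 p)\<^sup>2)" for p
    proof (cases "p \<in> {0..R} \<times> cball 0 R")
      case True
      have [measurable]: "(\<lambda>y. green_kernel a \<sigma> (snd p) y (fst p)) \<in> borel_measurable borel"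
        by (rule green_kernel_measurable[OF a_pos sigma_cont]) measurable
      have "(\<integral>\<^sup>+y. ennreal ((lhs_kernel \<theta> p y)\<^sup>2) \<partial>lborel) \<le> (\<integral>\<^sup>+y. ennreal (B1\<^sup>2) * ennreal ((green_kernel a \<sigma> (snd p) y (fst p))\<^sup>2) \<partial>lborel)"
      proof (rule nn_integral_mono)
        fix y
        have "(lhs_kernel \<theta> p y)\<^sup>2 \<le> (\<bar>green_kernel a \<sigma> (snd p) y (fst p)\<bar> * B1)\<^sup>2"
          using power_mono[OF l1[of p y], of 2] by simp
        then show "ennreal ((lhs_kernel \<theta> p y)\<^sup>2) \<le> ennreal (B1\<^sup>2) * ennreal ((green_kernel a \<sigma> (snd p) y (fst p))\<^sup>2)"
          by (simp add: ennreal_mult'[symmetric] power_mult_distrib mult.commute ennreal_leI)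
      qed
      also have "\<dots> = ennreal (B1\<^sup>2) * (\<integral>\<^sup>+y. ennreal ((green_kernel a \<sigma> (snd p) y (fst p))\<^sup>2) \<partial>lborel)"
        by (rule nn_integral_cmult) measurable
      also have "\<dots> \<le> ennreal (B1\<^sup>2) * ennreal K2" using True by (intro mult_left_mono K2(2)) auto
      also have "\<dots> = ennreal ((w1 p)\<^sup>2)" using True K2(1) by (simp add: w1_def power_mult_distrib ennreal_mult'[symmetric] mult.commute)
      finally show ?thesis .
    qed (simp add: l0)
    show "(\<integral>\<^sup>+y. ennreal ((rhs_kernel \<theta> t y)\<^sup>2) \<partial>lborel) \<le> ennreal ((w2 t)\<^sup>2)" for t
    proof -
      have "(\<integral>\<^sup>+y. ennreal ((rhs_kernel \<theta> t y)\<^sup>2) \<partial>lborel) \<le> (\<integral>\<^sup>+y. ennreal ((B2 * C * indicator {0..R} t)\<^sup>2) * indicator (cball (0 :: real \<times> real) R) y \<partial>lborel)"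
      proof (rule nn_integral_mono)
        fix y
        have "(rhs_kernel \<theta> t y)\<^sup>2 \<le> (B2 * C * indicator {0..R} t * indicator (cball 0 R) y)\<^sup>2"
          using power_mono[OF rle[of t y], of 2] by simp
        then show "ennreal ((rhs_kernel \<theta> t y)\<^sup>2) \<le> ennreal ((B2 * C * indicator {0..R} t)\<^sup>2) * indicator (cball 0 R) y"
          by (cases "y \<in> cball 0 R") (auto simp: ennreal_leI)
      qed
      also have "\<dots> = ennreal ((B2 * C * indicator {0..R} t)\<^sup>2) * emeasure lborel (cball (0 :: real \<times> real) R)"
        by (rule nn_integral_cmult_indicator) simp
      also have "emeasure lborel (cball (0 :: real \<times> real) R) = ennreal (measure lborel (cball (0 :: real \<times> real) R))"
        by (rule emeasure_eq_ennreal_measure) (use emeasure_lborel_cball_finite[of "0 :: real \<times> real" R] in auto)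
      also have "ennreal ((B2 * C * indicator {0..R} t)\<^sup>2) * \<dots> = ennreal ((w2 t)\<^sup>2)"
        by (simp add: w2_def power_mult_distrib ennreal_mult'[symmetric] mult.commute mult.left_commute)
      finally show ?thesis .
    qed
    show "(\<integral>p. \<bar>lhs_kernel \<theta> p y\<bar> \<partial>lborel) \<le> max K1 (B2 * C * R)" for y using K1(3)[of y] by linarith
    show "(\<integral>t. \<bar>rhs_kernel \<theta> t y\<bar> \<partial>lborel) \<le> max K1 (B2 * C * R)" for y using rK[of y] by linarith
  qed (fact K1(2) rint K1(4))+
qed

text \<open>Connects the joint integral over space-time with the iterated integral of
  \<open>weak_lhs\<close>. Since the series of the solution is known to converge only almost
  everywhere, measurability of the integrand is proved from its defining formula, and integrability
  is transferred along the almost everywhere equality.\<close>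

lemma weak_identity:
  assumes \<theta>: "smooth3 \<theta>"
    and s: "AE p in lborel. summable (\<lambda>k. coefficient k \<omega> * lhs_kernel \<theta> p (\<xi> k \<omega>))"
    and i: "integrable lborel (\<lambda>p. \<Sum>k. coefficient k \<omega> * lhs_kernel \<theta> p (\<xi> k \<omega>))"
    and eq: "(\<integral>p. (\<Sum>k. coefficient k \<omega> * lhs_kernel \<theta> p (\<xi> k \<omega>)) \<partial>lborel) =
      (\<integral>t. (\<Sum>k. coefficient k \<omega> * rhs_kernel \<theta> t (\<xi> k \<omega>)) \<partial>lborel)"
  shows "weak_lhs \<alpha> \<phi> E \<xi> g a \<sigma> \<theta> \<omega> = weak_rhs \<alpha> \<phi> E \<xi> g \<sigma> \<theta> \<omega>"
proof -
  define H where "H t x = wave_sol \<alpha> \<phi> E \<xi> g a \<sigma> x t \<omega> * wave_op a \<theta> x t" for t x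
  define S where "S p = (\<Sum>k. coefficient k \<omega> * lhs_kernel \<theta> p (\<xi> k \<omega>))" for p
  have H_eq: "H t x = stable_const \<alpha> * (\<Sum>k. coefficient k \<omega> * green_kernel a \<sigma> x (\<xi> k \<omega>) t) * wave_op a \<theta> x t" for t x
    by (simp add: H_def wave_sol_def stable_integral_def lepage_term_eq)
  have L: "continuous_on UNIV (\<lambda>(x, t). wave_op a \<theta> x t)"
    unfolding split_beta' by (intro smooth3_wave_op_continuous[OF \<theta>] continuous_intros)
  note [measurable] = green_kernel_measurable[OF a_pos sigma_cont] borel_measurable_continuous_curried[OF L]
  have Hm: "(\<lambda>(t, x). H t x) \<in> borel_measurable (lborel \<Otimes>\<^sub>M lborel)"
    unfolding H_eq by measurable
  have HS: "AE p in lborel \<Otimes>\<^sub>M lborel. (\<lambda>(t, x). H t x) p = stable_const \<alpha> * S p"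
    unfolding lborel_prod using s
  proof eventually_elim
    case (elim p)
    show ?case
    \<comment> \<open>Where the wave operator vanishes, the series of the solution may diverge, but
      both sides are 0. Elsewhere dividing by the nonzero factor gives its convergence.\<close>
    proof (cases "wave_op a \<theta> (snd p) (fst p) = 0")
      case True
      then show ?thesis by (simp add: H_eq S_def lhs_kernel_def split_beta')
    next
      case False
      let ?b = "\<lambda>k. coefficient k \<omega> * green_kernel a \<sigma> (snd p) (\<xi> k \<omega>) (fst p)"
      have "summable (\<lambda>k. ?b k * wave_op a \<theta> (snd p) (fst p))" using elim by (simp add: lhs_kernel_def mult.assoc)
      then have "summable ?b" using False by (simp add: mult.commute[of _ "wave_op _ _ _ _"] summable_cmult_iff)
      from suminf_mult2[OF this, of "wave_op a \<theta> (snd p) (fst p)"]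
      show ?thesis by (simp add: H_eq S_def lhs_kernel_def split_beta' mult.assoc)
    qed
  qed
  have iS: "integrable (lborel \<Otimes>\<^sub>M lborel) (\<lambda>p. stable_const \<alpha> * S p)"
    using i by (simp add: S_def lborel_prod)
  have Sm: "(\<lambda>p. stable_const \<alpha> * S p) \<in> borel_measurable (lborel \<Otimes>\<^sub>M lborel)" using iS by (rule borel_measurable_integrable)
  have iH: "integrable (lborel \<Otimes>\<^sub>M lborel) (\<lambda>(t, x). H t x)"
    using integrable_cong_AE[OF Hm Sm HS] iS by simp
  have neg: "H t x = 0" if "t < 0" for t x
    using that by (simp add: H_eq green_kernel_nonpos_time)
  have "weak_lhs \<alpha> \<phi> E \<xi> g a \<sigma> \<theta> \<omega> = (\<integral>t. indicator {0..} t *\<^sub>R (\<integral>x. H t x \<partial>lborel) \<partial>lborel)"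
    by (simp add: weak_lhs_def set_lebesgue_integral_def H_def)
  also have "\<dots> = (\<integral>t. (\<integral>x. H t x \<partial>lborel) \<partial>lborel)"
  proof (intro Bochner_Integration.integral_cong refl)
    fix t :: real
    show "indicator {0..} t *\<^sub>R (\<integral>x. H t x \<partial>lborel) = (\<integral>x. H t x \<partial>lborel)"
      by (cases "0 \<le> t") (simp_all add: neg)
  qed
  also have "\<dots> = (\<integral>p. (\<lambda>(t, x). H t x) p \<partial>(lborel \<Otimes>\<^sub>M lborel))"
    using lborel_pair.integral_fst[OF iH] by simp
  also have "\<dots> = (\<integral>p. stable_const \<alpha> * S p \<partial>(lborel \<Otimes>\<^sub>M lborel))"
    by (rule integral_cong_AE[OF Hm Sm HS])
  also have "\<dots> = stable_const \<alpha> * (\<integral>t. (\<Sum>k. coefficient k \<omega> * rhs_kernel \<theta> t (\<xi> k \<omega>)) \<partial>lborel)"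
    using eq by (simp add: S_def lborel_prod)
  also have "(\<integral>t. (\<Sum>k. coefficient k \<omega> * rhs_kernel \<theta> t (\<xi> k \<omega>)) \<partial>lborel) =
      (LINT t:{0..}|lborel. (\<Sum>k. lepage_term \<alpha> \<phi> E \<xi> g (\<lambda>y. \<theta> y t * \<sigma> y t) k \<omega>))"
    unfolding set_lebesgue_integral_def
    by (intro Bochner_Integration.integral_cong refl) (auto simp: lepage_term_eq rhs_kernel_def indicator_def)
  finally show ?thesis by (simp add: weak_rhs_def)
qed

text \<open>The event is fixed by summability of the coefficients alone, before \<theta> appears;
  only then are the radius and the constant chosen for the given \<theta>.\<close>

lemma weak_identity_small_index:
  assumes "\<alpha> < 1"
  shows "\<exists>\<Omega>0\<in>events. prob \<Omega>0 = 1 \<and>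
    (\<forall>\<omega>\<in>\<Omega>0. \<forall>\<theta>. test_fun \<theta> \<longrightarrow> weak_lhs \<alpha> \<phi> E \<xi> g a \<sigma> \<theta> \<omega> = weak_rhs \<alpha> \<phi> E \<xi> g \<sigma> \<theta> \<omega>)"
proof -
  obtain \<Omega>0 where \<Omega>0: "\<Omega>0 \<subseteq> {\<omega> \<in> space P. \<forall>R. summable (\<lambda>k. \<bar>coefficient k \<omega>\<bar> * indicator (cball 0 R) (\<xi> k \<omega>))}"
    "\<Omega>0 \<in> events" "prob \<Omega>0 = 1"
    using AE_E_prob[OF coefficient_locally_summable[OF \<alpha>_pos assms]] by blast
  have "weak_lhs \<alpha> \<phi> E \<xi> g a \<sigma> \<theta> \<omega> = weak_rhs \<alpha> \<phi> E \<xi> g \<sigma> \<theta> \<omega>" if \<omega>: "\<omega> \<in> \<Omega>0" and \<theta>: "test_fun \<theta>" for \<omega> \<theta>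
  proof -
    obtain R K where k: "\<And>p y. R < norm y \<Longrightarrow> lhs_kernel \<theta> p y = 0" "\<And>t y. R < norm y \<Longrightarrow> rhs_kernel \<theta> t y = 0"
      "\<And>y. integrable lborel (\<lambda>p. lhs_kernel \<theta> p y)" "\<And>y. integrable lborel (\<lambda>t. rhs_kernel \<theta> t y)"
      "\<And>y. (\<integral>p. \<bar>lhs_kernel \<theta> p y\<bar> \<partial>lborel) \<le> K" "\<And>y. (\<integral>t. \<bar>rhs_kernel \<theta> t y\<bar> \<partial>lborel) \<le> K"
      "\<And>y. (\<integral>p. lhs_kernel \<theta> p y \<partial>lborel) = (\<integral>t. rhs_kernel \<theta> t y \<partial>lborel)"
      by (rule kernel_bounds[OF \<theta>]) blast
    have b: "summable (\<lambda>k. \<bar>coefficient k \<omega>\<bar> * indicator (cball 0 R) (\<xi> k \<omega>))" using \<Omega>0 \<omega> by auto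
    show ?thesis
    proof (rule weak_identity)
      show "smooth3 \<theta>" using \<theta> by (simp add: test_fun_def)
      show "AE p in lborel. summable (\<lambda>k. coefficient k \<omega> * lhs_kernel \<theta> p (\<xi> k \<omega>))"
        by (rule integral_suminf_kernel(1)[OF b k(3,5,1)])
      show "integrable lborel (\<lambda>p. \<Sum>k. coefficient k \<omega> * lhs_kernel \<theta> p (\<xi> k \<omega>))"
        by (rule integral_suminf_kernel(2)[OF b k(3,5,1)])
      show "(\<integral>p. (\<Sum>k. coefficient k \<omega> * lhs_kernel \<theta> p (\<xi> k \<omega>)) \<partial>lborel) =
          (\<integral>t. (\<Sum>k. coefficient k \<omega> * rhs_kernel \<theta> t (\<xi> k \<omega>)) \<partial>lborel)"
        using integral_suminf_kernel(3)[where F="lhs_kernel \<theta>", OF b k(3,5,1)]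
          integral_suminf_kernel(3)[where F="rhs_kernel \<theta>", OF b k(4,6,2)] by (simp add: k(7))
    qed
  qed
  then show ?thesis using \<Omega>0 by blast
qed

text \<open>The kernels of the given \<theta> are fed to the stochastic Fubini theorem, and the null
  set it produces depends on them.\<close>

lemma weak_identity_large_index:
  assumes "\<alpha> < 2" and \<theta>: "test_fun \<theta>"
  shows "AE \<omega> in P. weak_lhs \<alpha> \<phi> E \<xi> g a \<sigma> \<theta> \<omega> = weak_rhs \<alpha> \<phi> E \<xi> g \<sigma> \<theta> \<omega>"
proof -
  have sm: "smooth3 \<theta>" using \<theta> by (simp add: test_fun_def)
  obtain R w1 w2 where k: "\<And>p y. R < norm y \<Longrightarrow> lhs_kernel \<theta> p y = 0" "\<And>t y. R < norm y \<Longrightarrow> rhs_kernel \<theta> t y = 0"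
    "\<And>y. integrable lborel (\<lambda>p. lhs_kernel \<theta> p y)" "\<And>y. integrable lborel (\<lambda>t. rhs_kernel \<theta> t y)"
    "\<And>y. (\<integral>p. lhs_kernel \<theta> p y \<partial>lborel) = (\<integral>t. rhs_kernel \<theta> t y \<partial>lborel)"
    "integrable lborel w1" "\<And>p. 0 \<le> w1 p" "\<And>p. (\<integral>\<^sup>+y. ennreal ((lhs_kernel \<theta> p y)\<^sup>2) \<partial>lborel) \<le> ennreal ((w1 p)\<^sup>2)"
    "integrable lborel w2" "\<And>t. 0 \<le> w2 t" "\<And>t. (\<integral>\<^sup>+y. ennreal ((rhs_kernel \<theta> t y)\<^sup>2) \<partial>lborel) \<le> ennreal ((w2 t)\<^sup>2)"
    by (rule kernel_bounds[OF \<theta>]) blast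
  have "AE \<omega> in P. (AE p in lborel. summable (\<lambda>k. coefficient k \<omega> * lhs_kernel \<theta> p (\<xi> k \<omega>))) \<and>
    integrable lborel (\<lambda>p. \<Sum>k. coefficient k \<omega> * lhs_kernel \<theta> p (\<xi> k \<omega>)) \<and>
    (\<integral>p. (\<Sum>k. coefficient k \<omega> * lhs_kernel \<theta> p (\<xi> k \<omega>)) \<partial>lborel) =
    (\<integral>p. (\<Sum>k. coefficient k \<omega> * rhs_kernel \<theta> p (\<xi> k \<omega>)) \<partial>lborel)"
    by (rule lepage_fubini_eq[OF \<alpha>_pos assms(1) lborel.sigma_finite_measure_axioms lhs_kernel_measurable[OF sm] k(6,7,8,3)
        lborel.sigma_finite_measure_axioms rhs_kernel_measurable[OF sm] k(9,10,11,4,1,2,5)])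
  then show ?thesis by eventually_elim (auto intro: weak_identity[OF sm])
qed

end


theorem theorem3:
  fixes P :: "'w measure" and \<alpha> a C :: real
    and \<phi> :: "real \<times> real \<Rightarrow> real"
    and E :: "nat \<Rightarrow> 'w \<Rightarrow> real" and \<xi> :: "nat \<Rightarrow> 'w \<Rightarrow> real \<times> real"
    and g :: "nat \<Rightarrow> 'w \<Rightarrow> real"
    and \<sigma> :: "real \<times> real \<Rightarrow> real \<Rightarrow> real"
  assumes data: "lepage_data P \<alpha> \<phi> E \<xi> g"
    and a_pos: "0 < a"
    and alpha: "0 < \<alpha>" "\<alpha> < 2"
    and sigma_bdd: "\<forall>x t. 0 \<le> t \<longrightarrow> \<bar>\<sigma> x t\<bar> \<le> C"
    and sigma_cont: "continuous_on {p. 0 \<le> snd p} (\<lambda>(x, t). \<sigma> x t)"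
  shows "(\<alpha> < 1 \<longrightarrow>
            (\<exists>\<Omega>0\<in>sets P. prob_space.prob P \<Omega>0 = 1 \<and>
               (\<forall>\<omega>\<in>\<Omega>0. \<forall>\<theta>. test_fun \<theta> \<longrightarrow>
                  weak_lhs \<alpha> \<phi> E \<xi> g a \<sigma> \<theta> \<omega> = weak_rhs \<alpha> \<phi> E \<xi> g \<sigma> \<theta> \<omega>)))
       \<and> (1 \<le> \<alpha> \<longrightarrow>
            (\<forall>\<theta>. test_fun \<theta> \<longrightarrow>
               (AE \<omega> in P. weak_lhs \<alpha> \<phi> E \<xi> g a \<sigma> \<theta> \<omega> = weak_rhs \<alpha> \<phi> E \<xi> g \<sigma> \<theta> \<omega>)))"
proof -
  \<comment> \<open>Nothing is known about \<open>\<sigma>\<close> at negative times.\<close>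
  define \<sigma>' where "\<sigma>' x t = \<sigma> x (max 0 t)" for x t
  have "continuous_on UNIV (\<lambda>p. (\<lambda>(x, t). \<sigma> x t) (fst p, max 0 (snd p)))"
    by (rule continuous_on_compose2[OF sigma_cont]) (auto intro!: continuous_intros)
  then have cont: "continuous_on UNIV (\<lambda>(x, t). \<sigma>' x t)" by (simp add: \<sigma>'_def split_beta')
  have bdd: "\<bar>\<sigma>' x t\<bar> \<le> C" for x t using sigma_bdd by (simp add: \<sigma>'_def del: split_paired_All)
  interpret wave_equation_data P \<alpha> \<phi> E \<xi> g a C \<sigma>'
    by unfold_locales (use data a_pos alpha bdd cont in auto)
  \<comment> \<open>In Duhamel's form only emission times \<tau> \<ge> 0 enter, where \<sigma> and
    its extension agree.\<close>
  have "green_kernel a \<sigma> = green_kernel a \<sigma>'"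
    unfolding green_kernel_eq[OF a_pos] fun_eq_iff
    by (intro allI Bochner_Integration.integral_cong refl) (simp add: \<sigma>'_def)
  then have lhs: "weak_lhs \<alpha> \<phi> E \<xi> g a \<sigma> \<theta> \<omega> = weak_lhs \<alpha> \<phi> E \<xi> g a \<sigma>' \<theta> \<omega>" for \<theta> \<omega>
    by (simp add: weak_lhs_def wave_sol_def)
  have rhs: "weak_rhs \<alpha> \<phi> E \<xi> g \<sigma> \<theta> \<omega> = weak_rhs \<alpha> \<phi> E \<xi> g \<sigma>' \<theta> \<omega>" for \<theta> \<omega>
    unfolding weak_rhs_def
    by (intro arg_cong[where f="(*) _"] set_lebesgue_integral_cong) (auto simp: \<sigma>'_def)
  show ?thesis unfolding lhs rhs
    using weak_identity_small_index weak_identity_large_index[OF alpha(2)] by blast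
qed

end
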